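(* Let $S$ be a commutative ring, let $\mathsf{C}$ be an additive self-orthogonal subcategory of $\mathrm{Mod}(S)$, let $f\in S$ be $S$-regular and $\mathsf{C}$-regular, and set $R=S/(f)$. Then the triangulated functor $\mathsf{T}:\mathsf{HF}(\mathsf{C},f)\to \mathsf{K}_{\mathrm{tac}}(R\otimes_S\mathsf{C})$, defined by $\mathsf{T}(M,d)=T^M$ and $\mathsf{T}([\alpha])=[\overline{\alpha}]$, is full and faithful.
   Context: Subcategories of $\mathrm{Mod}(S)$, the category of $S$-modules, are full and closed under isomorphisms. $\mathsf{C}$ is self-orthogonal if $\mathrm{Ext}_S^i(C,C')=0$ for all $C,C'\in\mathsf{C}$, $i\ge 1$ (similarly over $R$). The element $f$ is $M$-regular if $fx=0$ implies $x=0$ for each $x\in M$, and $\mathsf{C}$-regular if it is $M$-regular for every $M\in\mathsf{C}$. $R\otimes_S\mathsf{C}$ is the category of $R$-modules isomorphic to $R\otimes_S C$ for some $C\in\mathsf{C}$; under the given hypotheses it is self-orthogonal in $\mathrm{Mod}(R)$. A $\mathsf{C}$-factorization $(M,d)$ of $f$ consists of $M_0,M_1\in\mathsf{C}$ and $S$-linear maps $d_1:M_1\to M_0$, $d_0:M_0\to M_1$ with $d_1d_0=f1^{M_0}$, $d_0d_1=f1^{M_1}$. A morphism $\alpha:(M,d)\to(M',d')$ is a pair $\alpha_i:M_i\to M_i'$ ($i=0,1$) with $\alpha_0d_1=d_1'\alpha_1$ and $\alpha_1d_0=d_0'\alpha_0$. Morphisms $\alpha,\beta$ are homotopic if there are $h_0:M_0\to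 M_1'$, $h_1:M_1\to M_0'$ with $\alpha_0-\beta_0=h_1d_0+d_1'h_0$ and $\alpha_1-\beta_1=h_0d_1+d_0'h_1$. $\mathsf{HF}(\mathsf{C},f)$ has $\mathsf{C}$-factorizations of $f$ as objects and homotopy classes of morphisms as morphisms. It carries the usual triangulated structure: the shift interchanges $M_0$ and $M_1$ and changes the sign of $d$; exact triangles are those isomorphic to the ones coming from mapping cones, where the cone of $\alpha:M\to M'$ has components $M_i'\oplus M_{i-1}$ (indices mod 2) and differential $\begin{pmatrix} d' & \alpha\\ 0&-d\end{pmatrix}$. For a self-orthogonal category $\mathsf{W}$ of $R$-modules, an $R$-complex $T$ is $\mathsf{W}$-totally acyclic if it is acyclic, $T_i\in\mathsf{W}$ for all $i\in\mathbb{Z}$, and $\mathrm{Hom}_R(T,W)$ and $\mathrm{Hom}_R(W,T)$ are acyclic for every $W\in\mathsf{W}$. $\mathsf{K}_{\mathrm{tac}}(\mathsf{W})$ is the homotopy category of $\mathsf{W}$-totally acyclic complexes (morphisms are homotopy classes of degree $0$ chain maps), with its usual triangulated structure. With $\overline{(-)}=R\otimes_S-$, $T^M$ is the 2-periodic complex $\cdots\xrightarrow{\overline{d_0}}\overline{M_1}\xrightarrow{\overline{d_1}}\overline{M_0}\xrightarrow{\overline{d_0}}\overline{M_1}\xrightarrow{\overline{d_1}}\cdots$ with $\overline{M_0}$ in even degrees and $\overline{M_1}$ in odd degrees; it is $R\otimes_S\mathsf{C}$-totally acyclic. For a morphism $\alpha$, $\overline{\alpha}:T^M\to T^{M'}$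 is the induced 2-periodic chain map. *)

theory Defs
  imports "HOL-Algebra.Module" "HOL-Algebra.QuotRing" "HOL-Library.FuncSet"
begin

section \<open>Linear maps and modules of linear maps\<close>

text \<open>
  Maps between modules are total functions of which only the values on the carrier of the source
  matter; equations between maps are always stated on carriers.  The fields \<^const>\<open>mult\<close> and
  \<^const>\<open>one\<close> which the type of modules inherits from rings are irrelevant and are left undefined
  in the constructions below.
\<close>

definition lin_hom :: "('a, 'x) ring_scheme \<Rightarrow> ('a, 'b) module \<Rightarrow> ('a, 'c) module \<Rightarrow> ('b \<Rightarrow> 'c) set"
  where "lin_hom R M N =
    {h \<in> carrier M \<rightarrow> carrier N.
       (\<forall>x \<in> carrier M. \<forall>y \<in> carrier M. h (x \<oplus>\<^bsub>M\<^esub> y) = h x \<oplus>\<^bsub>N\<^esub> h y) \<and>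
       (\<forall>r \<in> carrier R. \<forall>x \<in> carrier M. h (r \<odot>\<^bsub>M\<^esub> x) = r \<odot>\<^bsub>N\<^esub> h x)}"

definition iso_modules :: "('a, 'x) ring_scheme \<Rightarrow> ('a, 'b) module \<Rightarrow> ('a, 'c) module \<Rightarrow> bool"
  where "iso_modules R M N \<longleftrightarrow> (\<exists>h \<in> lin_hom R M N. bij_betw h (carrier M) (carrier N))"

definition zero_module :: "('a, 'b) module \<Rightarrow> bool"
  where "zero_module M \<longleftrightarrow> carrier M = {\<zero>\<^bsub>M\<^esub>}"

definition hom_module ::
    "('a, 'x) ring_scheme \<Rightarrow> ('a, 'b) module \<Rightarrow> ('a, 'c) module \<Rightarrow> ('a, 'b \<Rightarrow> 'c) module"
  where "hom_module R M N =
    \<lparr> carrier = lin_hom R M N \<inter> extensional (carrier M),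
      mult = undefined,
      one = undefined,
      zero = (\<lambda>x \<in> carrier M. \<zero>\<^bsub>N\<^esub>),
      add = (\<lambda>g h. \<lambda>x \<in> carrier M. g x \<oplus>\<^bsub>N\<^esub> h x),
      smult = (\<lambda>r h. \<lambda>x \<in> carrier M. r \<odot>\<^bsub>N\<^esub> h x) \<rparr>"

definition quotient_module :: "('a, 'b) module \<Rightarrow> 'b set \<Rightarrow> ('a, 'b set) module"
  where "quotient_module M K =
    \<lparr> carrier = a_rcosets\<^bsub>M\<^esub> K,
      mult = undefined,
      one = undefined,
      zero = K,
      add = set_add M,
      smult = (\<lambda>r X. \<Union>x \<in> X. K +>\<^bsub>M\<^esub> (r \<odot>\<^bsub>M\<^esub> x)) \<rparr>"

definition submodule_generated :: "('a, 'x) ring_scheme \<Rightarrow> ('a, 'b) module \<Rightarrow> 'b set \<Rightarrow> 'b set"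
  where "submodule_generated R M X = \<Inter>{K. submodule K R M \<and> X \<subseteq> K}"

definition free_module :: "('a, 'x) ring_scheme \<Rightarrow> 'b set \<Rightarrow> ('a, 'b \<Rightarrow> 'a) module"
  where "free_module R B =
    \<lparr> carrier = {c. (\<forall>b. c b \<in> carrier R) \<and> (\<forall>b. b \<notin> B \<longrightarrow> c b = \<zero>\<^bsub>R\<^esub>) \<and> finite {b. c b \<noteq> \<zero>\<^bsub>R\<^esub>}},
      mult = undefined,
      one = undefined,
      zero = (\<lambda>b. \<zero>\<^bsub>R\<^esub>),
      add = (\<lambda>c c' b. c b \<oplus>\<^bsub>R\<^esub> c' b),
      smult = (\<lambda>r c b. r \<otimes>\<^bsub>R\<^esub> c b) \<rparr>"

definition free_gen :: "('a, 'x) ring_scheme \<Rightarrow> 'b \<Rightarrow> 'b \<Rightarrow> 'a"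
  where "free_gen R b = (\<lambda>b'. if b' = b then \<one>\<^bsub>R\<^esub> else \<zero>\<^bsub>R\<^esub>)"

text \<open>
  \<open>P\<close> together with \<open>i\<close>, \<open>j\<close>, \<open>p\<close>, \<open>q\<close> is a direct sum of \<open>A\<close> and \<open>B\<close>: the inclusions are
  \<open>i: A \<rightarrow> P\<close> and \<open>j: B \<rightarrow> P\<close>, the projections are \<open>p: P \<rightarrow> A\<close> and \<open>q: P \<rightarrow> B\<close>.
\<close>

definition direct_sum ::
    "('a, 'x) ring_scheme \<Rightarrow> ('a, 'b) module \<Rightarrow> ('a, 'b) module \<Rightarrow> ('a, 'b) module \<Rightarrow>
     ('b \<Rightarrow> 'b) \<Rightarrow> ('b \<Rightarrow> 'b) \<Rightarrow> ('b \<Rightarrow> 'b) \<Rightarrow> ('b \<Rightarrow> 'b) \<Rightarrow> bool"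
  where "direct_sum R A B P i j p q \<longleftrightarrow>
    i \<in> lin_hom R A P \<and> j \<in> lin_hom R B P \<and> p \<in> lin_hom R P A \<and> q \<in> lin_hom R P B \<and>
    (\<forall>a \<in> carrier A. p (i a) = a \<and> q (i a) = \<zero>\<^bsub>B\<^esub>) \<and>
    (\<forall>b \<in> carrier B. p (j b) = \<zero>\<^bsub>A\<^esub> \<and> q (j b) = b) \<and>
    (\<forall>x \<in> carrier P. i (p x) \<oplus>\<^bsub>P\<^esub> j (q x) = x)"


section \<open>Complexes, homology and Ext\<close>

text \<open>Homological indexing: \<^term>\<open>cdiff X i\<close> maps \<^term>\<open>cmod X i\<close> to \<^term>\<open>cmod X (i - 1)\<close>.\<close>

record ('a, 'b) chain_complex =
  cmod :: "int \<Rightarrow> ('a, 'b) module"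
  cdiff :: "int \<Rightarrow> 'b \<Rightarrow> 'b"

definition is_complex :: "('a, 'x) ring_scheme \<Rightarrow> ('a, 'b) chain_complex \<Rightarrow> bool"
  where "is_complex R X \<longleftrightarrow>
    (\<forall>i. module R (cmod X i)) \<and>
    (\<forall>i. cdiff X i \<in> lin_hom R (cmod X i) (cmod X (i - 1))) \<and>
    (\<forall>i. \<forall>x \<in> carrier (cmod X i). cdiff X (i - 1) (cdiff X i x) = \<zero>\<^bsub>cmod X (i - 2)\<^esub>)"

definition cycles :: "('a, 'b) chain_complex \<Rightarrow> int \<Rightarrow> 'b set"
  where "cycles X i = {x \<in> carrier (cmod X i). cdiff X i x = \<zero>\<^bsub>cmod X (i - 1)\<^esub>}"

definition boundaries :: "('a, 'b) chain_complex \<Rightarrow> int \<Rightarrow> 'b set"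
  where "boundaries X i = cdiff X (i + 1) ` carrier (cmod X (i + 1))"

definition homology :: "('a, 'b) chain_complex \<Rightarrow> int \<Rightarrow> ('a, 'b set) module"
  where "homology X i = quotient_module ((cmod X i)\<lparr>carrier := cycles X i\<rparr>) (boundaries X i)"

definition acyclic_complex :: "('a, 'b) chain_complex \<Rightarrow> bool"
  where "acyclic_complex X \<longleftrightarrow> (\<forall>i. cycles X i = boundaries X i)"

text \<open>
  The complexes \<open>Hom(X, N)\<close> and \<open>Hom(N, X)\<close>; a map from \<open>X\<^sub>k\<close> to \<open>N\<close> has degree \<open>-k\<close>.  The
  customary signs in the differential of \<open>Hom(X, N)\<close> are omitted, as they affect neither cycles
  nor boundaries.
\<close>

definition hom_from ::
    "('a, 'x) ring_scheme \<Rightarrow> ('a, 'b) chain_complex \<Rightarrow> ('a, 'c) module \<Rightarrow> ('a, 'b \<Rightarrow> 'c) chain_complex"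
  where "hom_from R X N =
    \<lparr> cmod = (\<lambda>i. hom_module R (cmod X (- i)) N),
      cdiff = (\<lambda>i h. \<lambda>x \<in> carrier (cmod X (1 - i)). h (cdiff X (1 - i) x)) \<rparr>"

definition hom_to ::
    "('a, 'x) ring_scheme \<Rightarrow> ('a, 'c) module \<Rightarrow> ('a, 'b) chain_complex \<Rightarrow> ('a, 'c \<Rightarrow> 'b) chain_complex"
  where "hom_to R N X =
    \<lparr> cmod = (\<lambda>i. hom_module R N (cmod X i)),
      cdiff = (\<lambda>i h. \<lambda>x \<in> carrier N. cdiff X i (h x)) \<rparr>"

text \<open>
  Free resolutions \<open>\<dots> \<rightarrow> P\<^sub>1 \<rightarrow> P\<^sub>0 \<rightarrow> M \<rightarrow> 0\<close>, as complexes vanishing in negative degrees.  The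
  bases are sets of words in elements of \<open>R\<close> and \<open>M\<close>.  This type is infinite and at least as large
  as \<open>R\<close> and \<open>M\<close>, hence large enough to index generators of \<open>M\<close> and of all iterated syzygies.
\<close>

definition free_resolutions ::
    "('a, 'x) ring_scheme \<Rightarrow> ('a, 'b) module \<Rightarrow> ('a, ('a + 'b) list \<Rightarrow> 'a) chain_complex set"
  where "free_resolutions R M =
    {P. is_complex R P \<and>
        (\<forall>n. \<exists>B. cmod P n = free_module R B) \<and>
        (\<forall>n < 0. zero_module (cmod P n)) \<and>
        (\<forall>n \<ge> 1. cycles P n = boundaries P n) \<and>
        (\<exists>e \<in> lin_hom R (cmod P 0) M.
           e ` carrier (cmod P 0) = carrier M \<and>
           {x \<in> carrier (cmod P 0). e x = \<zero>\<^bsub>M\<^esub>} = boundaries P 0)}"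

definition Ext ::
    "('a, 'x) ring_scheme \<Rightarrow> nat \<Rightarrow> ('a, 'b) module \<Rightarrow> ('a, 'c) module \<Rightarrow>
     ('a, ((('a + 'b) list \<Rightarrow> 'a) \<Rightarrow> 'c) set) module"
  where "Ext R i M N = homology (hom_from R (SOME P. P \<in> free_resolutions R M) N) (- int i)"


section \<open>Subcategories of the module category\<close>

text \<open>
  A full subcategory is given by its set of objects, which are modules with carrier contained in
  an arbitrary fixed type.
\<close>

definition additive_subcategory :: "('a, 'x) ring_scheme \<Rightarrow> ('a, 'b) module set \<Rightarrow> bool"
  where "additive_subcategory R C \<longleftrightarrow>
    (\<forall>M \<in> C. module R M) \<and>
    (\<forall>M \<in> C. \<forall>N. module R N \<and> iso_modules R M N \<longrightarrow> N \<in> C) \<and>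
    (\<exists>Z \<in> C. zero_module Z) \<and>
    (\<forall>A \<in> C. \<forall>B \<in> C. \<exists>P \<in> C. \<exists>i j p q. direct_sum R A B P i j p q)"

definition self_orthogonal :: "('a, 'x) ring_scheme \<Rightarrow> ('a, 'b) module set \<Rightarrow> bool"
  where "self_orthogonal R C \<longleftrightarrow> (\<forall>M \<in> C. \<forall>N \<in> C. \<forall>i \<ge> 1. zero_module (Ext R i M N))"

definition module_regular :: "('a, 'b) module \<Rightarrow> 'a \<Rightarrow> bool"
  where "module_regular M f \<longleftrightarrow> (\<forall>x \<in> carrier M. f \<odot>\<^bsub>M\<^esub> x = \<zero>\<^bsub>M\<^esub> \<longrightarrow> x = \<zero>\<^bsub>M\<^esub>)"

definition ring_regular :: "('a, 'x) ring_scheme \<Rightarrow> 'a \<Rightarrow> bool"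
  where "ring_regular R f \<longleftrightarrow> (\<forall>x \<in> carrier R. f \<otimes>\<^bsub>R\<^esub> x = \<zero>\<^bsub>R\<^esub> \<longrightarrow> x = \<zero>\<^bsub>R\<^esub>)"


section \<open>Extension of scalars\<close>

text \<open>
  For a ring homomorphism \<open>g: S \<rightarrow> R\<close> and an \<open>S\<close>-module \<open>M\<close>, the \<open>R\<close>-module \<open>R \<otimes>\<^sub>S M\<close> is
  the free \<open>R\<close>-module on the symbols \<open>(r, m)\<close> modulo the relations that make \<open>(r, m)\<close> additive in
  both arguments, \<open>S\<close>-balanced, and \<open>R\<close>-linear in the first argument.
\<close>

definition tensor_free :: "('r, 'y) ring_scheme \<Rightarrow> ('a, 'b) module \<Rightarrow> ('r, 'r \<times> 'b \<Rightarrow> 'r) module"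
  where "tensor_free R M = free_module R (carrier R \<times> carrier M)"

definition tensor_relations ::
    "('a, 'x) ring_scheme \<Rightarrow> ('r, 'y) ring_scheme \<Rightarrow> ('a \<Rightarrow> 'r) \<Rightarrow> ('a, 'b) module \<Rightarrow> ('r \<times> 'b \<Rightarrow> 'r) set"
  where "tensor_relations S R g M = (let F = tensor_free R M; e = (\<lambda>r m. free_gen R (r, m)) in
    {e (r \<oplus>\<^bsub>R\<^esub> r') m \<ominus>\<^bsub>F\<^esub> (e r m \<oplus>\<^bsub>F\<^esub> e r' m) | r r' m.
       r \<in> carrier R \<and> r' \<in> carrier R \<and> m \<in> carrier M} \<union>
    {e r (m \<oplus>\<^bsub>M\<^esub> m') \<ominus>\<^bsub>F\<^esub> (e r m \<oplus>\<^bsub>F\<^esub> e r m') | r m m'.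
       r \<in> carrier R \<and> m \<in> carrier M \<and> m' \<in> carrier M} \<union>
    {e (r \<otimes>\<^bsub>R\<^esub> g s) m \<ominus>\<^bsub>F\<^esub> e r (s \<odot>\<^bsub>M\<^esub> m) | r s m.
       r \<in> carrier R \<and> s \<in> carrier S \<and> m \<in> carrier M} \<union>
    {e (r \<otimes>\<^bsub>R\<^esub> r') m \<ominus>\<^bsub>F\<^esub> (r \<odot>\<^bsub>F\<^esub> e r' m) | r r' m.
       r \<in> carrier R \<and> r' \<in> carrier R \<and> m \<in> carrier M})"

definition tensor_kernel ::
    "('a, 'x) ring_scheme \<Rightarrow> ('r, 'y) ring_scheme \<Rightarrow> ('a \<Rightarrow> 'r) \<Rightarrow> ('a, 'b) module \<Rightarrow> ('r \<times> 'b \<Rightarrow> 'r) set"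
  where "tensor_kernel S R g M =
    submodule_generated R (tensor_free R M) (tensor_relations S R g M)"

definition base_change ::
    "('a, 'x) ring_scheme \<Rightarrow> ('r, 'y) ring_scheme \<Rightarrow> ('a \<Rightarrow> 'r) \<Rightarrow> ('a, 'b) module \<Rightarrow>
     ('r, ('r \<times> 'b \<Rightarrow> 'r) set) module"
  where "base_change S R g M = quotient_module (tensor_free R M) (tensor_kernel S R g M)"

text \<open>
  The map \<open>R \<otimes>\<^sub>S h: R \<otimes>\<^sub>S M \<rightarrow> R \<otimes>\<^sub>S N\<close>, sending the class of \<open>\<Sum> c(r, m) (r, m)\<close> to the
  class of \<open>\<Sum> c(r, m) (r, h m)\<close>.
\<close>

definition base_change_map ::
    "('a, 'x) ring_scheme \<Rightarrow> ('r, 'y) ring_scheme \<Rightarrow> ('a \<Rightarrow> 'r) \<Rightarrow> ('a, 'c) module \<Rightarrow> ('b \<Rightarrow> 'c) \<Rightarrow>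
     ('r \<times> 'b \<Rightarrow> 'r) set \<Rightarrow> ('r \<times> 'c \<Rightarrow> 'r) set"
  where "base_change_map S R g N h X = (let F = tensor_free R N in
    (\<Union>c \<in> X. tensor_kernel S R g N +>\<^bsub>F\<^esub>
       (\<Oplus>\<^bsub>F\<^esub>z \<in> {z. c z \<noteq> \<zero>\<^bsub>R\<^esub>}. c z \<odot>\<^bsub>F\<^esub> free_gen R (fst z, h (snd z)))))"

definition base_change_subcategory ::
    "('a, 'x) ring_scheme \<Rightarrow> ('r, 'y) ring_scheme \<Rightarrow> ('a \<Rightarrow> 'r) \<Rightarrow> ('a, 'b) module set \<Rightarrow>
     ('r, 'q) module set"
  where "base_change_subcategory S R g C =
    {N. module R N \<and> (\<exists>M \<in> C. iso_modules R N (base_change S R g M))}"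


section \<open>Data of triangulated categories, and functors between them\<close>

text \<open>
  Hom sets of different pairs of objects need not be disjoint, so operations on morphisms take the
  objects involved as arguments: \<open>Comp A X Y Z b a\<close> is the composite of \<open>a: X \<rightarrow> Y\<close> and
  \<open>b: Y \<rightarrow> Z\<close>.  \<open>Std A X Y Z u v w\<close> says that \<open>X \<rightarrow> Y \<rightarrow> Z \<rightarrow> \<Sigma>X\<close> is a
  standard triangle (one coming from a mapping cone); the exact triangles are those isomorphic to
  standard ones.
\<close>

record ('o, 'h) tri_category =
  Obj :: "'o set"
  Hom :: "'o \<Rightarrow> 'o \<Rightarrow> 'h set"
  Ident :: "'o \<Rightarrow> 'h"
  Comp :: "'o \<Rightarrow> 'o \<Rightarrow> 'o \<Rightarrow> 'h \<Rightarrow> 'h \<Rightarrow> 'h"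
  Plus :: "'o \<Rightarrow> 'o \<Rightarrow> 'h \<Rightarrow> 'h \<Rightarrow> 'h"
  ShiftO :: "'o \<Rightarrow> 'o"
  ShiftH :: "'o \<Rightarrow> 'o \<Rightarrow> 'h \<Rightarrow> 'h"
  Std :: "'o \<Rightarrow> 'o \<Rightarrow> 'o \<Rightarrow> 'h \<Rightarrow> 'h \<Rightarrow> 'h \<Rightarrow> bool"

definition iso_arrow :: "('o, 'h) tri_category \<Rightarrow> 'o \<Rightarrow> 'o \<Rightarrow> 'h \<Rightarrow> bool"
  where "iso_arrow A X Y a \<longleftrightarrow>
    a \<in> Hom A X Y \<and>
    (\<exists>b \<in> Hom A Y X. Comp A X Y X b a = Ident A X \<and> Comp A Y X Y a b = Ident A Y)"

definition exact_triangle ::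
    "('o, 'h) tri_category \<Rightarrow> 'o \<Rightarrow> 'o \<Rightarrow> 'o \<Rightarrow> 'h \<Rightarrow> 'h \<Rightarrow> 'h \<Rightarrow> bool"
  where "exact_triangle A X Y Z u v w \<longleftrightarrow>
    X \<in> Obj A \<and> Y \<in> Obj A \<and> Z \<in> Obj A \<and>
    u \<in> Hom A X Y \<and> v \<in> Hom A Y Z \<and> w \<in> Hom A Z (ShiftO A X) \<and>
    (\<exists>X' Y' Z' u' v' w' a b c.
       X' \<in> Obj A \<and> Y' \<in> Obj A \<and> Z' \<in> Obj A \<and> Std A X' Y' Z' u' v' w' \<and>
       iso_arrow A X X' a \<and> iso_arrow A Y Y' b \<and> iso_arrow A Z Z' c \<and>
       Comp A X Y Y' b u = Comp A X X' Y' u' a \<and>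
       Comp A Y Z Z' c v = Comp A Y Y' Z' v' b \<and>
       Comp A Z (ShiftO A X) (ShiftO A X') (ShiftH A X X' a) w =
         Comp A Z Z' (ShiftO A X') w' c)"

definition additive_functor ::
    "('o, 'h) tri_category \<Rightarrow> ('p, 'k) tri_category \<Rightarrow> ('o \<Rightarrow> 'p) \<Rightarrow> ('o \<Rightarrow> 'o \<Rightarrow> 'h \<Rightarrow> 'k) \<Rightarrow> bool"
  where "additive_functor A B Fo Fh \<longleftrightarrow>
    (\<forall>X \<in> Obj A. Fo X \<in> Obj B) \<and>
    (\<forall>X \<in> Obj A. \<forall>Y \<in> Obj A. \<forall>a \<in> Hom A X Y. Fh X Y a \<in> Hom B (Fo X) (Fo Y)) \<and>
    (\<forall>X \<in> Obj A. Fh X X (Ident A X) = Ident B (Fo X)) \<and>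
    (\<forall>X \<in> Obj A. \<forall>Y \<in> Obj A. \<forall>Z \<in> Obj A. \<forall>a \<in> Hom A X Y. \<forall>b \<in> Hom A Y Z.
       Fh X Z (Comp A X Y Z b a) = Comp B (Fo X) (Fo Y) (Fo Z) (Fh Y Z b) (Fh X Y a)) \<and>
    (\<forall>X \<in> Obj A. \<forall>Y \<in> Obj A. \<forall>a \<in> Hom A X Y. \<forall>b \<in> Hom A X Y.
       Fh X Y (Plus A X Y a b) = Plus B (Fo X) (Fo Y) (Fh X Y a) (Fh X Y b))"

text \<open>
  An additive functor \<open>F\<close> is triangulated if there is a natural isomorphism \<open>t\<close> from \<open>F\<Sigma>\<close> to
  \<open>\<Sigma>F\<close> through which \<open>F\<close> sends exact triangles to exact triangles.
\<close>

definition triangulated_functor ::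
    "('o, 'h) tri_category \<Rightarrow> ('p, 'k) tri_category \<Rightarrow> ('o \<Rightarrow> 'p) \<Rightarrow> ('o \<Rightarrow> 'o \<Rightarrow> 'h \<Rightarrow> 'k) \<Rightarrow> bool"
  where "triangulated_functor A B Fo Fh \<longleftrightarrow>
    additive_functor A B Fo Fh \<and>
    (\<exists>t.
      (\<forall>X \<in> Obj A. iso_arrow B (Fo (ShiftO A X)) (ShiftO B (Fo X)) (t X)) \<and>
      (\<forall>X \<in> Obj A. \<forall>Y \<in> Obj A. \<forall>a \<in> Hom A X Y.
        Comp B (Fo (ShiftO A X)) (Fo (ShiftO A Y)) (ShiftO B (Fo Y))
          (t Y) (Fh (ShiftO A X) (ShiftO A Y) (ShiftH A X Y a)) =
        Comp B (Fo (ShiftO A X)) (ShiftO B (Fo X)) (ShiftO B (Fo Y))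
          (ShiftH B (Fo X) (Fo Y) (Fh X Y a)) (t X)) \<and>
      (\<forall>X Y Z u v w. exact_triangle A X Y Z u v w \<longrightarrow>
        exact_triangle B (Fo X) (Fo Y) (Fo Z) (Fh X Y u) (Fh Y Z v)
          (Comp B (Fo Z) (Fo (ShiftO A X)) (ShiftO B (Fo X)) (t X) (Fh Z (ShiftO A X) w))))"

definition full_functor ::
    "('o, 'h) tri_category \<Rightarrow> ('p, 'k) tri_category \<Rightarrow> ('o \<Rightarrow> 'p) \<Rightarrow> ('o \<Rightarrow> 'o \<Rightarrow> 'h \<Rightarrow> 'k) \<Rightarrow> bool"
  where "full_functor A B Fo Fh \<longleftrightarrow>
    (\<forall>X \<in> Obj A. \<forall>Y \<in> Obj A. Hom B (Fo X) (Fo Y) \<subseteq> Fh X Y ` Hom A X Y)"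

definition faithful_functor ::
    "('o, 'h) tri_category \<Rightarrow> ('p, 'k) tri_category \<Rightarrow> ('o \<Rightarrow> 'p) \<Rightarrow> ('o \<Rightarrow> 'o \<Rightarrow> 'h \<Rightarrow> 'k) \<Rightarrow> bool"
  where "faithful_functor A B Fo Fh \<longleftrightarrow> (\<forall>X \<in> Obj A. \<forall>Y \<in> Obj A. inj_on (Fh X Y) (Hom A X Y))"


section \<open>The homotopy category of factorizations\<close>

text \<open>\<open>dif1: fac1 \<rightarrow> fac0\<close> and \<open>dif0: fac0 \<rightarrow> fac1\<close>.\<close>

record ('a, 'b) factorization =
  fac0 :: "('a, 'b) module"
  fac1 :: "('a, 'b) module"
  dif0 :: "'b \<Rightarrow> 'b"
  dif1 :: "'b \<Rightarrow> 'b"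

definition factorizations ::
    "('a, 'x) ring_scheme \<Rightarrow> ('a, 'b) module set \<Rightarrow> 'a \<Rightarrow> ('a, 'b) factorization set"
  where "factorizations S C f =
    {M. fac0 M \<in> C \<and> fac1 M \<in> C \<and>
        dif1 M \<in> lin_hom S (fac1 M) (fac0 M) \<and> dif0 M \<in> lin_hom S (fac0 M) (fac1 M) \<and>
        (\<forall>x \<in> carrier (fac0 M). dif1 M (dif0 M x) = f \<odot>\<^bsub>fac0 M\<^esub> x) \<and>
        (\<forall>x \<in> carrier (fac1 M). dif0 M (dif1 M x) = f \<odot>\<^bsub>fac1 M\<^esub> x)}"

text \<open>A morphism is a pair \<open>(\<alpha>\<^sub>0, \<alpha>\<^sub>1)\<close>.\<close>

definition fac_mor ::
    "('a, 'x) ring_scheme \<Rightarrow> ('a, 'b) factorization \<Rightarrow> ('a, 'b) factorization \<Rightarrow>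
     (('b \<Rightarrow> 'b) \<times> ('b \<Rightarrow> 'b)) set"
  where "fac_mor S M N =
    {(\<alpha>0, \<alpha>1). \<alpha>0 \<in> lin_hom S (fac0 M) (fac0 N) \<and> \<alpha>1 \<in> lin_hom S (fac1 M) (fac1 N) \<and>
       (\<forall>x \<in> carrier (fac1 M). \<alpha>0 (dif1 M x) = dif1 N (\<alpha>1 x)) \<and>
       (\<forall>x \<in> carrier (fac0 M). \<alpha>1 (dif0 M x) = dif0 N (\<alpha>0 x))}"

definition fac_homotopic ::
    "('a, 'x) ring_scheme \<Rightarrow> ('a, 'b) factorization \<Rightarrow> ('a, 'b) factorization \<Rightarrow>
     (('b \<Rightarrow> 'b) \<times> ('b \<Rightarrow> 'b)) rel"
  where "fac_homotopic S M N =
    {(\<alpha>, \<beta>). \<alpha> \<in> fac_mor S M N \<and> \<beta> \<in> fac_mor S M N \<and>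
       (\<exists>h0 \<in> lin_hom S (fac0 M) (fac1 N). \<exists>h1 \<in> lin_hom S (fac1 M) (fac0 N).
          (\<forall>x \<in> carrier (fac0 M).
             fst \<alpha> x \<ominus>\<^bsub>fac0 N\<^esub> fst \<beta> x = h1 (dif0 M x) \<oplus>\<^bsub>fac0 N\<^esub> dif1 N (h0 x)) \<and>
          (\<forall>x \<in> carrier (fac1 M).
             snd \<alpha> x \<ominus>\<^bsub>fac1 N\<^esub> snd \<beta> x = h0 (dif1 M x) \<oplus>\<^bsub>fac1 N\<^esub> dif0 N (h1 x)))}"

definition fac_shift :: "('a, 'b) factorization \<Rightarrow> ('a, 'b) factorization"
  where "fac_shift M =
    \<lparr> fac0 = fac1 M, fac1 = fac0 M,
      dif0 = (\<lambda>x. \<ominus>\<^bsub>fac0 M\<^esub> dif1 M x),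
      dif1 = (\<lambda>x. \<ominus>\<^bsub>fac1 M\<^esub> dif0 M x) \<rparr>"

text \<open>
  \<open>Z\<close> is a mapping cone of \<open>\<alpha>: X \<rightarrow> Y\<close>: its components are direct sums \<open>Y\<^sub>i \<oplus> X\<^sub>i\<^sub>-\<^sub>1\<close>
  and its differential is the matrix \<open>((d, \<alpha>), (0, -d))\<close> with respect to these decompositions.
  The triangle consists of the classes of \<open>\<alpha>\<close>, of the inclusion of \<open>Y\<close> and of the projection
  to \<open>\<Sigma>X\<close>.  (Direct sums are not chosen, so that the cone stays in the given category.)
\<close>

definition fac_cone_triangle ::
    "('a, 'x) ring_scheme \<Rightarrow>
     ('a, 'b) factorization \<Rightarrow> ('a, 'b) factorization \<Rightarrow> ('a, 'b) factorization \<Rightarrow>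
     (('b \<Rightarrow> 'b) \<times> ('b \<Rightarrow> 'b)) set \<Rightarrow> (('b \<Rightarrow> 'b) \<times> ('b \<Rightarrow> 'b)) set \<Rightarrow>
     (('b \<Rightarrow> 'b) \<times> ('b \<Rightarrow> 'b)) set \<Rightarrow> bool"
  where "fac_cone_triangle S X Y Z u v w \<longleftrightarrow>
    (\<exists>\<alpha>0 \<alpha>1 i0 j0 p0 q0 i1 j1 p1 q1.
       (\<alpha>0, \<alpha>1) \<in> fac_mor S X Y \<and>
       direct_sum S (fac0 Y) (fac1 X) (fac0 Z) i0 j0 p0 q0 \<and>
       direct_sum S (fac1 Y) (fac0 X) (fac1 Z) i1 j1 p1 q1 \<and>
       (\<forall>z \<in> carrier (fac1 Z). dif1 Z z =
          i0 (dif1 Y (p1 z) \<oplus>\<^bsub>fac0 Y\<^esub> \<alpha>0 (q1 z)) \<oplus>\<^bsub>fac0 Z\<^esub> j0 (\<ominus>\<^bsub>fac1 X\<^esub> dif0 X (q1 z))) \<and>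
       (\<forall>z \<in> carrier (fac0 Z). dif0 Z z =
          i1 (dif0 Y (p0 z) \<oplus>\<^bsub>fac1 Y\<^esub> \<alpha>1 (q0 z)) \<oplus>\<^bsub>fac1 Z\<^esub> j1 (\<ominus>\<^bsub>fac0 X\<^esub> dif1 X (q0 z))) \<and>
       u = fac_homotopic S X Y `` {(\<alpha>0, \<alpha>1)} \<and>
       v = fac_homotopic S Y Z `` {(i0, i1)} \<and>
       w = fac_homotopic S Z (fac_shift X) `` {(q0, q1)})"

definition HF ::
    "('a, 'x) ring_scheme \<Rightarrow> ('a, 'b) module set \<Rightarrow> 'a \<Rightarrow>
     (('a, 'b) factorization, (('b \<Rightarrow> 'b) \<times> ('b \<Rightarrow> 'b)) set) tri_category"
  where "HF S C f =
    \<lparr> Obj = factorizations S C f,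
      Hom = (\<lambda>M N. fac_mor S M N // fac_homotopic S M N),
      Ident = (\<lambda>M. fac_homotopic S M M `` {(id, id)}),
      Comp = (\<lambda>M N L b a. \<Union>\<beta> \<in> b. \<Union>\<alpha> \<in> a.
        fac_homotopic S M L `` {(fst \<beta> \<circ> fst \<alpha>, snd \<beta> \<circ> snd \<alpha>)}),
      Plus = (\<lambda>M N a b. \<Union>\<alpha> \<in> a. \<Union>\<beta> \<in> b.
        fac_homotopic S M N ``
          {(\<lambda>x. fst \<alpha> x \<oplus>\<^bsub>fac0 N\<^esub> fst \<beta> x, \<lambda>x. snd \<alpha> x \<oplus>\<^bsub>fac1 N\<^esub> snd \<beta> x)}),
      ShiftO = fac_shift,
      ShiftH = (\<lambda>M N a. \<Union>\<alpha> \<in> a.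
        fac_homotopic S (fac_shift M) (fac_shift N) `` {(snd \<alpha>, fst \<alpha>)}),
      Std = fac_cone_triangle S \<rparr>"


section \<open>The homotopy category of totally acyclic complexes\<close>

definition totally_acyclic ::
    "('a, 'x) ring_scheme \<Rightarrow> ('a, 'b) module set \<Rightarrow> ('a, 'b) chain_complex \<Rightarrow> bool"
  where "totally_acyclic R W T \<longleftrightarrow>
    is_complex R T \<and> acyclic_complex T \<and> (\<forall>i. cmod T i \<in> W) \<and>
    (\<forall>V \<in> W. acyclic_complex (hom_from R T V) \<and> acyclic_complex (hom_to R V T))"

definition chain_maps ::
    "('a, 'x) ring_scheme \<Rightarrow> ('a, 'b) chain_complex \<Rightarrow> ('a, 'b) chain_complex \<Rightarrow> (int \<Rightarrow> 'b \<Rightarrow> 'b) set"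
  where "chain_maps R X Y =
    {\<alpha>. (\<forall>i. \<alpha> i \<in> lin_hom R (cmod X i) (cmod Y i)) \<and>
        (\<forall>i. \<forall>x \<in> carrier (cmod X i). \<alpha> (i - 1) (cdiff X i x) = cdiff Y i (\<alpha> i x))}"

definition chain_homotopic ::
    "('a, 'x) ring_scheme \<Rightarrow> ('a, 'b) chain_complex \<Rightarrow> ('a, 'b) chain_complex \<Rightarrow> (int \<Rightarrow> 'b \<Rightarrow> 'b) rel"
  where "chain_homotopic R X Y =
    {(\<alpha>, \<beta>). \<alpha> \<in> chain_maps R X Y \<and> \<beta> \<in> chain_maps R X Y \<and>
       (\<exists>h. (\<forall>i. h i \<in> lin_hom R (cmod X i) (cmod Y (i + 1))) \<and>
            (\<forall>i. \<forall>x \<in> carrier (cmod X i).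
               \<alpha> i x \<ominus>\<^bsub>cmod Y i\<^esub> \<beta> i x =
               h (i - 1) (cdiff X i x) \<oplus>\<^bsub>cmod Y i\<^esub> cdiff Y (i + 1) (h i x)))}"

definition complex_shift :: "('a, 'b) chain_complex \<Rightarrow> ('a, 'b) chain_complex"
  where "complex_shift X =
    \<lparr> cmod = (\<lambda>i. cmod X (i - 1)),
      cdiff = (\<lambda>i x. \<ominus>\<^bsub>cmod X (i - 2)\<^esub> cdiff X (i - 1) x) \<rparr>"

definition complex_cone_triangle ::
    "('a, 'x) ring_scheme \<Rightarrow>
     ('a, 'b) chain_complex \<Rightarrow> ('a, 'b) chain_complex \<Rightarrow> ('a, 'b) chain_complex \<Rightarrow>
     (int \<Rightarrow> 'b \<Rightarrow> 'b) set \<Rightarrow> (int \<Rightarrow> 'b \<Rightarrow> 'b) set \<Rightarrow> (int \<Rightarrow> 'b \<Rightarrow> 'b) set \<Rightarrow> bool"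
  where "complex_cone_triangle R X Y Z u v w \<longleftrightarrow>
    (\<exists>\<alpha> \<in> chain_maps R X Y. \<exists>\<iota> \<kappa> \<pi> \<rho>.
       (\<forall>i. direct_sum R (cmod Y i) (cmod X (i - 1)) (cmod Z i) (\<iota> i) (\<kappa> i) (\<pi> i) (\<rho> i)) \<and>
       (\<forall>i. \<forall>z \<in> carrier (cmod Z i). cdiff Z i z =
          \<iota> (i - 1) (cdiff Y i (\<pi> i z) \<oplus>\<^bsub>cmod Y (i - 1)\<^esub> \<alpha> (i - 1) (\<rho> i z)) \<oplus>\<^bsub>cmod Z (i - 1)\<^esub>
          \<kappa> (i - 1) (\<ominus>\<^bsub>cmod X (i - 2)\<^esub> cdiff X (i - 1) (\<rho> i z))) \<and>
       u = chain_homotopic R X Y `` {\<alpha>} \<and>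
       v = chain_homotopic R Y Z `` {\<iota>} \<and>
       w = chain_homotopic R Z (complex_shift X) `` {\<rho>})"

definition Ktac ::
    "('a, 'x) ring_scheme \<Rightarrow> ('a, 'b) module set \<Rightarrow>
     (('a, 'b) chain_complex, (int \<Rightarrow> 'b \<Rightarrow> 'b) set) tri_category"
  where "Ktac R W =
    \<lparr> Obj = {T. totally_acyclic R W T},
      Hom = (\<lambda>X Y. chain_maps R X Y // chain_homotopic R X Y),
      Ident = (\<lambda>X. chain_homotopic R X X `` {\<lambda>i. id}),
      Comp = (\<lambda>X Y Z b a. \<Union>\<beta> \<in> b. \<Union>\<alpha> \<in> a. chain_homotopic R X Z `` {\<lambda>i. \<beta> i \<circ> \<alpha> i}),
      Plus = (\<lambda>X Y a b. \<Union>\<alpha> \<in> a. \<Union>\<beta> \<in> b.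
        chain_homotopic R X Y `` {\<lambda>i x. \<alpha> i x \<oplus>\<^bsub>cmod Y i\<^esub> \<beta> i x}),
      ShiftO = complex_shift,
      ShiftH = (\<lambda>X Y a. \<Union>\<alpha> \<in> a.
        chain_homotopic R (complex_shift X) (complex_shift Y) `` {\<lambda>i. \<alpha> (i - 1)}),
      Std = complex_cone_triangle R \<rparr>"


section \<open>The functor\<close>

definition T_obj ::
    "('a, 'x) ring_scheme \<Rightarrow> ('r, 'y) ring_scheme \<Rightarrow> ('a \<Rightarrow> 'r) \<Rightarrow> ('a, 'b) factorization \<Rightarrow>
     ('r, ('r \<times> 'b \<Rightarrow> 'r) set) chain_complex"
  where "T_obj S R g M =
    \<lparr> cmod = (\<lambda>i. if even i then base_change S R g (fac0 M) else base_change S R g (fac1 M)),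
      cdiff = (\<lambda>i. if even i then base_change_map S R g (fac1 M) (dif0 M)
                   else base_change_map S R g (fac0 M) (dif1 M)) \<rparr>"

definition T_map ::
    "('a, 'x) ring_scheme \<Rightarrow> ('r, 'y) ring_scheme \<Rightarrow> ('a \<Rightarrow> 'r) \<Rightarrow> ('a, 'b) factorization \<Rightarrow>
     ('b \<Rightarrow> 'b) \<times> ('b \<Rightarrow> 'b) \<Rightarrow> int \<Rightarrow> ('r \<times> 'b \<Rightarrow> 'r) set \<Rightarrow> ('r \<times> 'b \<Rightarrow> 'r) set"
  where "T_map S R g N \<alpha> =
    (\<lambda>i. if even i then base_change_map S R g (fac0 N) (fst \<alpha>)
         else base_change_map S R g (fac1 N) (snd \<alpha>))"

definition T_hom ::
    "('a, 'x) ring_scheme \<Rightarrow> ('r, 'y) ring_scheme \<Rightarrow> ('a \<Rightarrow> 'r) \<Rightarrow>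
     ('a, 'b) factorization \<Rightarrow> ('a, 'b) factorization \<Rightarrow> (('b \<Rightarrow> 'b) \<times> ('b \<Rightarrow> 'b)) set \<Rightarrow>
     (int \<Rightarrow> ('r \<times> 'b \<Rightarrow> 'r) set \<Rightarrow> ('r \<times> 'b \<Rightarrow> 'r) set) set"
  where "T_hom S R g M N a =
    (\<Union>\<alpha> \<in> a. chain_homotopic R (T_obj S R g M) (T_obj S R g N) `` {T_map S R g N \<alpha>})"

end

theory Submission
  imports Defs
begin

text \<open>
  Write \<open>M'\<close> for \<open>R \<otimes>\<^sub>S M\<close>, where \<open>R = S/(f)\<close>.  As \<open>S \<rightarrow> R\<close> is onto with kernel \<open>(f)\<close>, the map
  \<open>M \<rightarrow> M'\<close>, \<open>m \<mapsto> 1 \<otimes> m\<close>, is onto with kernel \<open>fM\<close>.  Two facts about modules \<open>M\<close>, \<open>N\<close> in \<open>C\<close>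
  carry the whole proof.  First, every \<open>R\<close>-linear map \<open>M' \<rightarrow> N'\<close> is the reduction of an \<open>S\<close>-linear
  map \<open>M \<rightarrow> N\<close> (\<open>reduced_map_lifts\<close>): apply \<open>Hom(M, -)\<close> to \<open>0 \<rightarrow> N \<rightarrow> N \<rightarrow> N/fN \<rightarrow> 0\<close>, where the first
  map is multiplication by \<open>f\<close>, and use \<open>Ext\<^sup>1(M, N) = 0\<close>.  Second, an \<open>S\<close>-linear map whose reduction
  vanishes is \<open>f\<close> times an \<open>S\<close>-linear map (\<open>reduced_map_zero\<close>), because \<open>f\<close> is \<open>N\<close>-regular.  Moreover
  both maps \<open>d\<close> of a factorization are injective, since \<open>dd = f\<close>; so \<open>f\<close> and \<open>d\<close> may be cancelled, and
  an error term \<open>f\<chi>\<close> may be absorbed by writing \<open>f = dd\<close>.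
  
  \<^item> \<open>T\<^sup>M\<close> is totally acyclic.  For \<open>N\<close> in \<open>C\<close>, let the reduction of \<open>\<psi>: M\<^sub>i \<rightarrow> N\<close> be a cocycle, that is,
    \<open>\<psi>d = f\<chi>\<close>.  Then \<open>f\<psi> = \<psi>dd = f\<chi>d\<close>, hence \<open>\<psi> = \<chi>d\<close> is a coboundary.  Maps into \<open>T\<^sup>M\<close> and
    elements of \<open>T\<^sup>M\<close> are treated in the same way.
  
  \<^item> Faithfulness.  Let \<open>\<gamma> = \<alpha> - \<beta>\<close> reduce to a null-homotopic chain map.  The homotopy need not be
    2-periodic, but only its components in degrees \<open>-1\<close> and \<open>0\<close> are used.  They lift to \<open>k\<^sub>1\<close>, \<open>k\<^sub>0\<close>
    with \<open>\<gamma>\<^sub>0 = k\<^sub>1d\<^sub>0 + d\<^sub>1k\<^sub>0 + f\<chi>\<close>.  Replacing \<open>k\<^sub>1\<close> by \<open>k\<^sub>1 + \<chi>d\<^sub>1\<close> removes the error term, and the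
    identity for \<open>\<gamma>\<^sub>1\<close> follows from that for \<open>\<gamma>\<^sub>0\<close> by cancelling \<open>d\<^sub>1\<close>.
  
  \<^item> Fullness.  Let \<open>a: T\<^sup>M \<rightarrow> T\<^sup>N\<close> be a chain map.  Lift \<open>a\<^sub>0\<close> to \<open>\<alpha>\<^sub>0\<close> and \<open>a\<^sub>1\<close> to \<open>b\<close>; then
    \<open>\<alpha>\<^sub>0d\<^sub>1 = d\<^sub>1b + f\<chi>\<close>, and \<open>(\<alpha>\<^sub>0, b + d\<^sub>0\<chi>)\<close> is a morphism of factorizations.  Its reduction agrees with
    \<open>a\<close> in degree \<open>0\<close>.  Two chain maps between totally acyclic complexes that are homotopic in one
    degree are homotopic: the homotopy extends upwards because \<open>Hom(T\<^sup>M\<^sub>i, T\<^sup>N)\<close> is acyclic and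
    downwards because \<open>Hom(T\<^sup>M, T\<^sup>N\<^sub>i)\<close> is (\<open>homotopy_extends\<close>).
  
  The faithfulness argument shows that two morphisms of factorizations are homotopic if and only if
  their reductions are (\<open>fac_homotopic_iff\<close>), so that homotopy of factorizations inherits its formal
  properties from homotopy of chain maps.  Finally \<open>T\<close> commutes with shifts up to the identity map,
  and it takes cones to cones because base change preserves direct sums; hence it is triangulated.
  
  The group \<open>Ext\<^sup>1\<close> is computed from a chosen free resolution whose bases are sets of words, so a
  resolution of that kind has to be constructed (\<open>free_resolution_exists\<close>).
\<close>

section \<open>Linear maps and submodules\<close>

context abelian_group
begin

lemma diff_eq_iff:
  assumes "x \<in> carrier G" "y \<in> carrier G" "z \<in> carrier G"
  shows "x \<ominus> y = z \<longleftrightarrow> x = y \<oplus> z"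
  using assms a_lcomm[of y z "\<ominus> y"] a_lcomm[of y x "\<ominus> y"]
  by (auto simp: a_minus_def a_assoc r_neg)

lemma diff_zero_iff:
  assumes "x \<in> carrier G" "y \<in> carrier G"
  shows "x \<ominus> y = \<zero> \<longleftrightarrow> x = y"
  using assms by (simp add: diff_eq_iff)

lemma sum4_swap:
  assumes "p \<in> carrier G" "q \<in> carrier G" "p' \<in> carrier G" "q' \<in> carrier G"
  shows "(p \<oplus> q) \<oplus> (p' \<oplus> q') = (p \<oplus> p') \<oplus> (q \<oplus> q')"
  using assms by (simp add: a_ac)

lemma diff_swap:
  assumes "a \<in> carrier G" "b \<in> carrier G"
  shows "b \<ominus> a = \<ominus> (a \<ominus> b)"
  using assms by (simp add: a_minus_def minus_add a_comm)

lemma diff_trans: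
  assumes "a \<in> carrier G" "b \<in> carrier G" "c \<in> carrier G"
  shows "a \<ominus> c = (a \<ominus> b) \<oplus> (b \<ominus> c)"
proof -
  have "(a \<oplus> \<ominus> b) \<oplus> (b \<oplus> \<ominus> c) = a \<oplus> ((\<ominus> b \<oplus> b) \<oplus> \<ominus> c)"
    using assms by (simp only: a_assoc a_closed a_inv_closed)
  then show ?thesis using assms by (simp add: a_minus_def l_neg)
qed

lemma diff_sum:
  assumes "a \<in> carrier G" "b \<in> carrier G" "a' \<in> carrier G" "b' \<in> carrier G"
  shows "(a \<oplus> b) \<ominus> (a' \<oplus> b') = (a \<ominus> a') \<oplus> (b \<ominus> b')"
  using assms by (simp add: a_minus_def minus_add a_ac)

end

lemma lin_homI:
  assumes "\<And>x. x \<in> carrier M \<Longrightarrow> h x \<in> carrier N"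
    and "\<And>x y. x \<in> carrier M \<Longrightarrow> y \<in> carrier M \<Longrightarrow> h (x \<oplus>\<^bsub>M\<^esub> y) = h x \<oplus>\<^bsub>N\<^esub> h y"
    and "\<And>r x. r \<in> carrier R \<Longrightarrow> x \<in> carrier M \<Longrightarrow> h (r \<odot>\<^bsub>M\<^esub> x) = r \<odot>\<^bsub>N\<^esub> h x"
  shows "h \<in> lin_hom R M N"
  using assms by (auto simp: lin_hom_def)

lemma lin_hom_closed: "h \<in> lin_hom R M N \<Longrightarrow> x \<in> carrier M \<Longrightarrow> h x \<in> carrier N"
  by (auto simp: lin_hom_def)

lemma lin_hom_add:
  "h \<in> lin_hom R M N \<Longrightarrow> x \<in> carrier M \<Longrightarrow> y \<in> carrier M \<Longrightarrow> h (x \<oplus>\<^bsub>M\<^esub> y) = h x \<oplus>\<^bsub>N\<^esub> h y"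
  by (auto simp: lin_hom_def)

lemma lin_hom_smult:
  "h \<in> lin_hom R M N \<Longrightarrow> r \<in> carrier R \<Longrightarrow> x \<in> carrier M \<Longrightarrow> h (r \<odot>\<^bsub>M\<^esub> x) = r \<odot>\<^bsub>N\<^esub> h x"
  by (auto simp: lin_hom_def)

lemma module_abelian_group: "module R M \<Longrightarrow> abelian_group M"
  by (auto simp: module_def)

lemma module_cring: "module R M \<Longrightarrow> cring R"
  by (auto simp: module_def)

lemmas module_zero_closed = abelian_monoid.zero_closed[OF abelian_group.axioms(1)[OF module_abelian_group]]
lemmas module_add_closed = abelian_monoid.a_closed[OF abelian_group.axioms(1)[OF module_abelian_group]]
lemmas module_neg_closed = abelian_group.a_inv_closed[OF module_abelian_group]

lemma lin_hom_group_hom: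
  assumes "module R M" "module R N" "h \<in> lin_hom R M N"
  shows "abelian_group_hom M N h"
  using assms
  by (auto intro!: abelian_group_homI group_hom.intro group_hom_axioms.intro homI
      simp: module_abelian_group abelian_group.a_group lin_hom_closed lin_hom_add)

lemma lin_hom_zero:
  assumes "module R M" "module R N" "h \<in> lin_hom R M N"
  shows "h \<zero>\<^bsub>M\<^esub> = \<zero>\<^bsub>N\<^esub>"
  by (rule abelian_group_hom.hom_zero[OF lin_hom_group_hom[OF assms]])

lemma lin_hom_neg:
  assumes "module R M" "module R N" "h \<in> lin_hom R M N" "x \<in> carrier M"
  shows "h (\<ominus>\<^bsub>M\<^esub> x) = \<ominus>\<^bsub>N\<^esub> h x"
  by (rule abelian_group_hom.hom_a_inv[OF lin_hom_group_hom[OF assms(1-3)] assms(4)])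

lemma lin_hom_minus:
  assumes "module R M" "module R N" "h \<in> lin_hom R M N" "x \<in> carrier M" "y \<in> carrier M"
  shows "h (x \<ominus>\<^bsub>M\<^esub> y) = h x \<ominus>\<^bsub>N\<^esub> h y"
  using assms
  by (simp add: a_minus_def lin_hom_add lin_hom_neg module_neg_closed)

lemma lin_hom_comp:
  "g \<in> lin_hom R M N \<Longrightarrow> h \<in> lin_hom R N L \<Longrightarrow> (\<lambda>x. h (g x)) \<in> lin_hom R M L"
  by (rule lin_homI) (simp_all add: lin_hom_closed lin_hom_add lin_hom_smult)

lemma lin_hom_id: "(\<lambda>x. x) \<in> lin_hom R M M"
  by (auto simp: lin_hom_def)

lemma lin_hom_cong:
  assumes "module R M" "\<And>x. x \<in> carrier M \<Longrightarrow> g x = h x"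
  shows "g \<in> lin_hom R M N \<longleftrightarrow> h \<in> lin_hom R M N"
  using assms by (auto simp: lin_hom_def module_add_closed module.smult_closed Pi_def)

lemma lin_hom_zero_map: "module R N \<Longrightarrow> (\<lambda>x. \<zero>\<^bsub>N\<^esub>) \<in> lin_hom R M N"
  by (rule lin_homI)
    (auto simp: module_zero_closed module.smult_r_null abelian_monoid.l_zero
      abelian_group.axioms(1) module_abelian_group)

lemma lin_hom_sum_map:
  assumes "module R N" "g \<in> lin_hom R M N" "h \<in> lin_hom R M N"
  shows "(\<lambda>x. g x \<oplus>\<^bsub>N\<^esub> h x) \<in> lin_hom R M N"
proof -
  interpret N: module R N by fact
  show ?thesis
    using assms(2,3)
    by (intro lin_homI) (auto simp: lin_hom_closed lin_hom_add lin_hom_smult N.smult_r_distr N.a_ac)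
qed

lemma lin_hom_neg_map:
  assumes "module R N" "h \<in> lin_hom R M N"
  shows "(\<lambda>x. \<ominus>\<^bsub>N\<^esub> h x) \<in> lin_hom R M N"
proof -
  interpret N: module R N by fact
  show ?thesis
    using assms(2)
    by (intro lin_homI) (auto simp: lin_hom_closed lin_hom_add lin_hom_smult N.smult_r_minus N.minus_add)
qed

lemma lin_hom_diff_map:
  assumes "module R N" "g \<in> lin_hom R M N" "h \<in> lin_hom R M N"
  shows "(\<lambda>x. g x \<ominus>\<^bsub>N\<^esub> h x) \<in> lin_hom R M N"
  using lin_hom_sum_map[OF assms(1,2) lin_hom_neg_map[OF assms(1,3)]]
  by (simp add: a_minus_def)

lemma lin_hom_smult_map:
  assumes "module R N" "r \<in> carrier R" "h \<in> lin_hom R M N"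
  shows "(\<lambda>x. r \<odot>\<^bsub>N\<^esub> h x) \<in> lin_hom R M N"
proof -
  interpret N: module R N by fact
  show ?thesis
    using assms(2,3)
    by (intro lin_homI) (auto simp: lin_hom_closed lin_hom_add lin_hom_smult N.smult_r_distr
        N.smult_assoc1[symmetric] N.R.m_comm)
qed

lemma lin_hom_inv_into:
  assumes "module R M" "h \<in> lin_hom R M N" "bij_betw h (carrier M) (carrier N)"
  shows "inv_into (carrier M) h \<in> lin_hom R N M"
proof -
  interpret M: module R M by fact
  let ?k = "inv_into (carrier M) h"
  have inj: "inj_on h (carrier M)" and im: "h ` carrier M = carrier N"
    using assms(3) by (auto simp: bij_betw_def)
  have k: "?k y \<in> carrier M" "h (?k y) = y" if "y \<in> carrier N" for y
    using that im by (auto intro: inv_into_into f_inv_into_f)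
  show ?thesis
  proof (rule lin_homI)
    fix x y assume xy: "x \<in> carrier N" "y \<in> carrier N"
    have "h (?k x \<oplus>\<^bsub>M\<^esub> ?k y) = x \<oplus>\<^bsub>N\<^esub> y"
      using k xy by (simp add: lin_hom_add[OF assms(2)])
    then show "?k (x \<oplus>\<^bsub>N\<^esub> y) = ?k x \<oplus>\<^bsub>M\<^esub> ?k y"
      using k xy inj by (metis M.add.m_closed inv_into_f_f)
  next
    fix r x assume rx: "r \<in> carrier R" "x \<in> carrier N"
    have "h (r \<odot>\<^bsub>M\<^esub> ?k x) = r \<odot>\<^bsub>N\<^esub> x"
      using k rx by (simp add: lin_hom_smult[OF assms(2)])
    then show "?k (r \<odot>\<^bsub>N\<^esub> x) = r \<odot>\<^bsub>M\<^esub> ?k x"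
      using k rx inj by (metis M.smult_closed inv_into_f_f)
  qed (use k in auto)
qed

lemma submodule_preimage:
  assumes "module R M" "module R N" "h \<in> lin_hom R M N" "submodule K R N"
  shows "submodule {x \<in> carrier M. h x \<in> K} R M"
proof -
  interpret M: module R M by fact
  interpret N: module R N by fact
  have K0: "\<zero>\<^bsub>N\<^esub> \<in> K"
    using assms(4) by (metis submodule_def subgroup.one_closed monoid.select_convs(2))
  show ?thesis
    using N.submoduleE[OF assms(4)] K0
    by (intro M.submoduleI)
       (auto simp: lin_hom_add[OF assms(3)] lin_hom_smult[OF assms(3)] lin_hom_neg[OF assms(1-3)]
          lin_hom_zero[OF assms(1-3)])
qed

lemma submodule_zero: "module R M \<Longrightarrow> submodule {\<zero>\<^bsub>M\<^esub>} R M"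
proof -
  assume "module R M"
  then interpret M: module R M .
  show ?thesis by (rule M.submoduleI) auto
qed

lemma submodule_kernel:
  assumes "module R M" "module R N" "h \<in> lin_hom R M N"
  shows "submodule {x \<in> carrier M. h x = \<zero>\<^bsub>N\<^esub>} R M"
  using submodule_preimage[OF assms submodule_zero[OF assms(2)]] by simp

lemma submodule_zero_mem: "submodule K R M \<Longrightarrow> \<zero>\<^bsub>M\<^esub> \<in> K"
  by (metis submodule_def subgroup.one_closed monoid.select_convs(2))

lemma submodule_abelian_subgroup:
  assumes "module R M" "submodule K R M"
  shows "abelian_subgroup K M"
  using assms by (intro abelian_subgroupI3 additive_subgroup.intro)
    (auto simp: submodule_def module_abelian_group)

lemma submodule_generated_submodule:
  assumes "module R M" "X \<subseteq> carrier M"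
  shows "submodule (submodule_generated R M X) R M"
proof -
  interpret M: module R M by fact
  have c: "submodule (carrier M) R M" by (rule M.carrier_is_submodule)
  show ?thesis
    unfolding submodule_generated_def
    using assms(2) c
    by (intro M.submoduleI)
       (auto simp: submodule_zero_mem intro: M.submoduleE(3-5))
qed

lemma submodule_generated_superset: "X \<subseteq> submodule_generated R M X"
  by (auto simp: submodule_generated_def)

lemma submodule_generated_least:
  "submodule K R M \<Longrightarrow> X \<subseteq> K \<Longrightarrow> submodule_generated R M X \<subseteq> K"
  by (auto simp: submodule_generated_def)


section \<open>Quotient modules\<close>

lemma quotient_module_carrier:
  "carrier (quotient_module M K) = (\<lambda>x. K +>\<^bsub>M\<^esub> x) ` carrier M"
  by (auto simp: quotient_module_def A_RCOSETS_def RCOSETS_def a_r_coset_def)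

context
  fixes R :: "('a, 'x) ring_scheme" and M :: "('a, 'b) module" and K
  assumes M: "module R M" and K: "submodule K R M"
begin

interpretation M: module R M by (rule M)
interpretation K: abelian_subgroup K M by (rule submodule_abelian_subgroup[OF M K])

lemma coset_eq_iff:
  assumes "x \<in> carrier M" "y \<in> carrier M"
  shows "K +>\<^bsub>M\<^esub> x = K +>\<^bsub>M\<^esub> y \<longleftrightarrow> x \<ominus>\<^bsub>M\<^esub> y \<in> K"
  using assms
  by (metis K.a_rcos_module K.a_rcos_self K.a_repr_independence' a_minus_def)

lemma coset_eq_self_iff:
  assumes "x \<in> carrier M"
  shows "K +>\<^bsub>M\<^esub> x = K \<longleftrightarrow> x \<in> K"
  by (metis K.a_rcos_const K.a_rcos_self assms)

lemma coset_add:
  assumes "x \<in> carrier M" "y \<in> carrier M"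
  shows "(K +>\<^bsub>M\<^esub> x) \<oplus>\<^bsub>quotient_module M K\<^esub> (K +>\<^bsub>M\<^esub> y) = K +>\<^bsub>M\<^esub> (x \<oplus>\<^bsub>M\<^esub> y)"
  using assms by (simp add: quotient_module_def K.a_rcos_sum)

text \<open>
  The union that defines scalar multiplication on cosets runs over all representatives, but all its
  members are the same coset.
\<close>

lemma coset_smult:
  assumes "r \<in> carrier R" "x \<in> carrier M"
  shows "r \<odot>\<^bsub>quotient_module M K\<^esub> (K +>\<^bsub>M\<^esub> x) = K +>\<^bsub>M\<^esub> (r \<odot>\<^bsub>M\<^esub> x)"
proof -
  have "K +>\<^bsub>M\<^esub> (r \<odot>\<^bsub>M\<^esub> y) = K +>\<^bsub>M\<^esub> (r \<odot>\<^bsub>M\<^esub> x)" if "y \<in> K +>\<^bsub>M\<^esub> x" for y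
  proof -
    have y: "y \<in> carrier M" using that assms(2) K.a_elemrcos_carrier by blast
    then have "y \<ominus>\<^bsub>M\<^esub> x \<in> K"
      using that assms(2) by (simp add: K.a_rcos_module a_minus_def)
    then have "r \<odot>\<^bsub>M\<^esub> (y \<ominus>\<^bsub>M\<^esub> x) \<in> K"
      using assms(1) M.submoduleE(4)[OF K] by blast
    then have "r \<odot>\<^bsub>M\<^esub> y \<ominus>\<^bsub>M\<^esub> r \<odot>\<^bsub>M\<^esub> x \<in> K"
      using assms y by (simp add: a_minus_def M.smult_r_distr M.smult_r_minus)
    then show ?thesis using assms y by (simp add: coset_eq_iff)
  qed
  moreover have "K +>\<^bsub>M\<^esub> x \<noteq> {}" using K.a_rcos_self[OF assms(2)] by blast
  ultimately have "(\<Union>y \<in> K +>\<^bsub>M\<^esub> x. K +>\<^bsub>M\<^esub> (r \<odot>\<^bsub>M\<^esub> y)) = K +>\<^bsub>M\<^esub> (r \<odot>\<^bsub>M\<^esub> x)"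
    by (rule SUP_eq_const[rotated])
  then show ?thesis by (simp add: quotient_module_def)
qed

lemma quotient_module_module: "module R (quotient_module M K)"
proof (rule moduleI)
  let ?Q = "quotient_module M K"
  show "cring R" by (rule module_cring[OF M])
  have z: "\<zero>\<^bsub>?Q\<^esub> = K +>\<^bsub>M\<^esub> \<zero>\<^bsub>M\<^esub>"
    by (simp add: quotient_module_def K.a_subset)
  show "abelian_group ?Q"
  proof (rule abelian_groupI)
    fix X assume "X \<in> carrier ?Q"
    then obtain x where x: "x \<in> carrier M" "X = K +>\<^bsub>M\<^esub> x"
      by (auto simp: quotient_module_carrier)
    then have "(K +>\<^bsub>M\<^esub> \<ominus>\<^bsub>M\<^esub> x) \<oplus>\<^bsub>?Q\<^esub> X = \<zero>\<^bsub>?Q\<^esub>"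
      by (simp add: coset_add z M.l_neg)
    then show "\<exists>Y\<in>carrier ?Q. Y \<oplus>\<^bsub>?Q\<^esub> X = \<zero>\<^bsub>?Q\<^esub>"
      using x by (auto simp: quotient_module_carrier)
  qed (auto simp: quotient_module_carrier coset_add z M.a_ac)
qed (auto simp: quotient_module_carrier coset_add coset_smult M.smult_l_distr M.smult_r_distr
      M.smult_assoc1)

lemma coset_lin_hom: "(\<lambda>x. K +>\<^bsub>M\<^esub> x) \<in> lin_hom R M (quotient_module M K)"
  by (rule lin_homI) (auto simp: quotient_module_carrier coset_add coset_smult)

end

lemma quotient_module_zero: "\<zero>\<^bsub>quotient_module M K\<^esub> = K"
  by (simp add: quotient_module_def)


section \<open>Free modules\<close>

text \<open>
  The map given by the universal property of a free module: it takes the generator at \<open>b\<close> to \<open>v b\<close>.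
\<close>

definition linear_extension ::
    "('a, 'x) ring_scheme \<Rightarrow> ('a, 'c) module \<Rightarrow> ('b \<Rightarrow> 'c) \<Rightarrow> ('b \<Rightarrow> 'a) \<Rightarrow> 'c"
  where "linear_extension R N v c = (\<Oplus>\<^bsub>N\<^esub>z \<in> {z. c z \<noteq> \<zero>\<^bsub>R\<^esub>}. c z \<odot>\<^bsub>N\<^esub> v z)"

context cring
begin

lemma free_module_carrier_iff:
  "c \<in> carrier (free_module R B) \<longleftrightarrow>
     (\<forall>b. c b \<in> carrier R) \<and> (\<forall>b. b \<notin> B \<longrightarrow> c b = \<zero>) \<and> finite {b. c b \<noteq> \<zero>}"
  by (simp add: free_module_def)

lemma free_module_ops:
  "\<zero>\<^bsub>free_module R B\<^esub> = (\<lambda>b. \<zero>)"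
  "c \<oplus>\<^bsub>free_module R B\<^esub> c' = (\<lambda>b. c b \<oplus> c' b)"
  "r \<odot>\<^bsub>free_module R B\<^esub> c = (\<lambda>b. r \<otimes> c b)"
  by (simp_all add: free_module_def)

lemma free_module_module: "module R (free_module R B)"
proof -
  have add: "(\<lambda>b. c b \<oplus> c' b) \<in> carrier (free_module R B)"
    if "c \<in> carrier (free_module R B)" "c' \<in> carrier (free_module R B)" for c c'
  proof -
    have "{b. c b \<oplus> c' b \<noteq> \<zero>} \<subseteq> {b. c b \<noteq> \<zero>} \<union> {b. c' b \<noteq> \<zero>}" by auto
    then show ?thesis
      using that by (auto simp: free_module_carrier_iff dest: finite_subset)
  qed
  have smult: "(\<lambda>b. r \<otimes> c b) \<in> carrier (free_module R B)"
    if "r \<in> carrier R" "c \<in> carrier (free_module R B)" for r c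
  proof -
    have "{b. r \<otimes> c b \<noteq> \<zero>} \<subseteq> {b. c b \<noteq> \<zero>}" using that(1) by auto
    then show ?thesis
      using that by (auto simp: free_module_carrier_iff dest: finite_subset)
  qed
  have grp: "abelian_group (free_module R B)"
  proof (rule abelian_groupI)
    fix c assume c: "c \<in> carrier (free_module R B)"
    have "(\<lambda>b. (\<ominus> \<one>) \<otimes> c b) \<in> carrier (free_module R B)"
      using smult[OF _ c] by simp
    moreover have "(\<lambda>b. ((\<ominus> \<one>) \<otimes> c b) \<oplus> c b) = (\<lambda>b. \<zero>)"
      using c by (auto simp: free_module_carrier_iff l_minus l_neg)
    ultimately show "\<exists>c'\<in>carrier (free_module R B).
        c' \<oplus>\<^bsub>free_module R B\<^esub> c = \<zero>\<^bsub>free_module R B\<^esub>"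
      by (auto simp: free_module_ops)
  qed (use add in \<open>auto simp: free_module_ops free_module_carrier_iff a_ac\<close>)
  show ?thesis
    using grp smult
    by (intro moduleI)
      (auto simp: free_module_ops free_module_carrier_iff l_distr r_distr m_assoc is_cring)
qed

lemma free_gen_closed: "b \<in> B \<Longrightarrow> free_gen R b \<in> carrier (free_module R B)"
proof -
  assume "b \<in> B"
  moreover have "{b'. free_gen R b b' \<noteq> \<zero>} \<subseteq> {b}" by (auto simp: free_gen_def)
  ultimately show ?thesis
    by (auto simp: free_module_carrier_iff free_gen_def dest: finite_subset)
qed

context
  fixes N :: "('a, 'n) module" and B :: "'i set" and v :: "'i \<Rightarrow> 'n"
  assumes N: "module R N" and v: "\<And>b. b \<in> B \<Longrightarrow> v b \<in> carrier N"
begin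

interpretation N: module R N by (rule N)

text \<open>
  Sums over the supports of different elements can be compared once they run over a common finite set.
\<close>

lemma linear_extension_superset:
  assumes c: "c \<in> carrier (free_module R B)" and A: "finite A" "A \<subseteq> B" "{z. c z \<noteq> \<zero>} \<subseteq> A"
  shows "linear_extension R N v c = (\<Oplus>\<^bsub>N\<^esub>z \<in> A. c z \<odot>\<^bsub>N\<^esub> v z)"
  unfolding linear_extension_def
  using assms v
  by (intro N.add.finprod_mono_neutral_cong_left)
     (auto simp: free_module_carrier_iff Pi_def subset_iff)

lemma linear_extension_lin_hom: "linear_extension R N v \<in> lin_hom R (free_module R B) N"
proof -
  interpret F: module R "free_module R B" by (rule free_module_module)
  have supp: "finite {z. c z \<noteq> \<zero>} \<and> {z. c z \<noteq> \<zero>} \<subseteq> B" if "c \<in> carrier (free_module R B)" for c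
    using that by (auto simp: free_module_carrier_iff)
  have vals: "(\<lambda>z. c z \<odot>\<^bsub>N\<^esub> v z) \<in> A \<rightarrow> carrier N"
    if "c \<in> carrier (free_module R B)" "A \<subseteq> B" for c A
    using that v by (auto simp: free_module_carrier_iff)
  show ?thesis
  proof (rule lin_homI)
    fix c assume c: "c \<in> carrier (free_module R B)"
    show "linear_extension R N v c \<in> carrier N"
      unfolding linear_extension_def using vals[OF c] supp[OF c] by (simp add: N.finsum_closed)
  next
    fix c c' assume c: "c \<in> carrier (free_module R B)" "c' \<in> carrier (free_module R B)"
    let ?A = "{z. c z \<noteq> \<zero>} \<union> {z. c' z \<noteq> \<zero>}"
    have A: "finite ?A" "?A \<subseteq> B" using supp c by auto
    have s: "c \<oplus>\<^bsub>free_module R B\<^esub> c' \<in> carrier (free_module R B)" using c by simp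
    have "linear_extension R N v (c \<oplus>\<^bsub>free_module R B\<^esub> c') =
        (\<Oplus>\<^bsub>N\<^esub>z \<in> ?A. (c z \<oplus> c' z) \<odot>\<^bsub>N\<^esub> v z)"
      by (subst linear_extension_superset[OF s A]) (auto simp: free_module_ops)
    also have "\<dots> = (\<Oplus>\<^bsub>N\<^esub>z \<in> ?A. c z \<odot>\<^bsub>N\<^esub> v z \<oplus>\<^bsub>N\<^esub> c' z \<odot>\<^bsub>N\<^esub> v z)"
      using c v A(2)
      by (intro N.finsum_cong') (auto simp: free_module_carrier_iff N.smult_l_distr Pi_def subset_iff)
    also have "\<dots> = (\<Oplus>\<^bsub>N\<^esub>z \<in> ?A. c z \<odot>\<^bsub>N\<^esub> v z) \<oplus>\<^bsub>N\<^esub> (\<Oplus>\<^bsub>N\<^esub>z \<in> ?A. c' z \<odot>\<^bsub>N\<^esub> v z)"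
      using vals[OF c(1) A(2)] vals[OF c(2) A(2)] by (simp add: N.finsum_addf)
    also have "\<dots> = linear_extension R N v c \<oplus>\<^bsub>N\<^esub> linear_extension R N v c'"
      using linear_extension_superset[OF c(1) A] linear_extension_superset[OF c(2) A] by auto
    finally show "linear_extension R N v (c \<oplus>\<^bsub>free_module R B\<^esub> c') =
      linear_extension R N v c \<oplus>\<^bsub>N\<^esub> linear_extension R N v c'" .
  next
    fix r c assume c: "r \<in> carrier R" "c \<in> carrier (free_module R B)"
    let ?A = "{z. c z \<noteq> \<zero>}"
    have A: "finite ?A" "?A \<subseteq> B" using supp c by auto
    have s: "r \<odot>\<^bsub>free_module R B\<^esub> c \<in> carrier (free_module R B)" using c by simp
    have "linear_extension R N v (r \<odot>\<^bsub>free_module R B\<^esub> c) =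
        (\<Oplus>\<^bsub>N\<^esub>z \<in> ?A. (r \<otimes> c z) \<odot>\<^bsub>N\<^esub> v z)"
      using c(1) by (subst linear_extension_superset[OF s A]) (auto simp: free_module_ops)
    also have "\<dots> = (\<Oplus>\<^bsub>N\<^esub>z \<in> ?A. r \<odot>\<^bsub>N\<^esub> (c z \<odot>\<^bsub>N\<^esub> v z))"
      using c v A(2)
      by (intro N.finsum_cong') (auto simp: free_module_carrier_iff N.smult_assoc1 Pi_def subset_iff)
    also have "\<dots> = r \<odot>\<^bsub>N\<^esub> linear_extension R N v c"
      unfolding linear_extension_def
      using N.finsum_smult_ldistr[OF A(1) c(1) vals[OF c(2) A(2)]] by simp
    finally show "linear_extension R N v (r \<odot>\<^bsub>free_module R B\<^esub> c) =
      r \<odot>\<^bsub>N\<^esub> linear_extension R N v c" .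
  qed
qed

lemma linear_extension_gen:
  assumes b: "b \<in> B"
  shows "linear_extension R N v (free_gen R b) = v b"
proof -
  have "linear_extension R N v (free_gen R b) = (\<Oplus>\<^bsub>N\<^esub>z \<in> {b}. free_gen R b z \<odot>\<^bsub>N\<^esub> v z)"
    by (rule linear_extension_superset[OF free_gen_closed[OF b]])
      (use b in \<open>auto simp: free_gen_def\<close>)
  also have "\<dots> = v b"
    using v[OF b] by (simp add: free_gen_def N.finsum_insert)
  finally show ?thesis .
qed

end

lemma free_module_induct [consumes 1, case_names zero gen]:
  assumes "c \<in> carrier (free_module R B)"
    and "P (\<lambda>b. \<zero>)"
    and "\<And>r b c. r \<in> carrier R \<Longrightarrow> b \<in> B \<Longrightarrow> c \<in> carrier (free_module R B) \<Longrightarrow> P c \<Longrightarrow>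
           P ((r \<odot>\<^bsub>free_module R B\<^esub> free_gen R b) \<oplus>\<^bsub>free_module R B\<^esub> c)"
  shows "P c"
proof -
  have fin: "finite {b. c b \<noteq> \<zero>}" using assms(1) by (simp add: free_module_carrier_iff)
  have "P c" if "finite A" "{b. c b \<noteq> \<zero>} \<subseteq> A" "c \<in> carrier (free_module R B)" for A c
    using that
  proof (induction A arbitrary: c)
    case empty
    then have "c = (\<lambda>b. \<zero>)" by auto
    then show ?case using assms(2) by simp
  next
    case (insert a A)
    show ?case
    proof (cases "c a = \<zero>")
      case True
      then show ?thesis using insert by (intro insert.IH) auto
    next
      case False
      let ?c = "c(a := \<zero>)"
      have a: "a \<in> B" "c a \<in> carrier R"
        using insert.prems(2) False by (auto simp: free_module_carrier_iff)
      have "finite {b. ?c b \<noteq> \<zero>}"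
        using insert.prems(2) by (auto simp: free_module_carrier_iff elim: finite_subset[rotated])
      then have c: "?c \<in> carrier (free_module R B)"
        using insert.prems(2) by (auto simp: free_module_carrier_iff)
      moreover have "P ?c" using insert.prems(1) by (intro insert.IH[OF _ c]) auto
      ultimately have "P ((c a \<odot>\<^bsub>free_module R B\<^esub> free_gen R a) \<oplus>\<^bsub>free_module R B\<^esub> ?c)"
        using a assms(3) by blast
      also have "(c a \<odot>\<^bsub>free_module R B\<^esub> free_gen R a) \<oplus>\<^bsub>free_module R B\<^esub> ?c = c"
        using insert.prems(2) by (auto simp: free_module_ops free_gen_def free_module_carrier_iff fun_eq_iff)
      finally show ?thesis .
    qed
  qed
  from this[OF fin subset_refl assms(1)] show ?thesis .
qed

lemma free_module_generated:
  assumes "submodule K R (free_module R B)" "\<And>b. b \<in> B \<Longrightarrow> free_gen R b \<in> K"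
  shows "carrier (free_module R B) \<subseteq> K"
proof
  interpret F: module R "free_module R B" by (rule free_module_module)
  fix c assume "c \<in> carrier (free_module R B)"
  then show "c \<in> K"
  proof (induction rule: free_module_induct)
    case zero
    then show ?case using submodule_zero_mem[OF assms(1)] by (simp add: free_module_ops)
  next
    case (gen r b c)
    have "r \<odot>\<^bsub>free_module R B\<^esub> free_gen R b \<in> K"
      by (rule F.submoduleE(4)[OF assms(1) gen(1) assms(2)[OF gen(2)]])
    then show ?case by (rule F.submoduleE(5)[OF assms(1) _ gen(4)])
  qed
qed

lemma lin_hom_free_eqI:
  assumes N: "module R N" and g: "g \<in> lin_hom R (free_module R B) N"
    and h: "h \<in> lin_hom R (free_module R B) N"
    and eq: "\<And>b. b \<in> B \<Longrightarrow> g (free_gen R b) = h (free_gen R b)"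
    and c: "c \<in> carrier (free_module R B)"
  shows "g c = h c"
proof -
  interpret N: module R N by fact
  have "submodule {c \<in> carrier (free_module R B). g c \<ominus>\<^bsub>N\<^esub> h c = \<zero>\<^bsub>N\<^esub>} R (free_module R B)"
    by (rule submodule_kernel[OF free_module_module N lin_hom_diff_map[OF N g h]])
  then have "carrier (free_module R B) \<subseteq>
      {c \<in> carrier (free_module R B). g c \<ominus>\<^bsub>N\<^esub> h c = \<zero>\<^bsub>N\<^esub>}"
  proof (rule free_module_generated)
    fix b assume b: "b \<in> B"
    then show "free_gen R b \<in> {c \<in> carrier (free_module R B). g c \<ominus>\<^bsub>N\<^esub> h c = \<zero>\<^bsub>N\<^esub>}"
      using free_gen_closed[OF b] lin_hom_closed[OF h free_gen_closed[OF b]] by (simp add: eq a_minus_def abelian_group.r_neg[OF module_abelian_group[OF N]])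
  qed
  then show ?thesis
    using c lin_hom_closed[OF g c] lin_hom_closed[OF h c]
    by (auto simp: abelian_group.diff_zero_iff[OF module_abelian_group[OF N]])
qed

end

section \<open>Existence of free resolutions\<close>

text \<open>
  A self-delimiting code for words over an alphabet with two distinct letters \<open>p\<close>, \<open>q\<close>: the letter
  \<open>p\<close> announces a further letter of the word and \<open>q\<close> its end.  A concatenation of codes can
  therefore be decoded, which embeds lists of words into words.
\<close>

fun delimited :: "'l \<Rightarrow> 'l \<Rightarrow> 'l list \<Rightarrow> 'l list" where
  "delimited p q [] = [q]"
| "delimited p q (x # w) = p # x # delimited p q w"

lemma delimited_append_inject:
  "p \<noteq> q \<Longrightarrow> delimited p q w @ u = delimited p q w' @ u' \<Longrightarrow> w = w' \<and> u = u'"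
  by (induction w arbitrary: w') (case_tac w'; auto)+

lemma concat_delimited_inject:
  assumes "p \<noteq> q" "concat (map (delimited p q) ws) = concat (map (delimited p q) ws')"
  shows "ws = ws'"
  using assms(2)
proof (induction ws arbitrary: ws')
  case Nil
  then show ?case by (cases ws'; cases "hd ws'") auto
next
  case (Cons w ws ws')
  then show ?case
  proof (cases ws')
    case Nil
    then show ?thesis using Cons.prems by (cases w) auto
  next
    case (Cons w' vs)
    then have "delimited p q w @ concat (map (delimited p q) ws) =
        delimited p q w' @ concat (map (delimited p q) vs)"
      using Cons.prems by simp
    from delimited_append_inject[OF assms(1) this] show ?thesis
      using Cons Cons.IH[of vs] by simp
  qed
qed

lemma word_value_list_inject:
  assumes "concat (map (\<lambda>w. [w, [Inl (c w)]]) l) = concat (map (\<lambda>w. [w, [Inl (c' w)]]) l')"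
  shows "l = l' \<and> (\<forall>w \<in> set l. c w = c' w)"
  using assms
proof (induction l arbitrary: l')
  case Nil
  then show ?case by (cases l') auto
next
  case (Cons w l)
  then show ?case by (cases l') auto
qed

text \<open>
  A finitely supported function is determined by the list of the words in its support, each followed
  by its value.  The syzygies in a free resolution consist of such functions; through this embedding
  their elements serve as basis elements of the next free module.
\<close>

lemma finite_support_words_inj:
  "\<exists>enc :: (('a + 'b) list \<Rightarrow> 'a) \<Rightarrow> ('a + 'b) list. inj_on enc {c. finite {w. c w \<noteq> z}}"
proof -
  \<comment> \<open>two letters that differ, whatever the default values are\<close>
  define p q :: "'a + 'b" where "p = Inl undefined" and "q = Inr undefined"
  have pq: "p \<noteq> q" by (simp add: p_def q_def)
  define supp where "supp c = (SOME l. set l = {w. c w \<noteq> z})" for c :: "('a + 'b) list \<Rightarrow> 'a"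
  have supp: "set (supp c) = {w. c w \<noteq> z}" if "finite {w. c w \<noteq> z}" for c
    unfolding supp_def using finite_list[OF that] by (rule someI_ex)
  let ?enc = "\<lambda>c. concat (map (delimited p q) (concat (map (\<lambda>w. [w, [Inl (c w)]]) (supp c))))"
  have "inj_on ?enc {c. finite {w. c w \<noteq> z}}"
  proof (rule inj_onI)
    fix c c' assume fin: "c \<in> {c. finite {w. c w \<noteq> z}}" "c' \<in> {c. finite {w. c w \<noteq> z}}"
      and eq: "?enc c = ?enc c'"
    note * = word_value_list_inject[OF concat_delimited_inject[OF pq eq]]
    show "c = c'"
    proof
      fix w
      show "c w = c' w"
      proof (cases "w \<in> set (supp c)")
        case True
        then show ?thesis using * by blast
      next
        case False
        moreover from False have "w \<notin> set (supp c')" using * by simp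
        ultimately show ?thesis using supp[of c] supp[of c'] fin by simp
      qed
    qed
  qed
  then show ?thesis by blast
qed

text \<open>
  The free module on (names for) all elements of a submodule \<open>K\<close> maps onto \<open>K\<close>.
\<close>

lemma (in cring) free_cover:
  fixes \<nu> :: "'n \<Rightarrow> 'i"
  assumes N: "module R N" and inj: "inj_on \<nu> K" and K: "submodule K R N"
  defines "d \<equiv> linear_extension R N (inv_into K \<nu>)"
  shows "d \<in> lin_hom R (free_module R (\<nu> ` K)) N"
    and "d ` carrier (free_module R (\<nu> ` K)) = K"
proof -
  interpret N: module R N by fact
  have KN: "K \<subseteq> carrier N" by (rule N.submoduleE(1)[OF K])
  have v: "inv_into K \<nu> b \<in> carrier N" if "b \<in> \<nu> ` K" for b
    using inv_into_into[OF that] KN by blast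
  show d: "d \<in> lin_hom R (free_module R (\<nu> ` K)) N"
    unfolding d_def by (rule linear_extension_lin_hom[OF N v])
  have gen: "d (free_gen R b) = inv_into K \<nu> b" if "b \<in> \<nu> ` K" for b
    unfolding d_def by (rule linear_extension_gen[OF N v that])
  have sub: "carrier (free_module R (\<nu> ` K)) \<subseteq> {c \<in> carrier (free_module R (\<nu> ` K)). d c \<in> K}"
    using gen by (intro free_module_generated submodule_preimage[OF free_module_module N d K])
      (auto simp: free_gen_closed inv_into_into)
  have "k \<in> d ` carrier (free_module R (\<nu> ` K))" if k: "k \<in> K" for k
  proof (rule image_eqI)
    show "k = d (free_gen R (\<nu> k))" using gen[of "\<nu> k"] k by (simp add: inv_into_f_f[OF inj])
    show "free_gen R (\<nu> k) \<in> carrier (free_module R (\<nu> ` K))" using k by (simp add: free_gen_closed)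
  qed
  then have "K \<subseteq> d ` carrier (free_module R (\<nu> ` K))" by (rule subsetI)
  moreover have "d ` carrier (free_module R (\<nu> ` K)) \<subseteq> K"
    using sub by (intro image_subsetI) (drule subsetD, assumption, simp)
  ultimately show "d ` carrier (free_module R (\<nu> ` K)) = K" by (rule equalityI[rotated])
qed

text \<open>
  The standard construction, in which each free module covers the kernel of the preceding map.  Only
  after this does the choice of a resolution in \<^const>\<open>Ext\<close> yield one.
\<close>

lemma (in cring) free_resolution_exists:
  fixes M :: "('a, 'c) module"
  assumes M: "module R M"
  shows "free_resolutions R M \<noteq> {}"
proof -
  obtain enc :: "(('a + 'c) list \<Rightarrow> 'a) \<Rightarrow> ('a + 'c) list"
    where enc: "inj_on enc {c. finite {w. c w \<noteq> \<zero>}}"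
    by (rule exE[OF finite_support_words_inj])
  have enc': "inj_on enc (carrier (free_module R B))" for B
    by (rule inj_on_subset[OF enc]) (auto simp: free_module_carrier_iff)
  define \<nu> :: "'c \<Rightarrow> ('a + 'c) list" where "\<nu> m = [Inr m]" for m
  define e where "e = linear_extension R M (inv_into (carrier M) \<nu>)"
  define F :: "('a + 'c) list set \<Rightarrow> ('a, ('a + 'c) list \<Rightarrow> 'a) module" where "F = free_module R"
  \<comment> \<open>A stage consists of the basis of a free module and the kernel of the map defined on that module.\<close>
  define cover where "cover B K = linear_extension R (F B) (inv_into K enc)" for B K
  define next_stage where "next_stage = (\<lambda>(B, K). (enc ` K,
      {c \<in> carrier (F (enc ` K)). cover B K c = \<zero>\<^bsub>F B\<^esub>}))"
  define stage where "stage n = (next_stage ^^ n)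
      (\<nu> ` carrier M, {c \<in> carrier (F (\<nu> ` carrier M)). e c = \<zero>\<^bsub>M\<^esub>})" for n
  define B K where "B n = fst (stage n)" and "K n = snd (stage n)" for n
  have F: "module R (F X)" for X unfolding F_def by (rule free_module_module)
  have \<nu>: "inj_on \<nu> (carrier M)" by (rule inj_onI) (simp add: \<nu>_def)
  have B0: "B 0 = \<nu> ` carrier M" and K0: "K 0 = {c \<in> carrier (F (B 0)). e c = \<zero>\<^bsub>M\<^esub>}"
    by (simp_all add: B_def K_def stage_def)
  have BS: "B (Suc n) = enc ` K n"
    and KS: "K (Suc n) = {c \<in> carrier (F (B (Suc n))). cover (B n) (K n) c = \<zero>\<^bsub>F (B n)\<^esub>}" for n
    by (simp_all add: B_def K_def stage_def next_stage_def split: prod.split)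
  have M': "submodule (carrier M) R M" by (rule module.carrier_is_submodule[OF M])
  have e: "e \<in> lin_hom R (F (B 0)) M" "e ` carrier (F (B 0)) = carrier M"
    unfolding e_def F_def B0 using free_cover[OF M \<nu> M'] by auto
  have step: "cover (B n) (K n) \<in> lin_hom R (F (B (Suc n))) (F (B n))
      \<and> cover (B n) (K n) ` carrier (F (B (Suc n))) = K n" if "submodule (K n) R (F (B n))" for n
  proof -
    have "inj_on enc (K n)"
      using inj_on_subset[OF enc'[of "B n"]] module.submoduleE(1)[OF F that] by (simp add: F_def)
    then show ?thesis
      using free_cover[OF F _ that, of enc] by (simp add: F_def BS cover_def)
  qed
  have K: "submodule (K n) R (F (B n))" for n
  proof (induction n)
    case 0
    then show ?case unfolding K0 by (rule submodule_kernel[OF F M e(1)])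
  next
    case (Suc n)
    then show ?case unfolding KS using step by (intro submodule_kernel[OF F F]) auto
  qed
  note step = step[OF K]
  define P where "P = \<lparr> cmod = (\<lambda>i. F (if i < 0 then {} else B (nat i))),
      cdiff = (\<lambda>i. if i \<le> 0 then (\<lambda>c w. \<zero>) else cover (B (nat (i - 1))) (K (nat (i - 1)))) \<rparr>"
  have Pmod: "module R (cmod P i)" for i by (simp add: P_def F)
  have pos: "cmod P i = F (B (Suc n))" "cmod P (i - 1) = F (B n)" "cdiff P i = cover (B n) (K n)"
    if "i = int (Suc n)" for i n
    using that by (auto simp: P_def nat_add_distrib)
  have nonpos: "cdiff P i = (\<lambda>c. \<zero>\<^bsub>cmod P (i - 1)\<^esub>)" if "i \<le> 0" for i
    using that by (simp add: P_def F_def free_module_ops)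
  have Pdiff: "cdiff P i \<in> lin_hom R (cmod P i) (cmod P (i - 1))" for i
  proof (cases "i \<le> 0")
    case True
    then show ?thesis by (simp add: nonpos lin_hom_zero_map[OF Pmod])
  next
    case False
    then obtain n where "i = int (Suc n)" by (metis not_le zero_less_imp_eq_int Suc_pred)
    then show ?thesis using pos step by simp
  qed
  have im: "cdiff P i ` carrier (cmod P i) = K n" if "i = int (Suc n)" for i n
    using pos[OF that] step by simp
  have dd: "cdiff P (i - 1) (cdiff P i x) = \<zero>\<^bsub>cmod P (i - 2)\<^esub>" if x: "x \<in> carrier (cmod P i)" for i x
  proof -
    consider "i \<le> 1" | n where "i = int (Suc (Suc n))"
      by (metis not_le zle_iff_zadd add.commute int_one_le_iff_zero_less linorder_le_less_linear of_nat_Suc one_add_one zless_iff_Suc_zadd)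
    then show ?thesis
    proof cases
      case 1
      then show ?thesis using nonpos[of "i - 1"] by simp
    next
      case 2
      then have "cdiff P i x \<in> K (Suc n)" using im[of i "Suc n"] x by blast
      moreover have "i - 1 = int (Suc n)" "i - 1 - 1 = i - 2" using 2 by auto
      ultimately show ?thesis using pos[of "i - 1" n] by (simp add: KS)
    qed
  qed
  have "is_complex R P"
    using Pmod Pdiff dd by (simp add: is_complex_def)
  moreover have "\<exists>B. cmod P n = free_module R B" for n
    by (auto simp: P_def F_def)
  moreover have "zero_module (cmod P n)" if "n < 0" for n
    using that by (auto simp: zero_module_def P_def F_def free_module_carrier_iff free_module_ops)
  moreover have "cycles P n = boundaries P n" if n: "n \<ge> 1" for n
  proof -
    obtain k where k: "n = int (Suc k)"
      using n by (metis int_one_le_iff_zero_less zero_less_imp_eq_int Suc_pred)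
    then have "boundaries P n = K (Suc k)"
      unfolding boundaries_def by (intro im) simp
    then show ?thesis using pos[OF k] by (simp add: cycles_def KS)
  qed
  moreover have "boundaries P 0 = K 0" unfolding boundaries_def by (intro im) simp
  moreover have "cmod P 0 = F (B 0)" by (simp add: P_def)
  ultimately have "P \<in> free_resolutions R M"
    using e by (auto simp: free_resolutions_def K0)
  then show ?thesis by blast
qed

section \<open>Lifting linear maps along a surjection with vanishing first Ext\<close>

lemma lin_hom_restrict:
  "module R M \<Longrightarrow> h \<in> lin_hom R M N \<Longrightarrow> restrict h (carrier M) \<in> lin_hom R M N \<inter> extensional (carrier M)"
  using lin_hom_cong[of R M "restrict h (carrier M)" h] by auto

text \<open>
  The homology module consists of cosets of the boundaries, so it vanishes only if each cocycle, as an
  element of its own coset, is a boundary.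
\<close>

lemma Ext1_cocycle_is_coboundary:
  assumes M: "module R M" and N: "module R N" and ext: "zero_module (Ext R 1 M N)"
  defines "P \<equiv> (SOME P. P \<in> free_resolutions R M)"
  assumes chi: "\<chi> \<in> lin_hom R (cmod P 1) N"
    and cocycle: "\<And>x. x \<in> carrier (cmod P 2) \<Longrightarrow> \<chi> (cdiff P 2 x) = \<zero>\<^bsub>N\<^esub>"
  shows "\<exists>\<theta> \<in> lin_hom R (cmod P 0) N. \<forall>x \<in> carrier (cmod P 1). \<chi> x = \<theta> (cdiff P 1 x)"
proof -
  interpret R: cring R by (rule module_cring[OF M])
  interpret N: module R N by (rule N)
  have "P \<in> free_resolutions R M"
    unfolding P_def using R.free_resolution_exists[OF M] by (simp add: some_in_eq)
  then have cx: "is_complex R P" by (simp add: free_resolutions_def)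
  have P: "module R (cmod P i)" and d: "cdiff P i \<in> lin_hom R (cmod P i) (cmod P (i - 1))" for i
    using cx by (auto simp: is_complex_def)
  let ?H = "hom_from R P N"
  let ?b = "boundaries ?H (-1)"
  let ?x = "restrict \<chi> (carrier (cmod P 1))"
  let ?A = "cmod ?H (-1)\<lparr>carrier := cycles ?H (-1)\<rparr>"
  have x: "?x \<in> cycles ?H (-1)"
    using lin_hom_restrict[OF P chi] cocycle lin_hom_closed[OF d[of 2]]
    by (auto simp: cycles_def hom_from_def hom_module_def)
  then have "?b +>\<^bsub>?A\<^esub> ?x \<in> carrier (homology ?H (-1))"
    by (auto simp: homology_def quotient_module_def A_RCOSETS_def RCOSETS_def a_r_coset_def)
  then have eq: "?b +>\<^bsub>?A\<^esub> ?x = ?b"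
    using ext by (auto simp: Ext_def P_def zero_module_def homology_def quotient_module_def)
  let ?z = "\<lambda>x\<in>carrier (cmod P 0). \<zero>\<^bsub>N\<^esub>"
  have "(\<lambda>x\<in>carrier (cmod P 1). ?z (cdiff P 1 x)) \<in> ?b"
    using lin_hom_restrict[OF P lin_hom_zero_map[OF N]]
    by (auto simp: boundaries_def hom_from_def hom_module_def intro!: image_eqI[of _ _ ?z])
  moreover have "(\<lambda>x\<in>carrier (cmod P 1). ?z (cdiff P 1 x)) = (\<lambda>x\<in>carrier (cmod P 1). \<zero>\<^bsub>N\<^esub>)"
    using lin_hom_closed[OF d[of 1]] by (auto simp: restrict_def)
  ultimately have "(\<lambda>x\<in>carrier (cmod P 1). \<zero>\<^bsub>N\<^esub>) \<oplus>\<^bsub>?A\<^esub> ?x \<in> ?b +>\<^bsub>?A\<^esub> ?x"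
    by (auto simp: a_r_coset_def r_coset_def)
  moreover have "(\<lambda>x\<in>carrier (cmod P 1). \<zero>\<^bsub>N\<^esub>) \<oplus>\<^bsub>?A\<^esub> ?x = ?x"
    using lin_hom_closed[OF chi] by (auto simp: hom_from_def hom_module_def restrict_def)
  ultimately have "?x \<in> ?b" using eq by simp
  then obtain \<theta> where \<theta>: "\<theta> \<in> lin_hom R (cmod P 0) N"
    and x: "?x = (\<lambda>x\<in>carrier (cmod P 1). \<theta> (cdiff P 1 x))"
    by (auto simp: boundaries_def hom_from_def hom_module_def)
  have "\<chi> y = \<theta> (cdiff P 1 y)" if "y \<in> carrier (cmod P 1)" for y
    using fun_cong[OF x, of y] that by simp
  with \<theta> show ?thesis by blast
qed

lemma lin_hom_factor:
  assumes P: "module R P" and M: "module R M" and N: "module R N"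
    and e: "e \<in> lin_hom R P M" "e ` carrier P = carrier M"
    and h: "h \<in> lin_hom R P N" and ker: "\<And>x. x \<in> carrier P \<Longrightarrow> e x = \<zero>\<^bsub>M\<^esub> \<Longrightarrow> h x = \<zero>\<^bsub>N\<^esub>"
  shows "\<exists>k \<in> lin_hom R M N. \<forall>x \<in> carrier P. k (e x) = h x"
proof -
  interpret P: module R P by (rule P)
  interpret M: module R M by (rule M)
  interpret N: module R N by (rule N)
  define k where "k y = h (inv_into (carrier P) e y)" for y
  have k: "k (e x) = h x" if x: "x \<in> carrier P" for x
  proof -
    let ?x = "inv_into (carrier P) e (e x)"
    have x': "?x \<in> carrier P" "e ?x = e x"
      using x by (auto intro: inv_into_into f_inv_into_f)
    then have "e (?x \<ominus>\<^bsub>P\<^esub> x) = \<zero>\<^bsub>M\<^esub>"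
      using x lin_hom_closed[OF e(1) x] by (simp add: lin_hom_minus[OF P M e(1)] M.diff_zero_iff)
    then have "h ?x \<ominus>\<^bsub>N\<^esub> h x = \<zero>\<^bsub>N\<^esub>"
      using ker[of "?x \<ominus>\<^bsub>P\<^esub> x"] x x' by (simp add: lin_hom_minus[OF P N h])
    then show ?thesis using x x' lin_hom_closed[OF h] by (simp add: k_def N.diff_zero_iff)
  qed
  have "k \<in> lin_hom R M N"
  proof (rule lin_homI)
    fix y assume "y \<in> carrier M"
    then obtain x where "x \<in> carrier P" "y = e x" using e(2) by blast
    then show "k y \<in> carrier N" by (simp add: k lin_hom_closed[OF h])
  next
    fix y y' assume "y \<in> carrier M" "y' \<in> carrier M"
    then obtain x x' where x: "x \<in> carrier P" "y = e x" "x' \<in> carrier P" "y' = e x'"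
      using e(2) by blast
    then have "k (y \<oplus>\<^bsub>M\<^esub> y') = k (e (x \<oplus>\<^bsub>P\<^esub> x'))" by (simp add: lin_hom_add[OF e(1)])
    then show "k (y \<oplus>\<^bsub>M\<^esub> y') = k y \<oplus>\<^bsub>N\<^esub> k y'"
      using x by (simp add: k lin_hom_add[OF h])
  next
    fix r y assume r: "r \<in> carrier R" "y \<in> carrier M"
    then obtain x where x: "x \<in> carrier P" "y = e x" using e(2) by blast
    then have "k (r \<odot>\<^bsub>M\<^esub> y) = k (e (r \<odot>\<^bsub>P\<^esub> x))" using r by (simp add: lin_hom_smult[OF e(1)])
    then show "k (r \<odot>\<^bsub>M\<^esub> y) = r \<odot>\<^bsub>N\<^esub> k y"
      using r x by (simp add: k lin_hom_smult[OF h])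
  qed
  then show ?thesis using k by blast
qed

lemma module_regular_cancel:
  assumes N: "module R N" and f: "f \<in> carrier R" and reg: "module_regular N f"
    and y: "y \<in> carrier N" "y' \<in> carrier N" and eq: "f \<odot>\<^bsub>N\<^esub> y = f \<odot>\<^bsub>N\<^esub> y'"
  shows "y = y'"
proof -
  interpret N: module R N by (rule N)
  have "f \<odot>\<^bsub>N\<^esub> (y \<ominus>\<^bsub>N\<^esub> y') = \<zero>\<^bsub>N\<^esub>"
    using y eq f N.diff_zero_iff[of "f \<odot>\<^bsub>N\<^esub> y" "f \<odot>\<^bsub>N\<^esub> y'"]
    by (simp add: a_minus_def N.smult_r_distr N.smult_r_minus)
  then show ?thesis using reg y by (auto simp: module_regular_def N.diff_zero_iff)
qed

text \<open>
  The quotient by \<open>f\<close> is unique by regularity, and uniqueness makes it linear.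
\<close>

lemma smult_divide_lin_hom:
  assumes M: "module R M" and N: "module R N" and f: "f \<in> carrier R" and reg: "module_regular N f"
    and h: "h \<in> lin_hom R M N"
    and div: "\<And>x. x \<in> carrier M \<Longrightarrow> \<exists>y \<in> carrier N. h x = f \<odot>\<^bsub>N\<^esub> y"
  shows "\<exists>k \<in> lin_hom R M N. \<forall>x \<in> carrier M. h x = f \<odot>\<^bsub>N\<^esub> k x"
proof -
  interpret M: module R M by (rule M)
  interpret N: module R N by (rule N)
  note inj = module_regular_cancel[OF N f reg]
  have "\<exists>k. \<forall>x \<in> carrier M. k x \<in> carrier N \<and> h x = f \<odot>\<^bsub>N\<^esub> k x"
    by (rule bchoice) (use div in blast)
  then obtain k where "\<forall>x \<in> carrier M. k x \<in> carrier N \<and> h x = f \<odot>\<^bsub>N\<^esub> k x" ..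
  then have k: "k x \<in> carrier N" "h x = f \<odot>\<^bsub>N\<^esub> k x" if "x \<in> carrier M" for x
    using that by simp_all
  have "k \<in> lin_hom R M N"
  proof (rule lin_homI)
    fix x y assume xy: "x \<in> carrier M" "y \<in> carrier M"
    then have "f \<odot>\<^bsub>N\<^esub> k (x \<oplus>\<^bsub>M\<^esub> y) = f \<odot>\<^bsub>N\<^esub> (k x \<oplus>\<^bsub>N\<^esub> k y)"
      using f k(1) by (simp add: N.smult_r_distr k(2)[symmetric] lin_hom_add[OF h])
    from inj[OF _ _ this] show "k (x \<oplus>\<^bsub>M\<^esub> y) = k x \<oplus>\<^bsub>N\<^esub> k y"
      using k(1) xy by auto
  next
    fix r x assume rx: "r \<in> carrier R" "x \<in> carrier M"
    then have "f \<odot>\<^bsub>N\<^esub> k (r \<odot>\<^bsub>M\<^esub> x) = r \<odot>\<^bsub>N\<^esub> (f \<odot>\<^bsub>N\<^esub> k x)"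
      using k(2)[of "r \<odot>\<^bsub>M\<^esub> x"] k(2)[of x] by (simp add: lin_hom_smult[OF h])
    also have "\<dots> = f \<odot>\<^bsub>N\<^esub> (r \<odot>\<^bsub>N\<^esub> k x)"
      using rx k(1) f by (simp add: N.smult_assoc1[symmetric] M.R.m_comm)
    finally have "f \<odot>\<^bsub>N\<^esub> k (r \<odot>\<^bsub>M\<^esub> x) = f \<odot>\<^bsub>N\<^esub> (r \<odot>\<^bsub>N\<^esub> k x)" .
    from inj[OF _ _ this] show "k (r \<odot>\<^bsub>M\<^esub> x) = r \<odot>\<^bsub>N\<^esub> k x"
      using k(1) rx by auto
  qed (use k(1) in auto)
  then show ?thesis using k(2) by blast
qed

text \<open>
  This is the part \<open>Hom(M, N) \<rightarrow> Hom(M, N/fN) \<rightarrow> Ext\<^sup>1(M, N)\<close> of a long exact sequence, made explicit on a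
  free resolution \<open>P\<close> of \<open>M\<close> with augmentation \<open>e\<close>.  As \<open>P\<^sub>0\<close> is free, \<open>\<phi>e\<close> lifts to \<open>g: P\<^sub>0 \<rightarrow> N\<close>.  The
  composite of \<open>g\<close> with \<open>P\<^sub>1 \<rightarrow> P\<^sub>0\<close> vanishes modulo \<open>f\<close>, so it is \<open>f\<chi>\<close> for a cocycle \<open>\<chi>\<close>, the connecting
  image of \<open>\<phi>\<close>.  If \<open>\<chi>\<close> is the coboundary of \<open>\<theta>\<close>, then \<open>g - f\<theta>\<close> factors through \<open>M\<close>, and it still lifts \<open>\<phi>\<close>.
\<close>

lemma lift_of_zero_Ext1:
  assumes M: "module R M" and N: "module R N" and Q: "module R Q"
    and f: "f \<in> carrier R" and reg: "module_regular N f"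
    and ext: "zero_module (Ext R 1 M N)"
    and \<pi>: "\<pi> \<in> lin_hom R N Q" "\<pi> ` carrier N = carrier Q"
    and ker: "\<And>y. y \<in> carrier N \<Longrightarrow> \<pi> y = \<zero>\<^bsub>Q\<^esub> \<longleftrightarrow> (\<exists>z \<in> carrier N. y = f \<odot>\<^bsub>N\<^esub> z)"
    and \<phi>: "\<phi> \<in> lin_hom R M Q"
  shows "\<exists>\<psi> \<in> lin_hom R M N. \<forall>x \<in> carrier M. \<pi> (\<psi> x) = \<phi> x"
proof -
  interpret R: cring R by (rule module_cring[OF M])
  interpret M: module R M by (rule M)
  interpret N: module R N by (rule N)
  interpret Q: module R Q by (rule Q)
  define P where "P = (SOME P. P \<in> free_resolutions R M)"
  have "P \<in> free_resolutions R M"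
    unfolding P_def using R.free_resolution_exists[OF M] by (simp add: some_in_eq)
  then obtain e where cx: "is_complex R P" and free: "\<And>n. \<exists>B. cmod P n = free_module R B"
    and e: "e \<in> lin_hom R (cmod P 0) M" "e ` carrier (cmod P 0) = carrier M"
    and ker_e: "{x \<in> carrier (cmod P 0). e x = \<zero>\<^bsub>M\<^esub>} = boundaries P 0"
    by (auto simp: free_resolutions_def)
  have P: "module R (cmod P i)" and d: "cdiff P i \<in> lin_hom R (cmod P i) (cmod P (i - 1))" for i
    using cx by (auto simp: is_complex_def)
  note d1 = d[of 1, simplified] and d2 = d[of 2, simplified]
  have d12: "cdiff P 1 (cdiff P 2 x) = \<zero>\<^bsub>cmod P 0\<^esub>" if "x \<in> carrier (cmod P 2)" for x
    using cx that by (auto simp: is_complex_def dest!: spec[of _ 2])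
  have ed: "e (cdiff P 1 x) = \<zero>\<^bsub>M\<^esub>" if "x \<in> carrier (cmod P 1)" for x
    using ker_e that by (auto simp: boundaries_def)
  obtain B where B: "cmod P 0 = free_module R B" using free by blast
  have "\<exists>v. \<forall>b \<in> B. v b \<in> carrier N \<and> \<pi> (v b) = \<phi> (e (free_gen R b))"
  proof (intro bchoice ballI)
    fix b assume "b \<in> B"
    then have "\<phi> (e (free_gen R b)) \<in> \<pi> ` carrier N"
      unfolding \<pi>(2) by (intro lin_hom_closed[OF \<phi>] lin_hom_closed[OF e(1)]) (simp add: B R.free_gen_closed)
    then show "\<exists>y. y \<in> carrier N \<and> \<pi> y = \<phi> (e (free_gen R b))" by (auto elim!: imageE)
  qed
  then obtain v where "\<forall>b \<in> B. v b \<in> carrier N \<and> \<pi> (v b) = \<phi> (e (free_gen R b))" ..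
  then have v: "v b \<in> carrier N" "\<pi> (v b) = \<phi> (e (free_gen R b))" if "b \<in> B" for b
    using that by simp_all
  define g where "g = linear_extension R N v"
  have g: "g \<in> lin_hom R (cmod P 0) N"
    unfolding g_def B by (rule R.linear_extension_lin_hom[OF N v(1)])
  have g_gen: "g (free_gen R b) = v b" if "b \<in> B" for b
    unfolding g_def by (rule R.linear_extension_gen[OF N v(1) that])
  have g_lift: "\<pi> (g x) = \<phi> (e x)" if "x \<in> carrier (cmod P 0)" for x
    using that g_gen v(2) unfolding B
    by (intro R.lin_hom_free_eqI[OF Q lin_hom_comp[OF g \<pi>(1), unfolded B]
          lin_hom_comp[OF e(1) \<phi>, unfolded B], of x]) auto
  have "\<exists>\<chi> \<in> lin_hom R (cmod P 1) N. \<forall>x \<in> carrier (cmod P 1). g (cdiff P 1 x) = f \<odot>\<^bsub>N\<^esub> \<chi> x"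
  proof (rule smult_divide_lin_hom[OF P N f reg lin_hom_comp[OF d1 g]])
    fix x assume x: "x \<in> carrier (cmod P 1)"
    have "\<pi> (g (cdiff P 1 x)) = \<zero>\<^bsub>Q\<^esub>"
      using x lin_hom_closed[OF d1] by (simp add: g_lift ed lin_hom_zero[OF M Q \<phi>])
    then show "\<exists>y \<in> carrier N. g (cdiff P 1 x) = f \<odot>\<^bsub>N\<^esub> y"
      using ker lin_hom_closed[OF g] lin_hom_closed[OF d1] x by blast
  qed
  then obtain \<chi> where \<chi>: "\<chi> \<in> lin_hom R (cmod P 1) N"
    and g\<chi>: "\<And>x. x \<in> carrier (cmod P 1) \<Longrightarrow> g (cdiff P 1 x) = f \<odot>\<^bsub>N\<^esub> \<chi> x" by blast
  have "\<exists>\<theta> \<in> lin_hom R (cmod P 0) N. \<forall>x \<in> carrier (cmod P 1). \<chi> x = \<theta> (cdiff P 1 x)"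
    unfolding P_def
  proof (rule Ext1_cocycle_is_coboundary[OF M N ext], fold P_def)
    fix x assume x: "x \<in> carrier (cmod P 2)"
    have "f \<odot>\<^bsub>N\<^esub> \<chi> (cdiff P 2 x) = g (cdiff P 1 (cdiff P 2 x))"
      using x lin_hom_closed[OF d2] by (simp add: g\<chi>)
    also have "\<dots> = \<zero>\<^bsub>N\<^esub>" using x by (simp add: d12 lin_hom_zero[OF P N g])
    finally show "\<chi> (cdiff P 2 x) = \<zero>\<^bsub>N\<^esub>"
      using reg x lin_hom_closed[OF d2] lin_hom_closed[OF \<chi>] by (auto simp: module_regular_def)
  qed (rule \<chi>)
  then obtain \<theta> where \<theta>: "\<theta> \<in> lin_hom R (cmod P 0) N"
    and \<chi>\<theta>: "\<And>x. x \<in> carrier (cmod P 1) \<Longrightarrow> \<chi> x = \<theta> (cdiff P 1 x)" by blast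
  let ?h = "\<lambda>x. g x \<ominus>\<^bsub>N\<^esub> f \<odot>\<^bsub>N\<^esub> \<theta> x"
  have h: "?h \<in> lin_hom R (cmod P 0) N"
    by (rule lin_hom_diff_map[OF N g lin_hom_smult_map[OF N f \<theta>]])
  have "\<exists>\<psi> \<in> lin_hom R M N. \<forall>x \<in> carrier (cmod P 0). \<psi> (e x) = ?h x"
  proof (rule lin_hom_factor[OF P M N e h])
    fix x assume "x \<in> carrier (cmod P 0)" "e x = \<zero>\<^bsub>M\<^esub>"
    then obtain y where y: "y \<in> carrier (cmod P 1)" "x = cdiff P 1 y"
      using ker_e by (auto simp: boundaries_def)
    then have "g x = f \<odot>\<^bsub>N\<^esub> \<theta> x" by (simp add: g\<chi> \<chi>\<theta>)
    then show "?h x = \<zero>\<^bsub>N\<^esub>"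
      using y lin_hom_closed[OF g] lin_hom_closed[OF \<theta>] lin_hom_closed[OF d1] f by (simp add: N.diff_zero_iff)
  qed
  then obtain \<psi> where \<psi>: "\<psi> \<in> lin_hom R M N" "\<And>x. x \<in> carrier (cmod P 0) \<Longrightarrow> \<psi> (e x) = ?h x"
    by blast
  have "\<pi> (\<psi> y) = \<phi> y" if "y \<in> carrier M" for y
  proof -
    have "y \<in> e ` carrier (cmod P 0)" using e(2) that by simp
    then obtain x where x: "x \<in> carrier (cmod P 0)" "y = e x" by (elim imageE) simp
    then have c: "g x \<in> carrier N" "\<theta> x \<in> carrier N" "f \<odot>\<^bsub>N\<^esub> \<theta> x \<in> carrier N"
      using lin_hom_closed[OF g] lin_hom_closed[OF \<theta>] f by auto
    then have "\<pi> (f \<odot>\<^bsub>N\<^esub> \<theta> x) = \<zero>\<^bsub>Q\<^esub>" using ker[OF c(3)] c(2) by blast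
    then have "\<pi> (?h x) = \<pi> (g x) \<ominus>\<^bsub>Q\<^esub> \<zero>\<^bsub>Q\<^esub>"
      using lin_hom_minus[OF N Q \<pi>(1) c(1) c(3)] by simp
    also have "\<dots> = \<pi> (g x)"
      using lin_hom_closed[OF \<pi>(1) c(1)] by (simp add: a_minus_def)
    finally show ?thesis using \<psi>(2)[OF x(1)] g_lift[OF x(1)] x(2) by simp
  qed
  then show ?thesis using \<psi>(1) by blast
qed

section \<open>Reduction modulo a ring element\<close>

definition restrict_scalars :: "('a \<Rightarrow> 'r) \<Rightarrow> ('r, 'b) module \<Rightarrow> ('a, 'b) module"
  where "restrict_scalars h M =
    \<lparr> carrier = carrier M, mult = mult M, one = one M, zero = zero M, add = add M,
      smult = (\<lambda>s. smult M (h s)) \<rparr>"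

lemma restrict_scalars_simps [simp]:
  "carrier (restrict_scalars h M) = carrier M"
  "\<zero>\<^bsub>restrict_scalars h M\<^esub> = \<zero>\<^bsub>M\<^esub>"
  "x \<oplus>\<^bsub>restrict_scalars h M\<^esub> y = x \<oplus>\<^bsub>M\<^esub> y"
  "s \<odot>\<^bsub>restrict_scalars h M\<^esub> x = h s \<odot>\<^bsub>M\<^esub> x"
  by (simp_all add: restrict_scalars_def)

lemma restrict_scalars_abelian_group:
  assumes "abelian_group M"
  shows "abelian_group (restrict_scalars h M)"
proof -
  interpret M: abelian_group M by fact
  show ?thesis
  proof (rule abelian_groupI)
    fix x assume "x \<in> carrier (restrict_scalars h M)"
    then show "\<exists>y\<in>carrier (restrict_scalars h M).
        y \<oplus>\<^bsub>restrict_scalars h M\<^esub> x = \<zero>\<^bsub>restrict_scalars h M\<^esub>"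
      by (auto intro!: bexI[of _ "\<ominus>\<^bsub>M\<^esub> x"] simp: M.l_neg)
  qed (auto simp: M.a_ac)
qed

lemma restrict_scalars_module:
  assumes "cring S" "h \<in> ring_hom S R" "module R M"
  shows "module S (restrict_scalars h M)"
proof -
  interpret M: module R M by fact
  show ?thesis
    using assms(1) ring_hom_closed[OF assms(2)] ring_hom_add[OF assms(2)] ring_hom_mult[OF assms(2)]
      ring_hom_one[OF assms(2)]
    by (intro moduleI restrict_scalars_abelian_group)
       (auto simp: M.abelian_group_axioms M.smult_l_distr M.smult_r_distr M.smult_assoc1)
qed

text \<open>
  A surjective ring homomorphism with principal kernel \<open>(f)\<close>.  Working with \<open>R\<close> and \<open>g\<close> up to
  isomorphism keeps cosets of ideals out of the arguments about modules.
\<close>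

locale reduction =
  fixes S :: "('a, 'x) ring_scheme" and R :: "('r, 'y) ring_scheme"
    and g :: "'a \<Rightarrow> 'r" and f :: 'a
  assumes S: "cring S" and R: "cring R"
    and hom: "g \<in> ring_hom S R" and surj: "g ` carrier S = carrier R"
    and f: "f \<in> carrier S"
    and ker: "s \<in> carrier S \<Longrightarrow> g s = \<zero>\<^bsub>R\<^esub> \<longleftrightarrow> (\<exists>t \<in> carrier S. s = f \<otimes>\<^bsub>S\<^esub> t)"
begin

sublocale S: cring S by (rule S)
sublocale R: cring R by (rule R)
sublocale g: ring_hom_cring S R g
  by (intro ring_hom_cringI ring_hom_ringI2 S R hom S.ring_axioms R.ring_axioms)

lemma g_f: "g f = \<zero>\<^bsub>R\<^esub>"
  using ker[OF f] f by (metis S.one_closed S.r_one)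

lemma scalar_lift:
  assumes "r \<in> carrier R"
  obtains s where "s \<in> carrier S" "r = g s"
  using assms surj by (metis imageE)

text \<open>
  An \<open>S\<close>-module annihilated by \<open>f\<close> is an \<open>R\<close>-module: scalars act through arbitrary preimages under \<open>g\<close>,
  which differ by multiples of \<open>f\<close>.
\<close>

lemma module_descends:
  fixes Q :: "('a, 'n) module"
  assumes Q: "module S Q" and fQ: "\<And>x. x \<in> carrier Q \<Longrightarrow> f \<odot>\<^bsub>Q\<^esub> x = \<zero>\<^bsub>Q\<^esub>"
  defines "Q' \<equiv> restrict_scalars (inv_into (carrier S) g) Q"
  shows "module R Q'"
    and "\<And>s x. s \<in> carrier S \<Longrightarrow> x \<in> carrier Q \<Longrightarrow> g s \<odot>\<^bsub>Q'\<^esub> x = s \<odot>\<^bsub>Q\<^esub> x"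
proof -
  interpret Q: module S Q by (rule Q)
  have act: "g s \<odot>\<^bsub>Q'\<^esub> x = s \<odot>\<^bsub>Q\<^esub> x" if s: "s \<in> carrier S" and x: "x \<in> carrier Q" for s x
  proof -
    let ?s = "inv_into (carrier S) g (g s)"
    have s': "?s \<in> carrier S" "g ?s = g s"
      using s by (auto intro: inv_into_into f_inv_into_f)
    have "g (?s \<ominus>\<^bsub>S\<^esub> s) = \<zero>\<^bsub>R\<^esub>"
      using s s' by (simp add: a_minus_def R.r_neg)
    then obtain t where t: "t \<in> carrier S" "?s \<ominus>\<^bsub>S\<^esub> s = f \<otimes>\<^bsub>S\<^esub> t"
      using ker[of "?s \<ominus>\<^bsub>S\<^esub> s"] s s' by auto
    then have "?s = s \<oplus>\<^bsub>S\<^esub> f \<otimes>\<^bsub>S\<^esub> t"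
      using s s' f by (simp add: S.diff_eq_iff)
    then have "?s \<odot>\<^bsub>Q\<^esub> x = s \<odot>\<^bsub>Q\<^esub> x \<oplus>\<^bsub>Q\<^esub> f \<odot>\<^bsub>Q\<^esub> (t \<odot>\<^bsub>Q\<^esub> x)"
      using s f t(1) x by (simp add: Q.smult_l_distr Q.smult_assoc1)
    then show ?thesis
      using s t(1) x by (simp add: Q'_def fQ)
  qed
  then show "\<And>s x. s \<in> carrier S \<Longrightarrow> x \<in> carrier Q \<Longrightarrow> g s \<odot>\<^bsub>Q'\<^esub> x = s \<odot>\<^bsub>Q\<^esub> x" .
  have Q': "carrier Q' = carrier Q" "\<And>x y. x \<oplus>\<^bsub>Q'\<^esub> y = x \<oplus>\<^bsub>Q\<^esub> y" by (simp_all add: Q'_def)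
  show "module R Q'"
  proof (rule moduleI)
    show "abelian_group Q'"
      unfolding Q'_def by (rule restrict_scalars_abelian_group[OF Q.abelian_group_axioms])
  next
    fix r x assume rx: "r \<in> carrier R" "x \<in> carrier Q'"
    from rx(1) obtain s where s: "s \<in> carrier S" "r = g s" by (rule scalar_lift)
    with rx show "r \<odot>\<^bsub>Q'\<^esub> x \<in> carrier Q'" by (simp add: act Q')
    fix y assume "y \<in> carrier Q'"
    with s rx show "r \<odot>\<^bsub>Q'\<^esub> (x \<oplus>\<^bsub>Q'\<^esub> y) = r \<odot>\<^bsub>Q'\<^esub> x \<oplus>\<^bsub>Q'\<^esub> r \<odot>\<^bsub>Q'\<^esub> y"
      by (simp add: act Q' Q.smult_r_distr)
  next
    fix r r' x assume rx: "r \<in> carrier R" "r' \<in> carrier R" "x \<in> carrier Q'"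
    from rx(1) obtain s where s: "s \<in> carrier S" "r = g s" by (rule scalar_lift)
    from rx(2) obtain s' where s': "s' \<in> carrier S" "r' = g s'" by (rule scalar_lift)
    show "(r \<oplus>\<^bsub>R\<^esub> r') \<odot>\<^bsub>Q'\<^esub> x = r \<odot>\<^bsub>Q'\<^esub> x \<oplus>\<^bsub>Q'\<^esub> r' \<odot>\<^bsub>Q'\<^esub> x"
      using s s' rx act[of "s \<oplus>\<^bsub>S\<^esub> s'" x] by (simp add: act Q' Q.smult_l_distr)
    show "(r \<otimes>\<^bsub>R\<^esub> r') \<odot>\<^bsub>Q'\<^esub> x = r \<odot>\<^bsub>Q'\<^esub> (r' \<odot>\<^bsub>Q'\<^esub> x)"
      using s s' rx act[of "s \<otimes>\<^bsub>S\<^esub> s'" x] by (simp add: act Q' Q.smult_assoc1)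
  next
    fix x assume "x \<in> carrier Q'"
    then show "\<one>\<^bsub>R\<^esub> \<odot>\<^bsub>Q'\<^esub> x = x" using act[of "\<one>\<^bsub>S\<^esub>" x] by (simp add: Q')
  qed (rule R)
qed

abbreviation bc :: "('a, 'm) module \<Rightarrow> ('r, ('r \<times> 'm \<Rightarrow> 'r) set) module"
  where "bc M \<equiv> base_change S R g M"

abbreviation bc_map :: "('a, 'n) module \<Rightarrow> ('m \<Rightarrow> 'n) \<Rightarrow> ('r \<times> 'm \<Rightarrow> 'r) set \<Rightarrow> ('r \<times> 'n \<Rightarrow> 'r) set"
  where "bc_map N h \<equiv> base_change_map S R g N h"

abbreviation tker :: "('a, 'm) module \<Rightarrow> ('r \<times> 'm \<Rightarrow> 'r) set"
  where "tker M \<equiv> tensor_kernel S R g M"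

text \<open>
  The map \<open>m \<mapsto> 1 \<otimes> m\<close>.  Its image, its kernel and its naturality determine base change along \<open>g\<close>, and
  all arguments about reduced modules and maps go through these three properties.
\<close>

definition unit_map :: "('a, 'm) module \<Rightarrow> 'm \<Rightarrow> ('r \<times> 'm \<Rightarrow> 'r) set"
  where "unit_map M m = tker M +>\<^bsub>tensor_free R M\<^esub> free_gen R (\<one>\<^bsub>R\<^esub>, m)"

lemma tensor_free_module: "module R (tensor_free R M)"
  unfolding tensor_free_def by (rule R.free_module_module)

lemma tensor_gen_closed:
  "r \<in> carrier R \<Longrightarrow> m \<in> carrier M \<Longrightarrow> free_gen R (r, m) \<in> carrier (tensor_free R M)"
  unfolding tensor_free_def by (rule R.free_gen_closed) simp

text \<open>
  The four families of relations as four conditions, for use in both directions: the relations lie in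
  the tensor kernel, and they are killed by maps out of the tensor product.
\<close>

lemma tensor_relations_subset_iff:
  fixes M :: "('a, 'm) module"
  defines "F \<equiv> tensor_free R M"
  shows "tensor_relations S R g M \<subseteq> X \<longleftrightarrow>
    (\<forall>r \<in> carrier R. \<forall>r' \<in> carrier R. \<forall>m \<in> carrier M.
       free_gen R (r \<oplus>\<^bsub>R\<^esub> r', m) \<ominus>\<^bsub>F\<^esub> (free_gen R (r, m) \<oplus>\<^bsub>F\<^esub> free_gen R (r', m)) \<in> X) \<and>
    (\<forall>r \<in> carrier R. \<forall>m \<in> carrier M. \<forall>m' \<in> carrier M.
       free_gen R (r, m \<oplus>\<^bsub>M\<^esub> m') \<ominus>\<^bsub>F\<^esub> (free_gen R (r, m) \<oplus>\<^bsub>F\<^esub> free_gen R (r, m')) \<in> X) \<and>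
    (\<forall>r \<in> carrier R. \<forall>s \<in> carrier S. \<forall>m \<in> carrier M.
       free_gen R (r \<otimes>\<^bsub>R\<^esub> g s, m) \<ominus>\<^bsub>F\<^esub> free_gen R (r, s \<odot>\<^bsub>M\<^esub> m) \<in> X) \<and>
    (\<forall>r \<in> carrier R. \<forall>r' \<in> carrier R. \<forall>m \<in> carrier M.
       free_gen R (r \<otimes>\<^bsub>R\<^esub> r', m) \<ominus>\<^bsub>F\<^esub> (r \<odot>\<^bsub>F\<^esub> free_gen R (r', m)) \<in> X)"
  unfolding tensor_relations_def Let_def F_def Un_subset_iff conj_assoc
  by (intro arg_cong2[where f = "(\<and>)"]) blast+

lemma tensor_relations_kernel: "tensor_relations S R g M \<subseteq> tker M"
  unfolding tensor_kernel_def by (rule submodule_generated_superset)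

context
  fixes M :: "('a, 'm) module"
  assumes M: "module S M"
begin

interpretation M: module S M by (rule M)
interpretation F: module R "tensor_free R M" by (rule tensor_free_module)

lemma tensor_relations_closed: "tensor_relations S R g M \<subseteq> carrier (tensor_free R M)"
  unfolding tensor_relations_subset_iff by (simp add: tensor_gen_closed)

lemma tensor_kernel_submodule: "submodule (tker M) R (tensor_free R M)"
  unfolding tensor_kernel_def
  by (rule submodule_generated_submodule[OF tensor_free_module tensor_relations_closed])

lemma base_change_module: "module R (bc M)"
  unfolding base_change_def by (rule quotient_module_module[OF tensor_free_module tensor_kernel_submodule])

interpretation B: module R "bc M" by (rule base_change_module)

lemma tensor_class_lin_hom: "(\<lambda>c. tker M +>\<^bsub>tensor_free R M\<^esub> c) \<in> lin_hom R (tensor_free R M) (bc M)"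
  unfolding base_change_def by (rule coset_lin_hom[OF tensor_free_module tensor_kernel_submodule])

lemmas tensor_class_eq_iff = coset_eq_iff[OF tensor_free_module tensor_kernel_submodule]

lemma unit_map_closed: "m \<in> carrier M \<Longrightarrow> unit_map M m \<in> carrier (bc M)"
  unfolding unit_map_def by (rule lin_hom_closed[OF tensor_class_lin_hom]) (simp add: tensor_gen_closed)

lemma unit_map_add:
  assumes "m \<in> carrier M" "m' \<in> carrier M"
  shows "unit_map M (m \<oplus>\<^bsub>M\<^esub> m') = unit_map M m \<oplus>\<^bsub>bc M\<^esub> unit_map M m'"
proof -
  have "free_gen R (\<one>\<^bsub>R\<^esub>, m \<oplus>\<^bsub>M\<^esub> m') \<ominus>\<^bsub>tensor_free R M\<^esub>
      (free_gen R (\<one>\<^bsub>R\<^esub>, m) \<oplus>\<^bsub>tensor_free R M\<^esub> free_gen R (\<one>\<^bsub>R\<^esub>, m')) \<in> tker M"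
    using tensor_relations_kernel[of M] assms unfolding tensor_relations_subset_iff by simp
  then show ?thesis
    using assms unfolding unit_map_def
    by (simp add: lin_hom_add[OF tensor_class_lin_hom, symmetric] tensor_gen_closed tensor_class_eq_iff)
qed

lemma tensor_class_gen:
  assumes "s \<in> carrier S" "m \<in> carrier M"
  shows "tker M +>\<^bsub>tensor_free R M\<^esub> free_gen R (g s, m) = unit_map M (s \<odot>\<^bsub>M\<^esub> m)"
proof -
  have "free_gen R (\<one>\<^bsub>R\<^esub> \<otimes>\<^bsub>R\<^esub> g s, m) \<ominus>\<^bsub>tensor_free R M\<^esub> free_gen R (\<one>\<^bsub>R\<^esub>, s \<odot>\<^bsub>M\<^esub> m) \<in> tker M"
    using tensor_relations_kernel[of M] assms unfolding tensor_relations_subset_iff by blast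
  then show ?thesis
    using assms unfolding unit_map_def by (simp add: tensor_gen_closed tensor_class_eq_iff)
qed

lemma unit_map_smult:
  assumes "s \<in> carrier S" "m \<in> carrier M"
  shows "unit_map M (s \<odot>\<^bsub>M\<^esub> m) = g s \<odot>\<^bsub>bc M\<^esub> unit_map M m"
proof -
  have "g s \<in> carrier R" "\<one>\<^bsub>R\<^esub> \<in> carrier R" using assms by simp_all
  then have "free_gen R (g s \<otimes>\<^bsub>R\<^esub> \<one>\<^bsub>R\<^esub>, m) \<ominus>\<^bsub>tensor_free R M\<^esub>
      g s \<odot>\<^bsub>tensor_free R M\<^esub> free_gen R (\<one>\<^bsub>R\<^esub>, m) \<in> tker M"
    using tensor_relations_kernel[of M] assms unfolding tensor_relations_subset_iff by blast
  then show ?thesis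
    using assms unfolding tensor_class_gen[OF assms, symmetric]
    by (simp add: unit_map_def lin_hom_smult[OF tensor_class_lin_hom, symmetric] tensor_gen_closed
        tensor_class_eq_iff)
qed

lemma unit_map_lin_hom: "unit_map M \<in> lin_hom S M (restrict_scalars g (bc M))"
  by (rule lin_homI) (simp_all add: unit_map_closed unit_map_add unit_map_smult)

lemma unit_map_zero: "unit_map M \<zero>\<^bsub>M\<^esub> = \<zero>\<^bsub>bc M\<^esub>"
  using lin_hom_zero[OF M restrict_scalars_module[OF S hom base_change_module] unit_map_lin_hom] by simp

lemma unit_map_neg:
  assumes "m \<in> carrier M"
  shows "unit_map M (\<ominus>\<^bsub>M\<^esub> m) = \<ominus>\<^bsub>bc M\<^esub> unit_map M m"
proof -
  have "unit_map M (\<ominus>\<^bsub>M\<^esub> m) \<oplus>\<^bsub>bc M\<^esub> unit_map M m = \<zero>\<^bsub>bc M\<^esub>"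
    using assms by (simp add: unit_map_add[symmetric] M.M.l_neg unit_map_zero)
  then show ?thesis
    using assms by (simp add: B.M.minus_equality unit_map_closed)
qed

lemma unit_map_minus:
  assumes "m \<in> carrier M" "m' \<in> carrier M"
  shows "unit_map M (m \<ominus>\<^bsub>M\<^esub> m') = unit_map M m \<ominus>\<^bsub>bc M\<^esub> unit_map M m'"
  using assms by (simp add: a_minus_def unit_map_add unit_map_neg)

text \<open>
  The image of the unit map is a submodule because \<open>g\<close> is onto, and it contains all generators, since
  \<open>g s \<otimes> m = 1 \<otimes> sm\<close>.
\<close>

lemma unit_map_image: "unit_map M ` carrier M = carrier (bc M)"
proof
  show "unit_map M ` carrier M \<subseteq> carrier (bc M)" by (auto simp: unit_map_closed)
  have "submodule (unit_map M ` carrier M) R (bc M)"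
  proof (rule B.submoduleI)
    fix r X assume r: "r \<in> carrier R" and X: "X \<in> unit_map M ` carrier M"
    from r obtain s where "s \<in> carrier S" "r = g s" by (rule scalar_lift)
    then show "r \<odot>\<^bsub>bc M\<^esub> X \<in> unit_map M ` carrier M"
      using X by (auto simp: unit_map_smult[symmetric])
  qed (auto simp: unit_map_closed unit_map_zero[symmetric] unit_map_neg[symmetric] unit_map_add[symmetric])
  from submodule_preimage[OF tensor_free_module base_change_module tensor_class_lin_hom this]
  have "carrier (tensor_free R M) \<subseteq>
      {c \<in> carrier (tensor_free R M). tker M +>\<^bsub>tensor_free R M\<^esub> c \<in> unit_map M ` carrier M}"
    unfolding tensor_free_def
  proof (rule R.free_module_generated, fold tensor_free_def)
    fix z assume "z \<in> carrier R \<times> carrier M"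
    then obtain r m where z: "r \<in> carrier R" "m \<in> carrier M" "z = (r, m)" by blast
    from z(1) obtain s where "s \<in> carrier S" "r = g s" by (rule scalar_lift)
    with z show "free_gen R z \<in>
        {c \<in> carrier (tensor_free R M). tker M +>\<^bsub>tensor_free R M\<^esub> c \<in> unit_map M ` carrier M}"
      by (simp add: tensor_gen_closed tensor_class_gen)
  qed
  then show "carrier (bc M) \<subseteq> unit_map M ` carrier M"
    unfolding base_change_def quotient_module_carrier by blast
qed

lemma unit_map_surj:
  assumes "X \<in> carrier (bc M)"
  obtains m where "m \<in> carrier M" "X = unit_map M m"
  using assms unfolding unit_map_image[symmetric] by blast

lemma multiples_submodule: "submodule ((\<lambda>m. f \<odot>\<^bsub>M\<^esub> m) ` carrier M) S M"
proof (rule M.submoduleI)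
  show "\<zero>\<^bsub>M\<^esub> \<in> (\<lambda>m. f \<odot>\<^bsub>M\<^esub> m) ` carrier M"
    using f by (auto intro!: image_eqI[of _ _ "\<zero>\<^bsub>M\<^esub>"])
next
  fix s x assume "s \<in> carrier S" "x \<in> (\<lambda>m. f \<odot>\<^bsub>M\<^esub> m) ` carrier M"
  then show "s \<odot>\<^bsub>M\<^esub> x \<in> (\<lambda>m. f \<odot>\<^bsub>M\<^esub> m) ` carrier M"
    using f by (auto simp: M.smult_assoc1[symmetric] S.m_comm) (simp add: M.smult_assoc1)
qed (use f in \<open>auto simp: M.smult_r_minus[symmetric] M.smult_r_distr[symmetric]\<close>)

text \<open>
  To see that \<open>1 \<otimes> m = 0\<close> implies \<open>m \<in> fM\<close>, map \<open>R \<otimes> M\<close> to \<open>M/fM\<close> by \<open>r \<otimes> m \<mapsto> r[m]\<close>, where \<open>M/fM\<close> is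
  regarded as an \<open>R\<close>-module.  In the other direction, \<open>1 \<otimes> fm = g f \<otimes> m = 0\<close>.
\<close>

lemma unit_map_kernel:
  assumes m: "m \<in> carrier M"
  shows "unit_map M m = \<zero>\<^bsub>bc M\<^esub> \<longleftrightarrow> (\<exists>m' \<in> carrier M. m = f \<odot>\<^bsub>M\<^esub> m')"
proof
  assume "\<exists>m' \<in> carrier M. m = f \<odot>\<^bsub>M\<^esub> m'"
  then show "unit_map M m = \<zero>\<^bsub>bc M\<^esub>"
    using f by (auto simp: unit_map_smult g_f unit_map_closed)
next
  assume zero: "unit_map M m = \<zero>\<^bsub>bc M\<^esub>"
  let ?K = "(\<lambda>m. f \<odot>\<^bsub>M\<^esub> m) ` carrier M"
  let ?F = "tensor_free R M"
  define Q where "Q = quotient_module M ?K"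
  define Q' where "Q' = restrict_scalars (inv_into (carrier S) g) Q"
  define cl where "cl x = ?K +>\<^bsub>M\<^esub> x" for x
  have Q: "module S Q" unfolding Q_def by (rule quotient_module_module[OF M multiples_submodule])
  have cl: "cl \<in> lin_hom S M Q"
    unfolding Q_def cl_def[abs_def] by (rule coset_lin_hom[OF M multiples_submodule])
  have cl0: "cl x = \<zero>\<^bsub>Q\<^esub> \<longleftrightarrow> x \<in> ?K" if "x \<in> carrier M" for x
    using coset_eq_self_iff[OF M multiples_submodule that] by (simp add: cl_def Q_def quotient_module_zero)
  have fQ: "f \<odot>\<^bsub>Q\<^esub> X = \<zero>\<^bsub>Q\<^esub>" if X: "X \<in> carrier Q" for X
  proof -
    obtain x where x: "x \<in> carrier M" "X = cl x"
      using X by (auto simp: Q_def quotient_module_carrier cl_def)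
    then have "f \<odot>\<^bsub>Q\<^esub> X = cl (f \<odot>\<^bsub>M\<^esub> x)" using f by (simp add: lin_hom_smult[OF cl])
    then show ?thesis using x f by (simp add: cl0)
  qed
  have Q': "module R Q'" and act: "\<And>s x. s \<in> carrier S \<Longrightarrow> x \<in> carrier Q \<Longrightarrow> g s \<odot>\<^bsub>Q'\<^esub> x = s \<odot>\<^bsub>Q\<^esub> x"
    unfolding Q'_def by (rule module_descends[OF Q fQ], assumption+)+
  interpret Q': module R Q' by (rule Q')
  have Q'_simps: "carrier Q' = carrier Q" "x \<oplus>\<^bsub>Q'\<^esub> y = x \<oplus>\<^bsub>Q\<^esub> y" "\<zero>\<^bsub>Q'\<^esub> = \<zero>\<^bsub>Q\<^esub>" for x y
    by (simp_all add: Q'_def)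
  have clQ': "cl x \<in> carrier Q'" if "x \<in> carrier M" for x
    using lin_hom_closed[OF cl that] by (simp add: Q'_simps)
  have cl_add: "cl (x \<oplus>\<^bsub>M\<^esub> y) = cl x \<oplus>\<^bsub>Q'\<^esub> cl y" if "x \<in> carrier M" "y \<in> carrier M" for x y
    using that by (simp add: lin_hom_add[OF cl] Q'_simps)
  define v where "v = (\<lambda>(r, x). r \<odot>\<^bsub>Q'\<^esub> cl x)"
  have v: "v z \<in> carrier Q'" if "z \<in> carrier R \<times> carrier M" for z
    using that clQ' by (auto simp: v_def)
  define \<Phi> where "\<Phi> = linear_extension R Q' v"
  have \<Phi>: "\<Phi> \<in> lin_hom R ?F Q'"
    unfolding \<Phi>_def tensor_free_def by (rule R.linear_extension_lin_hom[OF Q' v])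
  have \<Phi>_gen: "\<Phi> (free_gen R (r, x)) = r \<odot>\<^bsub>Q'\<^esub> cl x" if "r \<in> carrier R" "x \<in> carrier M" for r x
    using R.linear_extension_gen[OF Q', of "carrier R \<times> carrier M" v "(r, x)"] v that
    by (simp add: \<Phi>_def v_def)
  have \<Phi>_minus: "\<Phi> (a \<ominus>\<^bsub>?F\<^esub> b) = \<zero>\<^bsub>Q'\<^esub>"
    if "a \<in> carrier ?F" "b \<in> carrier ?F" "\<Phi> a = \<Phi> b" for a b
    using that lin_hom_closed[OF \<Phi>]
    by (simp add: lin_hom_minus[OF tensor_free_module Q' \<Phi>] Q'.diff_zero_iff)
  have "tensor_relations S R g M \<subseteq> {c \<in> carrier ?F. \<Phi> c = \<zero>\<^bsub>Q'\<^esub>}"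
    unfolding tensor_relations_subset_iff
  proof (intro conjI ballI CollectI)
    fix r r' x assume "r \<in> carrier R" "r' \<in> carrier R" "x \<in> carrier M"
    then show "\<Phi> (free_gen R (r \<oplus>\<^bsub>R\<^esub> r', x) \<ominus>\<^bsub>?F\<^esub> (free_gen R (r, x) \<oplus>\<^bsub>?F\<^esub> free_gen R (r', x))) = \<zero>\<^bsub>Q'\<^esub>"
      by (intro \<Phi>_minus)
        (auto simp: tensor_gen_closed \<Phi>_gen lin_hom_add[OF \<Phi>] Q'.smult_l_distr clQ')
  next
    fix r x y assume "r \<in> carrier R" "x \<in> carrier M" "y \<in> carrier M"
    then show "\<Phi> (free_gen R (r, x \<oplus>\<^bsub>M\<^esub> y) \<ominus>\<^bsub>?F\<^esub> (free_gen R (r, x) \<oplus>\<^bsub>?F\<^esub> free_gen R (r, y))) = \<zero>\<^bsub>Q'\<^esub>"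
      by (intro \<Phi>_minus)
        (auto simp: tensor_gen_closed \<Phi>_gen lin_hom_add[OF \<Phi>] Q'.smult_r_distr clQ' cl_add)
  next
    fix r s x assume "r \<in> carrier R" "s \<in> carrier S" "x \<in> carrier M"
    then show "\<Phi> (free_gen R (r \<otimes>\<^bsub>R\<^esub> g s, x) \<ominus>\<^bsub>?F\<^esub> free_gen R (r, s \<odot>\<^bsub>M\<^esub> x)) = \<zero>\<^bsub>Q'\<^esub>"
      by (intro \<Phi>_minus)
        (auto simp: tensor_gen_closed \<Phi>_gen Q'.smult_assoc1 clQ' lin_hom_smult[OF cl] act
          lin_hom_closed[OF cl])
  next
    fix r r' x assume "r \<in> carrier R" "r' \<in> carrier R" "x \<in> carrier M"
    then show "\<Phi> (free_gen R (r \<otimes>\<^bsub>R\<^esub> r', x) \<ominus>\<^bsub>?F\<^esub> r \<odot>\<^bsub>?F\<^esub> free_gen R (r', x)) = \<zero>\<^bsub>Q'\<^esub>"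
      by (intro \<Phi>_minus)
        (auto simp: tensor_gen_closed \<Phi>_gen lin_hom_smult[OF \<Phi>] Q'.smult_assoc1 clQ')
  qed (auto simp: tensor_gen_closed)
  then have K: "tker M \<subseteq> {c \<in> carrier ?F. \<Phi> c = \<zero>\<^bsub>Q'\<^esub>}"
    unfolding tensor_kernel_def
    by (rule submodule_generated_least[OF submodule_kernel[OF tensor_free_module Q' \<Phi>]])
  have "free_gen R (\<one>\<^bsub>R\<^esub>, m) \<in> tker M"
    using zero coset_eq_self_iff[OF tensor_free_module tensor_kernel_submodule, of "free_gen R (\<one>\<^bsub>R\<^esub>, m)"] m
    by (simp add: unit_map_def base_change_def quotient_module_zero tensor_gen_closed)
  then have "\<Phi> (free_gen R (\<one>\<^bsub>R\<^esub>, m)) = \<zero>\<^bsub>Q'\<^esub>" using K by blast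
  then have "cl m = \<zero>\<^bsub>Q\<^esub>" using m clQ' by (simp add: \<Phi>_gen Q'_simps)
  then show "\<exists>m' \<in> carrier M. m = f \<odot>\<^bsub>M\<^esub> m'" using m cl0 by blast
qed

end

text \<open>
  The underlying map of free modules sends relations to relations, so all members of the union that
  defines the value at a class are the same coset.
\<close>

lemma base_change_map_unit_map:
  fixes M :: "('a, 'm) module" and N :: "('a, 'n) module"
  assumes M: "module S M" and N: "module S N" and h: "h \<in> lin_hom S M N" and m: "m \<in> carrier M"
  shows "bc_map N h (unit_map M m) = unit_map N (h m)"
proof -
  let ?F = "tensor_free R M" and ?G = "tensor_free R N"
  interpret M: module S M by (rule M)
  interpret N: module S N by (rule N)
  interpret F: module R ?F by (rule tensor_free_module)
  interpret G: module R ?G by (rule tensor_free_module)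
  define v where "v = (\<lambda>z :: 'r \<times> 'm. free_gen R (fst z, h (snd z)))"
  have v: "v z \<in> carrier ?G" if "z \<in> carrier R \<times> carrier M" for z
    using that lin_hom_closed[OF h] by (auto simp: v_def tensor_gen_closed)
  define \<Psi> where "\<Psi> = linear_extension R ?G v"
  have \<Psi>: "\<Psi> \<in> lin_hom R ?F ?G"
    unfolding \<Psi>_def tensor_free_def[of R M]
    by (rule R.linear_extension_lin_hom[OF tensor_free_module v])
  have \<Psi>_gen: "\<Psi> (free_gen R (r, x)) = free_gen R (r, h x)" if "r \<in> carrier R" "x \<in> carrier M" for r x
  proof -
    have "(r, x) \<in> carrier R \<times> carrier M" using that by simp
    from R.linear_extension_gen[OF tensor_free_module v this] show ?thesis
      by (simp add: \<Psi>_def v_def)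
  qed
  have "tensor_relations S R g M \<subseteq> {c \<in> carrier ?F. \<Psi> c \<in> tker N}"
    using tensor_relations_kernel[of N] lin_hom_closed[OF h]
    unfolding tensor_relations_subset_iff
    by (simp add: tensor_gen_closed lin_hom_minus[OF tensor_free_module tensor_free_module \<Psi>]
        lin_hom_add[OF \<Psi>] lin_hom_smult[OF \<Psi>] \<Psi>_gen lin_hom_add[OF h] lin_hom_smult[OF h])
  then have K: "tker M \<subseteq> {c \<in> carrier ?F. \<Psi> c \<in> tker N}"
    unfolding tensor_kernel_def[of S R g M]
    by (rule submodule_generated_least[OF submodule_preimage[OF tensor_free_module tensor_free_module
          \<Psi> tensor_kernel_submodule[OF N]]])
  interpret KM: abelian_subgroup "tker M" ?F
    by (rule submodule_abelian_subgroup[OF tensor_free_module tensor_kernel_submodule[OF M]])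
  let ?e = "free_gen R (\<one>\<^bsub>R\<^esub>, m)"
  have e: "?e \<in> carrier ?F" using m by (simp add: tensor_gen_closed)
  have "tker N +>\<^bsub>?G\<^esub> \<Psi> c = unit_map N (h m)" if c: "c \<in> unit_map M m" for c
  proof -
    have c': "c \<in> carrier ?F" using KM.a_elemrcos_carrier[OF e] c by (simp add: unit_map_def)
    have "c \<ominus>\<^bsub>?F\<^esub> ?e \<in> tker M"
      using KM.a_rcos_module[OF e c'] c by (simp add: unit_map_def a_minus_def)
    then have "\<Psi> c \<ominus>\<^bsub>?G\<^esub> \<Psi> ?e \<in> tker N"
      using K c' e by (auto simp: lin_hom_minus[OF tensor_free_module tensor_free_module \<Psi>])
    then show ?thesis
      using lin_hom_closed[OF \<Psi> c'] lin_hom_closed[OF \<Psi> e] m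
      by (simp add: unit_map_def tensor_class_eq_iff[OF N, symmetric] \<Psi>_gen)
  qed
  moreover have "unit_map M m \<noteq> {}" using KM.a_rcos_self[OF e] by (auto simp: unit_map_def)
  ultimately have "(\<Union>c \<in> unit_map M m. tker N +>\<^bsub>?G\<^esub> \<Psi> c) = unit_map N (h m)"
    by (rule SUP_eq_const[rotated])
  then show ?thesis
    by (simp add: base_change_map_def Let_def \<Psi>_def v_def linear_extension_def)
qed

lemma base_change_map_lin_hom:
  fixes M :: "('a, 'm) module" and N :: "('a, 'n) module"
  assumes M: "module S M" and N: "module S N" and h: "h \<in> lin_hom S M N"
  shows "bc_map N h \<in> lin_hom R (bc M) (bc N)"
proof -
  note U = base_change_map_unit_map[OF M N h]
  interpret M: module S M by (rule M)
  show ?thesis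
  proof (rule lin_homI)
    fix X assume "X \<in> carrier (bc M)"
    then obtain x where x: "x \<in> carrier M" "X = unit_map M x" by (rule unit_map_surj[OF M])
    then show "bc_map N h X \<in> carrier (bc N)"
      by (simp add: U unit_map_closed[OF N] lin_hom_closed[OF h])
    fix Y assume "Y \<in> carrier (bc M)"
    then obtain y where y: "y \<in> carrier M" "Y = unit_map M y" by (rule unit_map_surj[OF M])
    with x show "bc_map N h (X \<oplus>\<^bsub>bc M\<^esub> Y) = bc_map N h X \<oplus>\<^bsub>bc N\<^esub> bc_map N h Y"
      by (simp add: unit_map_add[OF M, symmetric] U lin_hom_add[OF h] unit_map_add[OF N] lin_hom_closed[OF h])
  next
    fix r X assume r: "r \<in> carrier R" and "X \<in> carrier (bc M)"
    then obtain x where x: "x \<in> carrier M" "X = unit_map M x" by (metis unit_map_surj[OF M])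
    from r obtain s where "s \<in> carrier S" "r = g s" by (rule scalar_lift)
    with x show "bc_map N h (r \<odot>\<^bsub>bc M\<^esub> X) = r \<odot>\<^bsub>bc N\<^esub> bc_map N h X"
      by (simp add: unit_map_smult[OF M, symmetric] U lin_hom_smult[OF h] unit_map_smult[OF N] lin_hom_closed[OF h])
  qed
qed

text \<open>
  Composition with the unit map turns \<open>\<phi>\<close> into an \<open>S\<close>-linear map \<open>M \<rightarrow> N/fN\<close>, to which vanishing of
  \<open>Ext\<^sup>1\<close> applies.
\<close>

lemma reduced_map_lifts:
  fixes M :: "('a, 'm) module" and N :: "('a, 'n) module"
  assumes M: "module S M" and N: "module S N"
    and reg: "module_regular N f" and ext: "zero_module (Ext S 1 M N)"
    and \<phi>: "\<phi> \<in> lin_hom R (bc M) (bc N)"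
  obtains \<psi> where "\<psi> \<in> lin_hom S M N" "\<And>m. m \<in> carrier M \<Longrightarrow> unit_map N (\<psi> m) = \<phi> (unit_map M m)"
proof -
  let ?Q = "restrict_scalars g (bc N)"
  have Q: "module S ?Q" by (rule restrict_scalars_module[OF S hom base_change_module[OF N]])
  have "\<phi> \<in> lin_hom S (restrict_scalars g (bc M)) ?Q"
    using \<phi> by (intro lin_homI) (simp_all add: lin_hom_closed lin_hom_add lin_hom_smult)
  from lin_hom_comp[OF unit_map_lin_hom[OF M] this]
  have "(\<lambda>m. \<phi> (unit_map M m)) \<in> lin_hom S M ?Q" .
  from lift_of_zero_Ext1[OF M N Q f reg ext unit_map_lin_hom[OF N] _ _ this]
  show ?thesis using that unit_map_image[OF N] unit_map_kernel[OF N] by auto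
qed

lemma reduced_map_zero:
  fixes M :: "('a, 'm) module" and N :: "('a, 'n) module"
  assumes M: "module S M" and N: "module S N" and reg: "module_regular N f"
    and \<psi>: "\<psi> \<in> lin_hom S M N"
    and zero: "\<And>m. m \<in> carrier M \<Longrightarrow> unit_map N (\<psi> m) = \<zero>\<^bsub>bc N\<^esub>"
  obtains \<chi> where "\<chi> \<in> lin_hom S M N" "\<And>m. m \<in> carrier M \<Longrightarrow> \<psi> m = f \<odot>\<^bsub>N\<^esub> \<chi> m"
proof -
  have "\<exists>\<chi> \<in> lin_hom S M N. \<forall>m \<in> carrier M. \<psi> m = f \<odot>\<^bsub>N\<^esub> \<chi> m"
    using zero unit_map_kernel[OF N] lin_hom_closed[OF \<psi>]
    by (intro smult_divide_lin_hom[OF M N f reg \<psi>]) blast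
  then show ?thesis using that by blast
qed

end

section \<open>Chain maps and homotopies\<close>

lemma is_complexD:
  assumes "is_complex R X"
  shows "module R (cmod X i)" "cdiff X i \<in> lin_hom R (cmod X i) (cmod X (i - 1))"
    "x \<in> carrier (cmod X i) \<Longrightarrow> cdiff X (i - 1) (cdiff X i x) = \<zero>\<^bsub>cmod X (i - 2)\<^esub>"
  using assms by (auto simp: is_complex_def)

lemma is_complex_diff_up:
  assumes "is_complex R X"
  shows "cdiff X (i + 1) \<in> lin_hom R (cmod X (i + 1)) (cmod X i)"
  using is_complexD(2)[OF assms, of "i + 1"] by simp

lemma chain_mapsD:
  assumes "\<alpha> \<in> chain_maps R X Y"
  shows "\<alpha> i \<in> lin_hom R (cmod X i) (cmod Y i)"
    "x \<in> carrier (cmod X i) \<Longrightarrow> \<alpha> (i - 1) (cdiff X i x) = cdiff Y i (\<alpha> i x)"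
  using assms by (auto simp: chain_maps_def)

lemma chain_maps_closed:
  "\<alpha> \<in> chain_maps R X Y \<Longrightarrow> x \<in> carrier (cmod X i) \<Longrightarrow> \<alpha> i x \<in> carrier (cmod Y i)"
  by (rule lin_hom_closed[OF chain_mapsD(1)])

lemma chain_maps_id: "(\<lambda>i. id) \<in> chain_maps R X X"
  using lin_hom_id by (auto simp: chain_maps_def id_def)

lemma chain_maps_comp:
  assumes "\<alpha> \<in> chain_maps R X Y" "\<beta> \<in> chain_maps R Y Z"
  shows "(\<lambda>i. \<beta> i \<circ> \<alpha> i) \<in> chain_maps R X Z"
  using lin_hom_comp[OF chain_mapsD(1)[OF assms(1)] chain_mapsD(1)[OF assms(2)]]
    chain_mapsD(2)[OF assms(1)] chain_mapsD(2)[OF assms(2)] lin_hom_closed[OF chain_mapsD(1)[OF assms(1)]]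
  by (auto simp: chain_maps_def comp_def)

lemma chain_maps_sum:
  assumes Y: "is_complex R Y" and \<alpha>: "\<alpha> \<in> chain_maps R X Y" and \<beta>: "\<beta> \<in> chain_maps R X Y"
  shows "(\<lambda>i x. \<alpha> i x \<oplus>\<^bsub>cmod Y i\<^esub> \<beta> i x) \<in> chain_maps R X Y"
  using lin_hom_sum_map[OF is_complexD(1)[OF Y] chain_mapsD(1)[OF \<alpha>] chain_mapsD(1)[OF \<beta>]]
    lin_hom_closed[OF chain_mapsD(1)[OF \<alpha>]] lin_hom_closed[OF chain_mapsD(1)[OF \<beta>]]
  by (auto simp: chain_maps_def chain_mapsD(2)[OF \<alpha>] chain_mapsD(2)[OF \<beta>] lin_hom_add[OF is_complexD(2)[OF Y]])

lemma chain_maps_shift: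
  assumes X: "is_complex R X" and Y: "is_complex R Y" and \<alpha>: "\<alpha> \<in> chain_maps R X Y"
  shows "(\<lambda>i. \<alpha> (i - 1)) \<in> chain_maps R (complex_shift X) (complex_shift Y)"
proof -
  have "\<alpha> (i - 2) (\<ominus>\<^bsub>cmod X (i - 2)\<^esub> cdiff X (i - 1) x) =
      \<ominus>\<^bsub>cmod Y (i - 2)\<^esub> cdiff Y (i - 1) (\<alpha> (i - 1) x)" if x: "x \<in> carrier (cmod X (i - 1))" for i x
    using lin_hom_neg[OF is_complexD(1)[OF X] is_complexD(1)[OF Y] chain_mapsD(1)[OF \<alpha>],
        of "cdiff X (i - 1) x" "i - 2"] lin_hom_closed[OF is_complexD(2)[OF X] x]
      chain_mapsD(2)[OF \<alpha> x] by simp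
  then show ?thesis
    using chain_mapsD(1)[OF \<alpha>] by (auto simp: chain_maps_def complex_shift_def)
qed

lemma complex_shift_complex:
  assumes X: "is_complex R X"
  shows "is_complex R (complex_shift X)"
proof -
  have "(\<lambda>x. \<ominus>\<^bsub>cmod X (i - 2)\<^esub> cdiff X (i - 1) x) \<in> lin_hom R (cmod X (i - 1)) (cmod X (i - 2))" for i
    using lin_hom_neg_map[OF is_complexD(1)[OF X] is_complexD(2)[OF X, of "i - 1"]] by simp
  moreover have "\<ominus>\<^bsub>cmod X (i - 3)\<^esub> cdiff X (i - 2) (\<ominus>\<^bsub>cmod X (i - 2)\<^esub> cdiff X (i - 1) x) =
      \<zero>\<^bsub>cmod X (i - 3)\<^esub>" if x: "x \<in> carrier (cmod X (i - 1))" for i x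
  proof -
    interpret Xi: module R "cmod X (i - 3)" by (rule is_complexD(1)[OF X])
    have c: "cdiff X (i - 1) x \<in> carrier (cmod X (i - 2))"
      using lin_hom_closed[OF is_complexD(2)[OF X] x] by simp
    then have "cdiff X (i - 2) (\<ominus>\<^bsub>cmod X (i - 2)\<^esub> cdiff X (i - 1) x) =
        \<ominus>\<^bsub>cmod X (i - 3)\<^esub> cdiff X (i - 2) (cdiff X (i - 1) x)"
      using lin_hom_neg[OF is_complexD(1)[OF X] is_complexD(1)[OF X] is_complexD(2)[OF X] c] by simp
    then show ?thesis using is_complexD(3)[OF X x] by simp
  qed
  ultimately show ?thesis
    using is_complexD(1)[OF X] by (simp add: is_complex_def complex_shift_def)
qed

text \<open>
  That \<open>h\<close> contracts the family \<open>b\<close> is additive in the pair \<open>(h, b)\<close>.  Homotopy of chain maps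
  says that their difference is contracted, so that its formal properties reduce to this additivity.
\<close>

definition contracts ::
    "('a, 'x) ring_scheme \<Rightarrow> ('a, 'b) chain_complex \<Rightarrow> ('a, 'b) chain_complex \<Rightarrow>
     (int \<Rightarrow> 'b \<Rightarrow> 'b) \<Rightarrow> (int \<Rightarrow> 'b \<Rightarrow> 'b) \<Rightarrow> bool"
  where "contracts R X Y h b \<longleftrightarrow>
    (\<forall>i. h i \<in> lin_hom R (cmod X i) (cmod Y (i + 1))) \<and>
    (\<forall>i. \<forall>x \<in> carrier (cmod X i).
       b i x = h (i - 1) (cdiff X i x) \<oplus>\<^bsub>cmod Y i\<^esub> cdiff Y (i + 1) (h i x))"

lemma contractsD:
  assumes "contracts R X Y h b"
  shows "h i \<in> lin_hom R (cmod X i) (cmod Y (i + 1))"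
    and "x \<in> carrier (cmod X i) \<Longrightarrow>
      b i x = h (i - 1) (cdiff X i x) \<oplus>\<^bsub>cmod Y i\<^esub> cdiff Y (i + 1) (h i x)"
  using assms by (simp_all add: contracts_def)

lemma chain_homotopicI:
  assumes "\<alpha> \<in> chain_maps R X Y" "\<beta> \<in> chain_maps R X Y"
    and "contracts R X Y h b"
    and "\<And>i x. x \<in> carrier (cmod X i) \<Longrightarrow> \<alpha> i x \<ominus>\<^bsub>cmod Y i\<^esub> \<beta> i x = b i x"
  shows "(\<alpha>, \<beta>) \<in> chain_homotopic R X Y"
  using assms by (auto simp: chain_homotopic_def contracts_def)

lemma chain_homotopicE:
  assumes "(\<alpha>, \<beta>) \<in> chain_homotopic R X Y"
  obtains h where "\<alpha> \<in> chain_maps R X Y" "\<beta> \<in> chain_maps R X Y"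
    and "contracts R X Y h (\<lambda>i x. \<alpha> i x \<ominus>\<^bsub>cmod Y i\<^esub> \<beta> i x)"
  using assms unfolding chain_homotopic_def contracts_def by blast

text \<open>
  Homotopies pass between complexes with the same modules whose differentials agree on carriers but
  may differ as functions; a shifted reduced complex and the reduction of a shift are related like this.
\<close>

lemma chain_homotopic_cong:
  assumes "(\<alpha>, \<beta>) \<in> chain_homotopic R X Y" "\<alpha> \<in> chain_maps R X' Y'" "\<beta> \<in> chain_maps R X' Y'"
    and "\<And>i. cmod X' i = cmod X i" "\<And>i. cmod Y' i = cmod Y i"
    and "\<And>i x. x \<in> carrier (cmod X i) \<Longrightarrow> cdiff X' i x = cdiff X i x"
    and "\<And>i y. y \<in> carrier (cmod Y i) \<Longrightarrow> cdiff Y' i y = cdiff Y i y"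
  shows "(\<alpha>, \<beta>) \<in> chain_homotopic R X' Y'"
proof -
  from assms(1) obtain h where h: "contracts R X Y h (\<lambda>i x. \<alpha> i x \<ominus>\<^bsub>cmod Y i\<^esub> \<beta> i x)"
    by (rule chain_homotopicE)
  then have "contracts R X' Y' h (\<lambda>i x. \<alpha> i x \<ominus>\<^bsub>cmod Y i\<^esub> \<beta> i x)"
    using assms(4-7) lin_hom_closed[OF contractsD(1)[OF h]] by (simp add: contracts_def)
  then show ?thesis by (rule chain_homotopicI[OF assms(2,3)]) (simp add: assms(5))
qed

context
  fixes R :: "('a, 'x) ring_scheme" and X :: "('a, 'b) chain_complex" and Y :: "('a, 'b) chain_complex"
  assumes X: "is_complex R X" and Y: "is_complex R Y"
begin

lemma contracts_terms_closed:
  assumes "\<And>i. h i \<in> lin_hom R (cmod X i) (cmod Y (i + 1))" "x \<in> carrier (cmod X i)"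
  shows "h (i - 1) (cdiff X i x) \<in> carrier (cmod Y i)" "cdiff Y (i + 1) (h i x) \<in> carrier (cmod Y i)"
  using lin_hom_closed[OF assms(1)[of "i - 1"] lin_hom_closed[OF is_complexD(2)[OF X] assms(2)]]
    lin_hom_closed[OF is_complex_diff_up[OF Y] lin_hom_closed[OF assms]]
  by auto

lemma contracts_zero: "contracts R X Y (\<lambda>i x. \<zero>\<^bsub>cmod Y (i + 1)\<^esub>) (\<lambda>i x. \<zero>\<^bsub>cmod Y i\<^esub>)"
  unfolding contracts_def
proof (intro conjI allI ballI)
  show "(\<lambda>x. \<zero>\<^bsub>cmod Y (i + 1)\<^esub>) \<in> lin_hom R (cmod X i) (cmod Y (i + 1))" for i
    by (rule lin_hom_zero_map[OF is_complexD(1)[OF Y]])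
  fix i x
  interpret Yi: module R "cmod Y i" by (rule is_complexD(1)[OF Y])
  show "\<zero>\<^bsub>cmod Y i\<^esub> = \<zero>\<^bsub>cmod Y (i - 1 + 1)\<^esub> \<oplus>\<^bsub>cmod Y i\<^esub> cdiff Y (i + 1) \<zero>\<^bsub>cmod Y (i + 1)\<^esub>"
    using lin_hom_zero[OF is_complexD(1)[OF Y] is_complexD(1)[OF Y] is_complex_diff_up[OF Y, of i]] by simp
qed

lemma contracts_neg:
  assumes "contracts R X Y h b"
  shows "contracts R X Y (\<lambda>i x. \<ominus>\<^bsub>cmod Y (i + 1)\<^esub> h i x) (\<lambda>i x. \<ominus>\<^bsub>cmod Y i\<^esub> b i x)"
  unfolding contracts_def
proof (intro conjI allI ballI)
  note h = contractsD(1)[OF assms]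
  show "(\<lambda>x. \<ominus>\<^bsub>cmod Y (i + 1)\<^esub> h i x) \<in> lin_hom R (cmod X i) (cmod Y (i + 1))" for i
    by (rule lin_hom_neg_map[OF is_complexD(1)[OF Y] h])
  fix i x assume x: "x \<in> carrier (cmod X i)"
  interpret Yi: module R "cmod Y i" by (rule is_complexD(1)[OF Y])
  show "\<ominus>\<^bsub>cmod Y i\<^esub> b i x = \<ominus>\<^bsub>cmod Y (i - 1 + 1)\<^esub> h (i - 1) (cdiff X i x) \<oplus>\<^bsub>cmod Y i\<^esub>
      cdiff Y (i + 1) (\<ominus>\<^bsub>cmod Y (i + 1)\<^esub> h i x)"
    using contracts_terms_closed[OF h x]
      lin_hom_neg[OF is_complexD(1)[OF Y] is_complexD(1)[OF Y] is_complex_diff_up[OF Y] lin_hom_closed[OF h x]]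
    by (simp add: contractsD(2)[OF assms x] Yi.minus_add)
qed

lemma contracts_sum:
  assumes "contracts R X Y h b" "contracts R X Y k c"
  shows "contracts R X Y (\<lambda>i x. h i x \<oplus>\<^bsub>cmod Y (i + 1)\<^esub> k i x) (\<lambda>i x. b i x \<oplus>\<^bsub>cmod Y i\<^esub> c i x)"
  unfolding contracts_def
proof (intro conjI allI ballI)
  note h = contractsD(1)[OF assms(1)] and k = contractsD(1)[OF assms(2)]
  show "(\<lambda>x. h i x \<oplus>\<^bsub>cmod Y (i + 1)\<^esub> k i x) \<in> lin_hom R (cmod X i) (cmod Y (i + 1))" for i
    by (rule lin_hom_sum_map[OF is_complexD(1)[OF Y] h k])
  fix i x assume x: "x \<in> carrier (cmod X i)"
  interpret Yi: module R "cmod Y i" by (rule is_complexD(1)[OF Y])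
  show "b i x \<oplus>\<^bsub>cmod Y i\<^esub> c i x =
      (h (i - 1) (cdiff X i x) \<oplus>\<^bsub>cmod Y (i - 1 + 1)\<^esub> k (i - 1) (cdiff X i x)) \<oplus>\<^bsub>cmod Y i\<^esub>
      cdiff Y (i + 1) (h i x \<oplus>\<^bsub>cmod Y (i + 1)\<^esub> k i x)"
    using contracts_terms_closed[OF h x] contracts_terms_closed[OF k x]
    by (simp add: contractsD(2)[OF assms(1) x] contractsD(2)[OF assms(2) x] Yi.sum4_swap
        lin_hom_add[OF is_complex_diff_up[OF Y] lin_hom_closed[OF h x] lin_hom_closed[OF k x]])
qed

lemma chain_maps_eq_homotopic:
  assumes \<alpha>: "\<alpha> \<in> chain_maps R X Y" and \<beta>: "\<beta> \<in> chain_maps R X Y"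
    and eq: "\<And>i x. x \<in> carrier (cmod X i) \<Longrightarrow> \<alpha> i x = \<beta> i x"
  shows "(\<alpha>, \<beta>) \<in> chain_homotopic R X Y"
  by (rule chain_homotopicI[OF \<alpha> \<beta> contracts_zero])
    (simp add: eq chain_maps_closed[OF \<beta>] abelian_group.diff_zero_iff[OF module_abelian_group[OF is_complexD(1)[OF Y]]])

lemma chain_homotopic_equiv: "equiv (chain_maps R X Y) (chain_homotopic R X Y)"
proof (rule equivI)
  show "chain_homotopic R X Y \<subseteq> chain_maps R X Y \<times> chain_maps R X Y"
    by (auto simp: chain_homotopic_def)
  show "refl_on (chain_maps R X Y) (chain_homotopic R X Y)"
    by (auto simp: refl_on_def chain_maps_eq_homotopic)
  show "sym (chain_homotopic R X Y)"
  proof (rule symI)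
    fix \<alpha> \<beta> assume "(\<alpha>, \<beta>) \<in> chain_homotopic R X Y"
    then obtain h where \<alpha>: "\<alpha> \<in> chain_maps R X Y" and \<beta>: "\<beta> \<in> chain_maps R X Y"
      and h: "contracts R X Y h (\<lambda>i x. \<alpha> i x \<ominus>\<^bsub>cmod Y i\<^esub> \<beta> i x)"
      by (rule chain_homotopicE)
    show "(\<beta>, \<alpha>) \<in> chain_homotopic R X Y"
    proof (rule chain_homotopicI[OF \<beta> \<alpha> contracts_neg[OF h]])
      fix i x assume "x \<in> carrier (cmod X i)"
      then show "\<beta> i x \<ominus>\<^bsub>cmod Y i\<^esub> \<alpha> i x = \<ominus>\<^bsub>cmod Y i\<^esub> (\<alpha> i x \<ominus>\<^bsub>cmod Y i\<^esub> \<beta> i x)"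
        by (intro abelian_group.diff_swap[OF module_abelian_group[OF is_complexD(1)[OF Y]]]
            chain_maps_closed[OF \<alpha>] chain_maps_closed[OF \<beta>])
    qed
  qed
  show "trans (chain_homotopic R X Y)"
  proof (rule transI)
    fix \<alpha> \<beta> \<gamma> assume "(\<alpha>, \<beta>) \<in> chain_homotopic R X Y" and \<beta>\<gamma>: "(\<beta>, \<gamma>) \<in> chain_homotopic R X Y"
    then obtain h where \<alpha>: "\<alpha> \<in> chain_maps R X Y" and \<beta>: "\<beta> \<in> chain_maps R X Y"
      and h: "contracts R X Y h (\<lambda>i x. \<alpha> i x \<ominus>\<^bsub>cmod Y i\<^esub> \<beta> i x)"
      by (elim chain_homotopicE)
    from \<beta>\<gamma> obtain k where \<gamma>: "\<gamma> \<in> chain_maps R X Y"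
      and k: "contracts R X Y k (\<lambda>i x. \<beta> i x \<ominus>\<^bsub>cmod Y i\<^esub> \<gamma> i x)"
      by (elim chain_homotopicE)
    show "(\<alpha>, \<gamma>) \<in> chain_homotopic R X Y"
    proof (rule chain_homotopicI[OF \<alpha> \<gamma> contracts_sum[OF h k]])
      fix i x assume "x \<in> carrier (cmod X i)"
      then show "\<alpha> i x \<ominus>\<^bsub>cmod Y i\<^esub> \<gamma> i x =
          (\<alpha> i x \<ominus>\<^bsub>cmod Y i\<^esub> \<beta> i x) \<oplus>\<^bsub>cmod Y i\<^esub> (\<beta> i x \<ominus>\<^bsub>cmod Y i\<^esub> \<gamma> i x)"
        by (intro abelian_group.diff_trans[OF module_abelian_group[OF is_complexD(1)[OF Y]]]
            chain_maps_closed[OF \<alpha>] chain_maps_closed[OF \<beta>] chain_maps_closed[OF \<gamma>])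
    qed
  qed
qed

lemma chain_homotopic_sum:
  assumes "(\<alpha>, \<alpha>') \<in> chain_homotopic R X Y" "(\<beta>, \<beta>') \<in> chain_homotopic R X Y"
  shows "(\<lambda>i x. \<alpha> i x \<oplus>\<^bsub>cmod Y i\<^esub> \<beta> i x, \<lambda>i x. \<alpha>' i x \<oplus>\<^bsub>cmod Y i\<^esub> \<beta>' i x) \<in> chain_homotopic R X Y"
proof -
  from assms(1) obtain h where \<alpha>: "\<alpha> \<in> chain_maps R X Y" and \<alpha>': "\<alpha>' \<in> chain_maps R X Y"
    and h: "contracts R X Y h (\<lambda>i x. \<alpha> i x \<ominus>\<^bsub>cmod Y i\<^esub> \<alpha>' i x)"
    by (elim chain_homotopicE)
  from assms(2) obtain k where \<beta>: "\<beta> \<in> chain_maps R X Y" and \<beta>': "\<beta>' \<in> chain_maps R X Y"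
    and k: "contracts R X Y k (\<lambda>i x. \<beta> i x \<ominus>\<^bsub>cmod Y i\<^esub> \<beta>' i x)"
    by (elim chain_homotopicE)
  show ?thesis
  proof (rule chain_homotopicI[OF chain_maps_sum[OF Y \<alpha> \<beta>] chain_maps_sum[OF Y \<alpha>' \<beta>'] contracts_sum[OF h k]])
    fix i x assume "x \<in> carrier (cmod X i)"
    then show "(\<alpha> i x \<oplus>\<^bsub>cmod Y i\<^esub> \<beta> i x) \<ominus>\<^bsub>cmod Y i\<^esub> (\<alpha>' i x \<oplus>\<^bsub>cmod Y i\<^esub> \<beta>' i x) =
        (\<alpha> i x \<ominus>\<^bsub>cmod Y i\<^esub> \<alpha>' i x) \<oplus>\<^bsub>cmod Y i\<^esub> (\<beta> i x \<ominus>\<^bsub>cmod Y i\<^esub> \<beta>' i x)"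
      by (intro abelian_group.diff_sum[OF module_abelian_group[OF is_complexD(1)[OF Y]]]
          chain_maps_closed[OF \<alpha>] chain_maps_closed[OF \<beta>] chain_maps_closed[OF \<alpha>'] chain_maps_closed[OF \<beta>'])
  qed
qed

lemma contracts_shift:
  assumes "contracts R X Y h b"
  shows "contracts R (complex_shift X) (complex_shift Y) (\<lambda>i x. \<ominus>\<^bsub>cmod Y i\<^esub> h (i - 1) x) (\<lambda>i. b (i - 1))"
  unfolding contracts_def
proof (intro conjI allI ballI)
  note h = contractsD(1)[OF assms]
  show "(\<lambda>x. \<ominus>\<^bsub>cmod Y i\<^esub> h (i - 1) x) \<in> lin_hom R (cmod (complex_shift X) i) (cmod (complex_shift Y) (i + 1))" for i
    using lin_hom_neg_map[OF is_complexD(1)[OF Y] h[of "i - 1"]] by (simp add: complex_shift_def)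
  fix i x assume "x \<in> carrier (cmod (complex_shift X) i)"
  then have x: "x \<in> carrier (cmod X (i - 1))" by (simp add: complex_shift_def)
  interpret Yi: module R "cmod Y (i - 1)" by (rule is_complexD(1)[OF Y])
  have dx: "cdiff X (i - 1) x \<in> carrier (cmod X (i - 2))"
    using lin_hom_closed[OF is_complexD(2)[OF X] x] by simp
  have hx: "h (i - 1) x \<in> carrier (cmod Y i)" using lin_hom_closed[OF h x] by simp
  \<comment> \<open>the sign of the homotopy and the sign of the shifted differential cancel in both terms\<close>
  have "\<ominus>\<^bsub>cmod Y (i - 1)\<^esub> h (i - 2) (\<ominus>\<^bsub>cmod X (i - 2)\<^esub> cdiff X (i - 1) x) = h (i - 2) (cdiff X (i - 1) x)"
    using lin_hom_neg[OF is_complexD(1)[OF X] is_complexD(1)[OF Y] h[of "i - 2"] dx]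
      lin_hom_closed[OF h[of "i - 2"] dx] by simp
  moreover have "\<ominus>\<^bsub>cmod Y (i - 1)\<^esub> cdiff Y i (\<ominus>\<^bsub>cmod Y i\<^esub> h (i - 1) x) = cdiff Y i (h (i - 1) x)"
    using lin_hom_neg[OF is_complexD(1)[OF Y] is_complexD(1)[OF Y] is_complexD(2)[OF Y] hx]
      lin_hom_closed[OF is_complexD(2)[OF Y] hx] by simp
  ultimately show "b (i - 1) x = \<ominus>\<^bsub>cmod Y (i - 1)\<^esub> h (i - 1 - 1) (cdiff (complex_shift X) i x)
      \<oplus>\<^bsub>cmod (complex_shift Y) i\<^esub> cdiff (complex_shift Y) (i + 1) (\<ominus>\<^bsub>cmod Y i\<^esub> h (i - 1) x)"
    using contractsD(2)[OF assms x] by (simp add: complex_shift_def)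
qed

lemma chain_homotopic_shift:
  assumes "(\<alpha>, \<beta>) \<in> chain_homotopic R X Y"
  shows "(\<lambda>i. \<alpha> (i - 1), \<lambda>i. \<beta> (i - 1)) \<in> chain_homotopic R (complex_shift X) (complex_shift Y)"
proof -
  from assms obtain h where \<alpha>: "\<alpha> \<in> chain_maps R X Y" and \<beta>: "\<beta> \<in> chain_maps R X Y"
    and h: "contracts R X Y h (\<lambda>i x. \<alpha> i x \<ominus>\<^bsub>cmod Y i\<^esub> \<beta> i x)"
    by (elim chain_homotopicE)
  show ?thesis
    by (rule chain_homotopicI[OF chain_maps_shift[OF X Y \<alpha>] chain_maps_shift[OF X Y \<beta>] contracts_shift[OF h]])
      (simp add: complex_shift_def)
qed

end

lemma chain_homotopic_comp:
  assumes X: "is_complex R X" and Y: "is_complex R Y" and Z: "is_complex R Z"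
    and "(\<alpha>, \<alpha>') \<in> chain_homotopic R X Y" "(\<beta>, \<beta>') \<in> chain_homotopic R Y Z"
  shows "(\<lambda>i. \<beta> i \<circ> \<alpha> i, \<lambda>i. \<beta>' i \<circ> \<alpha>' i) \<in> chain_homotopic R X Z"
proof -
  from assms(4) obtain h where \<alpha>: "\<alpha> \<in> chain_maps R X Y" and \<alpha>': "\<alpha>' \<in> chain_maps R X Y"
    and h: "contracts R X Y h (\<lambda>i x. \<alpha> i x \<ominus>\<^bsub>cmod Y i\<^esub> \<alpha>' i x)"
    by (elim chain_homotopicE)
  from assms(5) obtain k where \<beta>: "\<beta> \<in> chain_maps R Y Z" and \<beta>': "\<beta>' \<in> chain_maps R Y Z"
    and k: "contracts R Y Z k (\<lambda>i x. \<beta> i x \<ominus>\<^bsub>cmod Z i\<^esub> \<beta>' i x)"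
    by (elim chain_homotopicE)
  have "contracts R X Z (\<lambda>i x. k i (\<alpha> i x)) (\<lambda>i x. \<beta> i (\<alpha> i x) \<ominus>\<^bsub>cmod Z i\<^esub> \<beta>' i (\<alpha> i x))"
    using lin_hom_comp[OF chain_mapsD(1)[OF \<alpha>] contractsD(1)[OF k]] contractsD(2)[OF k chain_maps_closed[OF \<alpha>]]
    by (simp add: contracts_def chain_mapsD(2)[OF \<alpha>])
  then have 1: "(\<lambda>i. \<beta> i \<circ> \<alpha> i, \<lambda>i. \<beta>' i \<circ> \<alpha> i) \<in> chain_homotopic R X Z"
    by (rule chain_homotopicI[OF chain_maps_comp[OF \<alpha> \<beta>] chain_maps_comp[OF \<alpha> \<beta>']]) simp
  have "contracts R X Z (\<lambda>i x. \<beta>' (i + 1) (h i x)) (\<lambda>i x. \<beta>' i (\<alpha> i x \<ominus>\<^bsub>cmod Y i\<^esub> \<alpha>' i x))"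
    using lin_hom_comp[OF contractsD(1)[OF h] chain_mapsD(1)[OF \<beta>']]
      contracts_terms_closed[OF X Y contractsD(1)[OF h]] chain_mapsD(2)[OF \<beta>' lin_hom_closed[OF contractsD(1)[OF h]]]
    by (simp add: contracts_def contractsD(2)[OF h] lin_hom_add[OF chain_mapsD(1)[OF \<beta>']])
  then have 2: "(\<lambda>i. \<beta>' i \<circ> \<alpha> i, \<lambda>i. \<beta>' i \<circ> \<alpha>' i) \<in> chain_homotopic R X Z"
    by (rule chain_homotopicI[OF chain_maps_comp[OF \<alpha> \<beta>'] chain_maps_comp[OF \<alpha>' \<beta>']])
      (simp add: lin_hom_minus[OF is_complexD(1)[OF Y] is_complexD(1)[OF Z] chain_mapsD(1)[OF \<beta>']]
        chain_maps_closed[OF \<alpha>] chain_maps_closed[OF \<alpha>'])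
  from chain_homotopic_equiv[OF X Z] 1 2 show ?thesis by (blast elim: equivE dest: transD)
qed

section \<open>Acyclicity of Hom complexes\<close>

lemma hom_to_acyclicD:
  assumes V: "module R V" and ac: "acyclic_complex (hom_to R V Y)"
    and \<phi>: "\<phi> \<in> lin_hom R V (cmod Y i)"
    and zero: "\<And>v. v \<in> carrier V \<Longrightarrow> cdiff Y i (\<phi> v) = \<zero>\<^bsub>cmod Y (i - 1)\<^esub>"
  obtains \<psi> where "\<psi> \<in> lin_hom R V (cmod Y (i + 1))"
    "\<And>v. v \<in> carrier V \<Longrightarrow> \<phi> v = cdiff Y (i + 1) (\<psi> v)"
proof -
  have "restrict \<phi> (carrier V) \<in> cycles (hom_to R V Y) i"
    using lin_hom_restrict[OF V \<phi>] zero by (auto simp: cycles_def hom_to_def hom_module_def)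
  then have "restrict \<phi> (carrier V) \<in> boundaries (hom_to R V Y) i"
    using ac by (simp add: acyclic_complex_def)
  then obtain \<psi> where \<psi>: "\<psi> \<in> lin_hom R V (cmod Y (i + 1))"
    and eq: "restrict \<phi> (carrier V) = (\<lambda>v \<in> carrier V. cdiff Y (i + 1) (\<psi> v))"
    by (auto simp: boundaries_def hom_to_def hom_module_def)
  have "\<phi> v = cdiff Y (i + 1) (\<psi> v)" if "v \<in> carrier V" for v
    using fun_cong[OF eq, of v] that by simp
  with \<psi> show ?thesis by (rule that)
qed

lemma hom_to_acyclicI:
  assumes Y: "is_complex R Y" and V: "module R V"
    and ex: "\<And>i \<phi>. \<phi> \<in> lin_hom R V (cmod Y i) \<Longrightarrow>
      (\<And>v. v \<in> carrier V \<Longrightarrow> cdiff Y i (\<phi> v) = \<zero>\<^bsub>cmod Y (i - 1)\<^esub>) \<Longrightarrow>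
      \<exists>\<psi> \<in> lin_hom R V (cmod Y (i + 1)). \<forall>v \<in> carrier V. \<phi> v = cdiff Y (i + 1) (\<psi> v)"
  shows "acyclic_complex (hom_to R V Y)"
  unfolding acyclic_complex_def
proof (intro allI equalityI subsetI)
  fix i \<phi> assume "\<phi> \<in> cycles (hom_to R V Y) i"
  then have \<phi>: "\<phi> \<in> lin_hom R V (cmod Y i)" "\<phi> \<in> extensional (carrier V)"
    and eq: "(\<lambda>v \<in> carrier V. cdiff Y i (\<phi> v)) = (\<lambda>v \<in> carrier V. \<zero>\<^bsub>cmod Y (i - 1)\<^esub>)"
    by (auto simp: cycles_def hom_to_def hom_module_def)
  have "cdiff Y i (\<phi> v) = \<zero>\<^bsub>cmod Y (i - 1)\<^esub>" if "v \<in> carrier V" for v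
    using fun_cong[OF eq, of v] that by simp
  from ex[OF \<phi>(1) this] obtain \<psi> where \<psi>: "\<psi> \<in> lin_hom R V (cmod Y (i + 1))"
    "\<And>v. v \<in> carrier V \<Longrightarrow> \<phi> v = cdiff Y (i + 1) (\<psi> v)" by blast
  define \<psi>' where "\<psi>' = restrict \<psi> (carrier V)"
  have "\<phi> = (\<lambda>v \<in> carrier V. cdiff Y (i + 1) (\<psi>' v))"
    using \<phi>(2) \<psi>(2) by (auto simp: fun_eq_iff extensional_def \<psi>'_def)
  moreover have "\<psi>' \<in> lin_hom R V (cmod Y (i + 1)) \<inter> extensional (carrier V)"
    unfolding \<psi>'_def by (rule lin_hom_restrict[OF V \<psi>(1)])
  ultimately show "\<phi> \<in> boundaries (hom_to R V Y) i"
    by (auto simp: boundaries_def hom_to_def hom_module_def)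
next
  fix i \<phi> assume "\<phi> \<in> boundaries (hom_to R V Y) i"
  then obtain \<psi> where \<psi>: "\<psi> \<in> lin_hom R V (cmod Y (i + 1))"
    and \<phi>: "\<phi> = (\<lambda>v \<in> carrier V. cdiff Y (i + 1) (\<psi> v))"
    by (auto simp: boundaries_def hom_to_def hom_module_def)
  have "cdiff Y i (cdiff Y (i + 1) (\<psi> v)) = \<zero>\<^bsub>cmod Y (i - 1)\<^esub>" if "v \<in> carrier V" for v
    using is_complexD(3)[OF Y lin_hom_closed[OF \<psi> that]] by simp
  then show "\<phi> \<in> cycles (hom_to R V Y) i"
    using lin_hom_restrict[OF V lin_hom_comp[OF \<psi> is_complex_diff_up[OF Y]]] \<phi>
    by (auto simp: cycles_def hom_to_def hom_module_def)
qed

lemma hom_from_acyclicD: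
  assumes X: "is_complex R X" and ac: "acyclic_complex (hom_from R X V)"
    and \<phi>: "\<phi> \<in> lin_hom R (cmod X i) V"
    and zero: "\<And>x. x \<in> carrier (cmod X (i + 1)) \<Longrightarrow> \<phi> (cdiff X (i + 1) x) = \<zero>\<^bsub>V\<^esub>"
  obtains \<psi> where "\<psi> \<in> lin_hom R (cmod X (i - 1)) V"
    "\<And>x. x \<in> carrier (cmod X i) \<Longrightarrow> \<phi> x = \<psi> (cdiff X i x)"
proof -
  let ?\<phi> = "restrict \<phi> (carrier (cmod X i))"
  have "\<phi> (cdiff X (1 + i) x) = \<zero>\<^bsub>V\<^esub>" "cdiff X (1 + i) x \<in> carrier (cmod X i)"
    if "x \<in> carrier (cmod X (1 + i))" for x
    using zero[of x] lin_hom_closed[OF is_complex_diff_up[OF X, of i], of x] that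
    by (simp_all add: add.commute)
  then have "?\<phi> \<in> cycles (hom_from R X V) (- i)"
    using lin_hom_restrict[OF is_complexD(1)[OF X] \<phi>]
    by (auto simp: cycles_def hom_from_def hom_module_def)
  then have "?\<phi> \<in> boundaries (hom_from R X V) (- i)"
    using ac by (simp add: acyclic_complex_def)
  then obtain \<psi> where \<psi>: "\<psi> \<in> lin_hom R (cmod X (i - 1)) V"
    and eq: "?\<phi> = (\<lambda>x \<in> carrier (cmod X i). \<psi> (cdiff X i x))"
    by (auto simp: boundaries_def hom_from_def hom_module_def)
  have "\<phi> x = \<psi> (cdiff X i x)" if "x \<in> carrier (cmod X i)" for x
    using fun_cong[OF eq, of x] that by simp
  with \<psi> show ?thesis by (rule that)
qed

lemma hom_from_acyclicI:
  assumes X: "is_complex R X" and V: "module R V"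
    and ex: "\<And>i \<phi>. \<phi> \<in> lin_hom R (cmod X i) V \<Longrightarrow>
      (\<And>x. x \<in> carrier (cmod X (i + 1)) \<Longrightarrow> \<phi> (cdiff X (i + 1) x) = \<zero>\<^bsub>V\<^esub>) \<Longrightarrow>
      \<exists>\<psi> \<in> lin_hom R (cmod X (i - 1)) V. \<forall>x \<in> carrier (cmod X i). \<phi> x = \<psi> (cdiff X i x)"
  shows "acyclic_complex (hom_from R X V)"
  unfolding acyclic_complex_def
proof (intro allI equalityI subsetI)
  fix i \<phi> assume "\<phi> \<in> cycles (hom_from R X V) i"
  then have \<phi>: "\<phi> \<in> lin_hom R (cmod X (- i)) V" "\<phi> \<in> extensional (carrier (cmod X (- i)))"
    and eq: "(\<lambda>x \<in> carrier (cmod X (1 - i)). \<phi> (cdiff X (1 - i) x)) =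
      (\<lambda>x \<in> carrier (cmod X (1 - i)). \<zero>\<^bsub>V\<^esub>)"
    by (auto simp: cycles_def hom_from_def hom_module_def)
  have "\<phi> (cdiff X (- i + 1) x) = \<zero>\<^bsub>V\<^esub>" if "x \<in> carrier (cmod X (- i + 1))" for x
    using fun_cong[OF eq, of x] that by simp
  from ex[OF \<phi>(1) this] obtain \<psi> where \<psi>: "\<psi> \<in> lin_hom R (cmod X (- i - 1)) V"
    "\<And>x. x \<in> carrier (cmod X (- i)) \<Longrightarrow> \<phi> x = \<psi> (cdiff X (- i) x)" by blast
  define \<psi>' where "\<psi>' = restrict \<psi> (carrier (cmod X (- i - 1)))"
  have "\<phi> = (\<lambda>x \<in> carrier (cmod X (- i)). \<psi>' (cdiff X (- i) x))"
    using \<phi>(2) \<psi>(2) lin_hom_closed[OF is_complexD(2)[OF X, of "- i"]]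
    by (auto simp: fun_eq_iff extensional_def \<psi>'_def)
  moreover have "\<psi>' \<in> lin_hom R (cmod X (- i - 1)) V \<inter> extensional (carrier (cmod X (- i - 1)))"
    unfolding \<psi>'_def by (rule lin_hom_restrict[OF is_complexD(1)[OF X] \<psi>(1)])
  ultimately show "\<phi> \<in> boundaries (hom_from R X V) i"
    by (auto simp: boundaries_def hom_from_def hom_module_def)
next
  fix i \<phi> assume "\<phi> \<in> boundaries (hom_from R X V) i"
  then obtain \<psi> where \<psi>: "\<psi> \<in> lin_hom R (cmod X (- i - 1)) V"
    and \<phi>: "\<phi> = (\<lambda>x \<in> carrier (cmod X (- i)). \<psi> (cdiff X (- i) x))"
    by (auto simp: boundaries_def hom_from_def hom_module_def)
  have "\<psi> (cdiff X (- i) (cdiff X (1 - i) x)) = \<zero>\<^bsub>V\<^esub>" if "x \<in> carrier (cmod X (1 - i))" for x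
  proof -
    have "1 - i - 1 = - i" "1 - i - 2 = - i - 1" by simp_all
    with is_complexD(3)[OF X that] have "cdiff X (- i) (cdiff X (1 - i) x) = \<zero>\<^bsub>cmod X (- i - 1)\<^esub>"
      by metis
    then show ?thesis using lin_hom_zero[OF is_complexD(1)[OF X] V \<psi>] by simp
  qed
  moreover have "cdiff X (1 - i) x \<in> carrier (cmod X (- i))" if "x \<in> carrier (cmod X (1 - i))" for x
    using lin_hom_closed[OF is_complexD(2)[OF X] that] by simp
  ultimately show "\<phi> \<in> cycles (hom_from R X V) i"
    using lin_hom_restrict[OF is_complexD(1)[OF X] lin_hom_comp[OF is_complexD(2)[OF X] \<psi>]] \<phi>
    by (auto simp: cycles_def hom_from_def hom_module_def)
qed

section \<open>Extending a homotopy from one degree\<close>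

text \<open>
  Dependent choice in both directions from \<open>0\<close>, where consecutive terms of the sequence are related.
\<close>

lemma two_sided_choice:
  fixes P :: "int \<Rightarrow> 'h \<Rightarrow> 'h \<Rightarrow> bool"
  assumes start: "P 0 a b"
    and up: "\<And>i a b. P i a b \<Longrightarrow> \<exists>c. P (i + 1) b c"
    and down: "\<And>i a b. P i a b \<Longrightarrow> \<exists>c. P (i - 1) c a"
  shows "\<exists>h. \<forall>i. P i (h (i - 1)) (h i)"
proof -
  have "\<exists>F. \<forall>n. (P (int n) (fst (F n)) (snd (F n)) \<and> (n = 0 \<longrightarrow> F n = (a, b))) \<and>
      fst (F (Suc n)) = snd (F n)"
  proof (rule dependent_nat_choice)
    show "\<exists>p. P (int 0) (fst p) (snd p) \<and> (0 = (0 :: nat) \<longrightarrow> p = (a, b))" using start by simp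
    fix p n assume "P (int n) (fst p) (snd p) \<and> (n = 0 \<longrightarrow> p = (a, b))"
    then obtain c where "P (int n + 1) (snd p) c" using up by blast
    then show "\<exists>q. (P (int (Suc n)) (fst q) (snd q) \<and> (Suc n = 0 \<longrightarrow> q = (a, b))) \<and> fst q = snd p"
      by (intro exI[of _ "(snd p, c)"]) (simp add: add.commute)
  qed
  then obtain F where F: "\<And>n. P (int n) (fst (F n)) (snd (F n))" "F 0 = (a, b)"
    "\<And>n. fst (F (Suc n)) = snd (F n)" by blast
  have "\<exists>G. \<forall>n. (P (- int n) (fst (G n)) (snd (G n)) \<and> (n = 0 \<longrightarrow> G n = (a, b))) \<and>
      snd (G (Suc n)) = fst (G n)"
  proof (rule dependent_nat_choice)
    show "\<exists>p. P (- int 0) (fst p) (snd p) \<and> (0 = (0 :: nat) \<longrightarrow> p = (a, b))" using start by simp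
    fix p n assume "P (- int n) (fst p) (snd p) \<and> (n = 0 \<longrightarrow> p = (a, b))"
    then obtain c where "P (- int n - 1) c (fst p)" using down by blast
    moreover have "- int (Suc n) = - int n - 1" by simp
    ultimately have "P (- int (Suc n)) c (fst p)" by (simp only:)
    then show "\<exists>q. (P (- int (Suc n)) (fst q) (snd q) \<and> (Suc n = 0 \<longrightarrow> q = (a, b))) \<and> snd q = fst p"
      by (intro exI[of _ "(c, fst p)"]) (simp del: of_nat_Suc)
  qed
  then obtain G where G: "\<And>n. P (- int n) (fst (G n)) (snd (G n))" "G 0 = (a, b)"
    "\<And>n. snd (G (Suc n)) = fst (G n)" by blast
  define h where "h i = (if i \<ge> 0 then snd (F (nat i)) else fst (G (nat (- i - 1))))" for i
  have nat: "nat (1 + int n) = Suc n" for n by simp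
  have "P i (h (i - 1)) (h i)" for i
  proof (cases i rule: int_cases)
    case (nonneg n)
    then show ?thesis using F(1)[of n] F(2,3) G(2) by (cases n) (simp_all add: h_def nat)
  next
    case (neg n)
    then show ?thesis using G(1)[of "Suc n"] G(3)[of n] by (simp add: h_def nat)
  qed
  then show ?thesis by blast
qed

text \<open>
  Let \<open>\<beta>\<close> be the difference of the chain maps and suppose \<open>\<beta>\<^sub>i = hd + dh'\<close>.  Then
  \<open>d\<beta>\<^sub>i\<^sub>+\<^sub>1 = \<beta>\<^sub>id = dh'd\<close>, so \<open>\<beta>\<^sub>i\<^sub>+\<^sub>1 - h'd\<close> maps \<open>X\<^sub>i\<^sub>+\<^sub>1\<close> to cycles of \<open>Y\<close> and lifts along \<open>d\<close> by acyclicity of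
  \<open>Hom(X\<^sub>i\<^sub>+\<^sub>1, Y)\<close>.  Dually, \<open>\<beta>\<^sub>i\<^sub>-\<^sub>1d = d\<beta>\<^sub>i = dhd\<close>, so \<open>\<beta>\<^sub>i\<^sub>-\<^sub>1 - dh\<close> vanishes on boundaries of \<open>X\<close> and factors
  through \<open>d\<close> by acyclicity of \<open>Hom(X, Y\<^sub>i\<^sub>-\<^sub>1)\<close>.
\<close>

lemma homotopy_extends:
  assumes X: "is_complex R X" and Y: "is_complex R Y"
    and from_ac: "\<And>i. acyclic_complex (hom_from R X (cmod Y i))"
    and to_ac: "\<And>i. acyclic_complex (hom_to R (cmod X i) Y)"
    and \<alpha>: "\<alpha> \<in> chain_maps R X Y" and \<gamma>: "\<gamma> \<in> chain_maps R X Y"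
    and h0: "h0 \<in> lin_hom R (cmod X 0) (cmod Y 1)" and hm: "hm \<in> lin_hom R (cmod X (- 1)) (cmod Y 0)"
    and deg0: "\<And>x. x \<in> carrier (cmod X 0) \<Longrightarrow>
      \<alpha> 0 x \<ominus>\<^bsub>cmod Y 0\<^esub> \<gamma> 0 x = hm (cdiff X 0 x) \<oplus>\<^bsub>cmod Y 0\<^esub> cdiff Y 1 (h0 x)"
  shows "(\<alpha>, \<gamma>) \<in> chain_homotopic R X Y"
proof -
  note XM = is_complexD(1)[OF X] and YM = is_complexD(1)[OF Y]
  note dX = is_complexD(2)[OF X] and dY = is_complexD(2)[OF Y]
  define \<beta> where "\<beta> i x = \<alpha> i x \<ominus>\<^bsub>cmod Y i\<^esub> \<gamma> i x" for i x
  have \<beta>: "\<beta> i \<in> lin_hom R (cmod X i) (cmod Y i)" for i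
    unfolding \<beta>_def[abs_def] by (intro lin_hom_diff_map YM chain_mapsD(1)[OF \<alpha>] chain_mapsD(1)[OF \<gamma>])
  have d\<beta>: "cdiff Y i (\<beta> i x) = \<beta> (i - 1) (cdiff X i x)" if "x \<in> carrier (cmod X i)" for i x
    using lin_hom_minus[OF YM YM dY] chain_maps_closed[OF \<alpha> that] chain_maps_closed[OF \<gamma> that]
    by (simp add: \<beta>_def chain_mapsD(2)[OF \<alpha> that] chain_mapsD(2)[OF \<gamma> that])
  define P where "P i h h' \<longleftrightarrow>
      h \<in> lin_hom R (cmod X (i - 1)) (cmod Y i) \<and> h' \<in> lin_hom R (cmod X i) (cmod Y (i + 1)) \<and>
      (\<forall>x \<in> carrier (cmod X i). \<beta> i x = h (cdiff X i x) \<oplus>\<^bsub>cmod Y i\<^esub> cdiff Y (i + 1) (h' x))" for i h h'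
  have "\<exists>H. \<forall>i. P i (H (i - 1)) (H i)"
  proof (rule two_sided_choice)
    show "P 0 hm h0" using hm h0 deg0 by (simp add: P_def \<beta>_def)
  next
    fix i h h' assume "P i h h'"
    then have h: "h \<in> lin_hom R (cmod X (i - 1)) (cmod Y i)"
      and h': "h' \<in> lin_hom R (cmod X i) (cmod Y (i + 1))"
      and eq: "\<And>x. x \<in> carrier (cmod X i) \<Longrightarrow> \<beta> i x = h (cdiff X i x) \<oplus>\<^bsub>cmod Y i\<^esub> cdiff Y (i + 1) (h' x)"
      by (auto simp: P_def)
    interpret Yi: module R "cmod Y i" by (rule YM)
    interpret Yp: module R "cmod Y (i + 1)" by (rule YM)
    let ?\<phi> = "\<lambda>x. \<beta> (i + 1) x \<ominus>\<^bsub>cmod Y (i + 1)\<^esub> h' (cdiff X (i + 1) x)"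
    have dX': "cdiff X (i + 1) \<in> lin_hom R (cmod X (i + 1)) (cmod X i)" by (rule is_complex_diff_up[OF X])
    note h'd = lin_hom_comp[OF dX' h']
    have "cdiff Y (i + 1) (?\<phi> x) = \<zero>\<^bsub>cmod Y (i + 1 - 1)\<^esub>" if x: "x \<in> carrier (cmod X (i + 1))" for x
    proof -
      have dx: "cdiff X (i + 1) x \<in> carrier (cmod X i)" by (rule lin_hom_closed[OF dX' x])
      have c: "cdiff Y (i + 1) (h' (cdiff X (i + 1) x)) \<in> carrier (cmod Y i)"
        by (rule lin_hom_closed[OF is_complex_diff_up[OF Y] lin_hom_closed[OF h'd x]])
      have "cdiff X i (cdiff X (i + 1) x) = \<zero>\<^bsub>cmod X (i - 1)\<^esub>" using is_complexD(3)[OF X x] by simp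
      then have "cdiff Y (i + 1) (\<beta> (i + 1) x) = cdiff Y (i + 1) (h' (cdiff X (i + 1) x))"
        using d\<beta>[OF x] eq[OF dx] lin_hom_zero[OF XM YM h] c by simp
      then show ?thesis
        using lin_hom_minus[OF YM YM is_complex_diff_up[OF Y] lin_hom_closed[OF \<beta> x] lin_hom_closed[OF h'd x]] c
        by (simp add: Yi.diff_zero_iff)
    qed
    then obtain w where w: "w \<in> lin_hom R (cmod X (i + 1)) (cmod Y (i + 1 + 1))"
      and \<phi>w: "\<And>x. x \<in> carrier (cmod X (i + 1)) \<Longrightarrow> ?\<phi> x = cdiff Y (i + 1 + 1) (w x)"
      by (rule hom_to_acyclicD[OF XM to_ac lin_hom_diff_map[OF YM \<beta> h'd]]) auto
    have "\<beta> (i + 1) x = h' (cdiff X (i + 1) x) \<oplus>\<^bsub>cmod Y (i + 1)\<^esub> cdiff Y (i + 1 + 1) (w x)"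
      if x: "x \<in> carrier (cmod X (i + 1))" for x
      using \<phi>w[OF x] lin_hom_closed[OF \<beta> x] lin_hom_closed[OF h'd x]
        lin_hom_closed[OF is_complex_diff_up[OF Y] lin_hom_closed[OF w x]]
      by (simp add: Yp.diff_eq_iff)
    then show "\<exists>w. P (i + 1) h' w" using h' w by (auto simp: P_def)
  next
    fix i h h' assume "P i h h'"
    then have h: "h \<in> lin_hom R (cmod X (i - 1)) (cmod Y (i - 1 + 1))"
      and h': "h' \<in> lin_hom R (cmod X i) (cmod Y (i + 1))"
      and eq: "\<And>x. x \<in> carrier (cmod X i) \<Longrightarrow> \<beta> i x = h (cdiff X i x) \<oplus>\<^bsub>cmod Y i\<^esub> cdiff Y (i + 1) (h' x)"
      by (auto simp: P_def)
    interpret Yi: module R "cmod Y (i - 1)" by (rule YM)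
    let ?\<phi> = "\<lambda>x. \<beta> (i - 1) x \<ominus>\<^bsub>cmod Y (i - 1)\<^esub> cdiff Y (i - 1 + 1) (h x)"
    note dh = lin_hom_comp[OF h is_complex_diff_up[OF Y]]
    have "?\<phi> (cdiff X (i - 1 + 1) x) = \<zero>\<^bsub>cmod Y (i - 1)\<^esub>" if "x \<in> carrier (cmod X (i - 1 + 1))" for x
    proof -
      from that have x: "x \<in> carrier (cmod X i)" by simp
      note dx = lin_hom_closed[OF dX x]
      have h'x: "h' x \<in> carrier (cmod Y (i + 1))" by (rule lin_hom_closed[OF h' x])
      have c: "cdiff Y i (h (cdiff X i x)) \<in> carrier (cmod Y (i - 1))"
        using lin_hom_closed[OF dh dx] by simp
      have "cdiff Y i (cdiff Y (i + 1) (h' x)) = \<zero>\<^bsub>cmod Y (i - 1)\<^esub>"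
        using is_complexD(3)[OF Y h'x] by simp
      then have "\<beta> (i - 1) (cdiff X i x) = cdiff Y i (h (cdiff X i x))"
        using d\<beta>[OF x] eq[OF x] c lin_hom_closed[OF h dx] lin_hom_closed[OF is_complex_diff_up[OF Y] h'x]
        by (simp add: lin_hom_add[OF dY])
      then show ?thesis using c by (simp add: Yi.diff_zero_iff)
    qed
    then obtain w where w: "w \<in> lin_hom R (cmod X (i - 1 - 1)) (cmod Y (i - 1))"
      and \<phi>w: "\<And>x. x \<in> carrier (cmod X (i - 1)) \<Longrightarrow> ?\<phi> x = w (cdiff X (i - 1) x)"
      by (rule hom_from_acyclicD[OF X from_ac lin_hom_diff_map[OF YM \<beta> dh]]) auto
    have "\<beta> (i - 1) x = w (cdiff X (i - 1) x) \<oplus>\<^bsub>cmod Y (i - 1)\<^esub> cdiff Y (i - 1 + 1) (h x)"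
      if x: "x \<in> carrier (cmod X (i - 1))" for x
      using \<phi>w[OF x] lin_hom_closed[OF \<beta> x] lin_hom_closed[OF dh x] lin_hom_closed[OF w lin_hom_closed[OF dX x]]
      by (simp add: Yi.diff_eq_iff Yi.M.a_comm)
    then show "\<exists>w. P (i - 1) w h" using h w by (auto simp: P_def)
  qed
  then obtain H where H: "\<forall>i. P i (H (i - 1)) (H i)" ..
  then have "contracts R X Y H \<beta>" by (auto simp: contracts_def P_def)
  then show ?thesis by (rule chain_homotopicI[OF \<alpha> \<gamma>]) (simp add: \<beta>_def)
qed

section \<open>Factorizations and their 2-periodic complexes\<close>

text \<open>
  Indexing the two components by all integers, according to parity, matches factorizations with their
  2-periodic complexes and makes one argument serve both components.
\<close>

definition fac_mod :: "('a, 'b) factorization \<Rightarrow> int \<Rightarrow> ('a, 'b) module"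
  where "fac_mod M i = (if even i then fac0 M else fac1 M)"

definition fac_diff :: "('a, 'b) factorization \<Rightarrow> int \<Rightarrow> 'b \<Rightarrow> 'b"
  where "fac_diff M i = (if even i then dif0 M else dif1 M)"

definition mor_at :: "('b \<Rightarrow> 'b) \<times> ('b \<Rightarrow> 'b) \<Rightarrow> int \<Rightarrow> 'b \<Rightarrow> 'b"
  where "mor_at \<alpha> i = (if even i then fst \<alpha> else snd \<alpha>)"

lemma fac_mod_periodic [simp]: "fac_mod M (i - 2) = fac_mod M i"
  by (simp add: fac_mod_def)

lemma fac_mod_succ: "fac_mod M (i + 1) = fac_mod M (i - 1)"
  by (simp add: fac_mod_def)

lemma fac_diff_succ: "fac_diff M (i + 1) = fac_diff M (i - 1)"
  by (simp add: fac_diff_def)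

lemma T_obj_cmod: "cmod (T_obj S R g M) i = base_change S R g (fac_mod M i)"
  by (simp add: T_obj_def fac_mod_def)

lemma T_obj_cdiff: "cdiff (T_obj S R g M) i = base_change_map S R g (fac_mod M (i - 1)) (fac_diff M i)"
  by (simp add: T_obj_def fac_mod_def fac_diff_def)

lemma T_map_at: "T_map S R g N \<alpha> i = base_change_map S R g (fac_mod N i) (mor_at \<alpha> i)"
  by (simp add: T_map_def fac_mod_def mor_at_def)

lemma all_parity_iff:
  fixes P :: "bool \<Rightarrow> bool"
  shows "(\<forall>i :: int. P (even i)) \<longleftrightarrow> P True \<and> P False"
  by (metis even_zero odd_one)

lemma fac_mor_iff:
  "\<alpha> \<in> fac_mor S M N \<longleftrightarrow>
    (\<forall>i. mor_at \<alpha> i \<in> lin_hom S (fac_mod M i) (fac_mod N i) \<and>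
      (\<forall>x \<in> carrier (fac_mod M i). mor_at \<alpha> (i - 1) (fac_diff M i x) = fac_diff N i (mor_at \<alpha> i x)))"
proof -
  let ?P = "\<lambda>b. (if b then fst \<alpha> else snd \<alpha>) \<in> lin_hom S (if b then fac0 M else fac1 M) (if b then fac0 N else fac1 N) \<and>
      (\<forall>x \<in> carrier (if b then fac0 M else fac1 M).
        (if b then snd \<alpha> else fst \<alpha>) ((if b then dif0 M else dif1 M) x) =
        (if b then dif0 N else dif1 N) ((if b then fst \<alpha> else snd \<alpha>) x))"
  have "\<alpha> \<in> fac_mor S M N \<longleftrightarrow> ?P True \<and> ?P False"
    by (auto simp: fac_mor_def split: prod.splits)
  also have "\<dots> \<longleftrightarrow> (\<forall>i :: int. ?P (even i))" by (rule all_parity_iff[symmetric])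
  finally show ?thesis
    by (simp add: mor_at_def fac_mod_def fac_diff_def if_distrib[of Not] cong: if_cong)
qed

lemma fac_morD:
  assumes "\<alpha> \<in> fac_mor S M N"
  shows "mor_at \<alpha> i \<in> lin_hom S (fac_mod M i) (fac_mod N i)"
    "x \<in> carrier (fac_mod M i) \<Longrightarrow> mor_at \<alpha> (i - 1) (fac_diff M i x) = fac_diff N i (mor_at \<alpha> i x)"
  using assms by (simp_all add: fac_mor_iff)

locale factorization_reduction = reduction S R g f
  for S :: "('a, 'x) ring_scheme" and R :: "('r, 'y) ring_scheme" and g :: "'a \<Rightarrow> 'r" and f :: 'a +
  fixes C :: "('a, 'm) module set"
  assumes C_module: "M \<in> C \<Longrightarrow> module S M"
    and C_regular: "M \<in> C \<Longrightarrow> module_regular M f"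
    and C_Ext1: "M \<in> C \<Longrightarrow> N \<in> C \<Longrightarrow> zero_module (Ext S 1 M N)"
begin

abbreviation "Fac \<equiv> factorizations S C f"
abbreviation "T \<equiv> T_obj S R g"
abbreviation "T_mor \<equiv> T_map S R g"
abbreviation "W \<equiv> base_change_subcategory S R g C"

lemma smult_f_cancel:
  "M \<in> C \<Longrightarrow> x \<in> carrier M \<Longrightarrow> y \<in> carrier M \<Longrightarrow> f \<odot>\<^bsub>M\<^esub> x = f \<odot>\<^bsub>M\<^esub> y \<Longrightarrow> x = y"
  by (rule module_regular_cancel[OF C_module f C_regular])

lemma factorizationD:
  assumes "M \<in> Fac"
  shows "fac_mod M i \<in> C"
    and "fac_diff M i \<in> lin_hom S (fac_mod M i) (fac_mod M (i - 1))"
    and "x \<in> carrier (fac_mod M i) \<Longrightarrow> fac_diff M (i - 1) (fac_diff M i x) = f \<odot>\<^bsub>fac_mod M i\<^esub> x"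
  using assms by (auto simp: factorizations_def fac_mod_def fac_diff_def)

lemma fac_diff_diff:
  assumes "M \<in> Fac" "x \<in> carrier (fac_mod M i)"
  shows "fac_diff M (i + 1) (fac_diff M i x) = f \<odot>\<^bsub>fac_mod M i\<^esub> x"
  using factorizationD(3)[OF assms] by (simp add: fac_diff_succ)

lemma fac_diff_up:
  assumes "M \<in> Fac"
  shows "fac_diff M (i + 1) \<in> lin_hom S (fac_mod M (i + 1)) (fac_mod M i)"
  using factorizationD(2)[OF assms, of "i + 1"] by simp

text \<open>
  Since \<open>dd = f\<close> and \<open>f\<close> is regular.
\<close>

lemma fac_diff_inj:
  assumes M: "M \<in> Fac" and x: "x \<in> carrier (fac_mod M i)" "y \<in> carrier (fac_mod M i)"
    and eq: "fac_diff M i x = fac_diff M i y"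
  shows "x = y"
  using smult_f_cancel[OF factorizationD(1)[OF M] x] factorizationD(3)[OF M x(1)]
    factorizationD(3)[OF M x(2)] eq by simp

lemma factorization_maps:
  assumes M: "M \<in> Fac"
  shows "fac_diff M 0 \<in> lin_hom S (fac_mod M 0) (fac_mod M 1)"
    and "fac_diff M 1 \<in> lin_hom S (fac_mod M 1) (fac_mod M 0)"
    and "x \<in> carrier (fac_mod M 0) \<Longrightarrow> fac_diff M 1 (fac_diff M 0 x) = f \<odot>\<^bsub>fac_mod M 0\<^esub> x"
    and "y \<in> carrier (fac_mod M 1) \<Longrightarrow> fac_diff M 0 (fac_diff M 1 y) = f \<odot>\<^bsub>fac_mod M 1\<^esub> y"
  using factorizationD(2)[OF M, of 0] factorizationD(2)[OF M, of 1] fac_diff_diff[OF M, of x 0]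
    factorizationD(3)[OF M, of y 1] by (simp_all add: fac_mod_def)

lemmas fac_module = C_module[OF factorizationD(1)]

lemma base_changed_objectE:
  assumes "V \<in> W"
  obtains N k where "module R V" "N \<in> C" "k \<in> lin_hom R V (bc N)"
    "inv_into (carrier V) k \<in> lin_hom R (bc N) V"
    "\<And>v. v \<in> carrier V \<Longrightarrow> inv_into (carrier V) k (k v) = v"
proof -
  from assms obtain N k where V: "module R V" "N \<in> C" and k: "k \<in> lin_hom R V (bc N)"
    and bij: "bij_betw k (carrier V) (carrier (bc N))"
    by (auto simp: base_change_subcategory_def iso_modules_def)
  show ?thesis
    using that[OF V k lin_hom_inv_into[OF V(1) k bij]] bij
    by (auto simp: bij_betw_inv_into_left)
qed

context
  fixes M assumes M: "M \<in> Fac"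
begin

lemma T_cdiff_unit_map:
  assumes "x \<in> carrier (fac_mod M i)"
  shows "cdiff (T M) i (unit_map (fac_mod M i) x) = unit_map (fac_mod M (i - 1)) (fac_diff M i x)"
  unfolding T_obj_cdiff
  by (rule base_change_map_unit_map[OF fac_module[OF M] fac_module[OF M] factorizationD(2)[OF M] assms])

lemma T_element:
  assumes "X \<in> carrier (cmod (T M) i)"
  obtains x where "x \<in> carrier (fac_mod M i)" "X = unit_map (fac_mod M i) x"
  using assms unfolding T_obj_cmod by (rule unit_map_surj[OF fac_module[OF M]])

lemma T_is_complex: "is_complex R (T M)"
proof -
  have "cdiff (T M) (i - 1) (cdiff (T M) i X) = \<zero>\<^bsub>cmod (T M) (i - 2)\<^esub>"
    if "X \<in> carrier (cmod (T M) i)" for i X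
  proof -
    from that obtain x where x: "x \<in> carrier (fac_mod M i)" "X = unit_map (fac_mod M i) x"
      by (rule T_element)
    have dx: "fac_diff M i x \<in> carrier (fac_mod M (i - 1))"
      by (rule lin_hom_closed[OF factorizationD(2)[OF M] x(1)])
    have "cdiff (T M) (i - 1) (cdiff (T M) i X) = unit_map (fac_mod M i) (f \<odot>\<^bsub>fac_mod M i\<^esub> x)"
      using T_cdiff_unit_map[OF x(1)] T_cdiff_unit_map[OF dx] factorizationD(3)[OF M x(1)] x(2) by simp
    also have "\<dots> = \<zero>\<^bsub>cmod (T M) (i - 2)\<^esub>"
      using unit_map_kernel[OF fac_module[OF M]] x(1) module.smult_closed[OF fac_module[OF M] f x(1)]
      by (auto simp: T_obj_cmod)
    finally show ?thesis .
  qed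
  then show ?thesis
    unfolding is_complex_def
    by (auto simp: T_obj_cmod T_obj_cdiff base_change_module[OF fac_module[OF M]]
        base_change_map_lin_hom[OF fac_module[OF M] fac_module[OF M] factorizationD(2)[OF M]])
qed

text \<open>
  If \<open>d x\<close> vanishes modulo \<open>f\<close>, then \<open>d x = f y = d (d y)\<close>, and \<open>d\<close> can be cancelled.
\<close>

lemma T_acyclic: "acyclic_complex (T M)"
  unfolding acyclic_complex_def
proof (intro allI equalityI subsetI)
  fix i X assume "X \<in> cycles (T M) i"
  then have X: "X \<in> carrier (cmod (T M) i)" "cdiff (T M) i X = \<zero>\<^bsub>cmod (T M) (i - 1)\<^esub>"
    by (auto simp: cycles_def)
  from X(1) obtain x where x: "x \<in> carrier (fac_mod M i)" "X = unit_map (fac_mod M i) x"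
    by (rule T_element)
  have "unit_map (fac_mod M (i - 1)) (fac_diff M i x) = \<zero>\<^bsub>bc (fac_mod M (i - 1))\<^esub>"
    using X(2) x T_cdiff_unit_map by (simp add: T_obj_cmod)
  then obtain y where y: "y \<in> carrier (fac_mod M (i - 1))" "fac_diff M i x = f \<odot>\<^bsub>fac_mod M (i - 1)\<^esub> y"
    using unit_map_kernel[OF fac_module[OF M] lin_hom_closed[OF factorizationD(2)[OF M] x(1)]] by blast
  have y': "y \<in> carrier (fac_mod M (i + 1))" using y by (simp add: fac_mod_succ)
  have "fac_diff M i x = fac_diff M i (fac_diff M (i + 1) y)"
    using y fac_diff_diff[OF M y(1)] by (simp add: fac_diff_succ)
  then have "x = fac_diff M (i + 1) y"
    by (rule fac_diff_inj[OF M x(1) lin_hom_closed[OF fac_diff_up[OF M] y']])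
  then have "X = cdiff (T M) (i + 1) (unit_map (fac_mod M (i + 1)) y)"
    using x T_cdiff_unit_map[OF y'] by simp
  then show "X \<in> boundaries (T M) i"
    using y' by (auto simp: boundaries_def T_obj_cmod unit_map_closed[OF fac_module[OF M]])
next
  fix i X assume "X \<in> boundaries (T M) i"
  then obtain Y where Y: "Y \<in> carrier (cmod (T M) (i + 1))" "X = cdiff (T M) (i + 1) Y"
    by (auto simp: boundaries_def)
  then show "X \<in> cycles (T M) i"
    using is_complexD(3)[OF T_is_complex Y(1)] lin_hom_closed[OF is_complex_diff_up[OF T_is_complex] Y(1)]
    by (simp add: cycles_def)
qed

lemma T_cmod_mem: "cmod (T M) i \<in> W"
  unfolding base_change_subcategory_def T_obj_cmod
  using base_change_module[OF fac_module[OF M]] factorizationD(1)[OF M] lin_hom_id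
  by (auto simp: iso_modules_def intro!: bexI[of _ "fac_mod M i"] bexI[of _ "\<lambda>x. x"] bij_betw_byWitness)

text \<open>
  A cocycle \<open>\<phi>\<close> lifts to \<open>\<psi>\<close> with \<open>\<psi>d = f\<chi>\<close>, and then \<open>f\<psi> = \<psi>dd = f\<chi>d\<close> gives \<open>\<psi> = \<chi>d\<close>.
  The isomorphism \<open>k\<close> reduces an arbitrary object \<open>V\<close> of the subcategory to the base change of some \<open>N\<close>.
\<close>

lemma hom_from_T_acyclic:
  assumes V: "V \<in> W"
  shows "acyclic_complex (hom_from R (T M) V)"
proof -
  from V obtain N k where VM: "module R V" and N: "N \<in> C" and k: "k \<in> lin_hom R V (bc N)"
    and k': "inv_into (carrier V) k \<in> lin_hom R (bc N) V"
    and k'k: "\<And>v. v \<in> carrier V \<Longrightarrow> inv_into (carrier V) k (k v) = v"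
    by (erule base_changed_objectE)
  note NM = C_module[OF N]
  show ?thesis
  proof (rule hom_from_acyclicI[OF T_is_complex VM])
    fix i \<phi> assume \<phi>: "\<phi> \<in> lin_hom R (cmod (T M) i) V"
      and zero: "\<And>X. X \<in> carrier (cmod (T M) (i + 1)) \<Longrightarrow> \<phi> (cdiff (T M) (i + 1) X) = \<zero>\<^bsub>V\<^esub>"
    let ?A = "fac_mod M i" and ?B = "fac_mod M (i - 1)"
    interpret N: module S N by (rule NM)
    have "(\<lambda>X. k (\<phi> X)) \<in> lin_hom R (bc ?A) (bc N)"
      using lin_hom_comp[OF \<phi> k] by (simp add: T_obj_cmod)
    then obtain \<psi> where \<psi>: "\<psi> \<in> lin_hom S ?A N"
      and \<psi>_lift: "\<And>x. x \<in> carrier ?A \<Longrightarrow> unit_map N (\<psi> x) = k (\<phi> (unit_map ?A x))"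
      by (rule reduced_map_lifts[OF fac_module[OF M] NM C_regular[OF N] C_Ext1[OF factorizationD(1)[OF M] N]])
        auto
    have d: "fac_diff M (i + 1) \<in> lin_hom S ?B ?A" using fac_diff_up[OF M, of i] by (simp add: fac_mod_succ)
    have "unit_map N (\<psi> (fac_diff M (i + 1) x)) = \<zero>\<^bsub>bc N\<^esub>" if x: "x \<in> carrier ?B" for x
    proof -
      have x': "x \<in> carrier (fac_mod M (i + 1))" using x by (simp add: fac_mod_succ)
      have "unit_map N (\<psi> (fac_diff M (i + 1) x)) =
          k (\<phi> (cdiff (T M) (i + 1) (unit_map (fac_mod M (i + 1)) x)))"
        using \<psi>_lift[OF lin_hom_closed[OF d x]] T_cdiff_unit_map[OF x'] by simp
      also have "\<dots> = k \<zero>\<^bsub>V\<^esub>"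
        using zero x' unit_map_closed[OF fac_module[OF M] x'] by (simp add: T_obj_cmod)
      finally show ?thesis
        using lin_hom_zero[OF VM base_change_module[OF NM] k] by simp
    qed
    then obtain \<chi> where \<chi>: "\<chi> \<in> lin_hom S ?B N"
      and \<psi>\<chi>: "\<And>x. x \<in> carrier ?B \<Longrightarrow> \<psi> (fac_diff M (i + 1) x) = f \<odot>\<^bsub>N\<^esub> \<chi> x"
      by (rule reduced_map_zero[OF fac_module[OF M] NM C_regular[OF N] lin_hom_comp[OF d \<psi>]]) auto
    have \<psi>_eq: "\<psi> x = \<chi> (fac_diff M i x)" if x: "x \<in> carrier ?A" for x
    proof (rule smult_f_cancel[OF N lin_hom_closed[OF \<psi> x]])
      have dx: "fac_diff M i x \<in> carrier ?B" by (rule lin_hom_closed[OF factorizationD(2)[OF M] x])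
      then show "\<chi> (fac_diff M i x) \<in> carrier N" by (rule lin_hom_closed[OF \<chi>])
      show "f \<odot>\<^bsub>N\<^esub> \<psi> x = f \<odot>\<^bsub>N\<^esub> \<chi> (fac_diff M i x)"
        using \<psi>\<chi>[OF dx] fac_diff_diff[OF M x] lin_hom_smult[OF \<psi> f x] by simp
    qed
    let ?h = "\<lambda>X. inv_into (carrier V) k (bc_map N \<chi> X)"
    have "?h \<in> lin_hom R (cmod (T M) (i - 1)) V"
      using lin_hom_comp[OF base_change_map_lin_hom[OF fac_module[OF M] NM \<chi>] k'] by (simp add: T_obj_cmod)
    moreover have "\<phi> X = ?h (cdiff (T M) i X)" if X: "X \<in> carrier (cmod (T M) i)" for X
    proof -
      from X obtain x where x: "x \<in> carrier ?A" "X = unit_map ?A x" by (rule T_element)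
      have "bc_map N \<chi> (cdiff (T M) i X) = unit_map N (\<chi> (fac_diff M i x))"
        using T_cdiff_unit_map[OF x(1)] x(2)
          base_change_map_unit_map[OF fac_module[OF M] NM \<chi> lin_hom_closed[OF factorizationD(2)[OF M] x(1)]]
        by simp
      also have "\<dots> = k (\<phi> X)" using \<psi>_lift x by (simp add: \<psi>_eq)
      finally show ?thesis using k'k lin_hom_closed[OF \<phi> X] by simp
    qed
    ultimately show "\<exists>\<psi> \<in> lin_hom R (cmod (T M) (i - 1)) V. \<forall>X \<in> carrier (cmod (T M) i). \<phi> X = \<psi> (cdiff (T M) i X)"
      by (intro bexI[of _ ?h]) auto
  qed
qed

text \<open>
  Here a cycle lifts to \<open>\<psi>\<close> with \<open>d\<psi> = f\<chi> = dd\<chi>\<close>, and cancelling \<open>d\<close> gives \<open>\<psi> = d\<chi>\<close>.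
\<close>

lemma hom_to_T_acyclic:
  assumes V: "V \<in> W"
  shows "acyclic_complex (hom_to R V (T M))"
proof -
  from V obtain N k where VM: "module R V" and N: "N \<in> C" and k: "k \<in> lin_hom R V (bc N)"
    and k': "inv_into (carrier V) k \<in> lin_hom R (bc N) V"
    and k'k: "\<And>v. v \<in> carrier V \<Longrightarrow> inv_into (carrier V) k (k v) = v"
    by (erule base_changed_objectE)
  note NM = C_module[OF N]
  show ?thesis
  proof (rule hom_to_acyclicI[OF T_is_complex VM])
    fix i \<phi> assume \<phi>: "\<phi> \<in> lin_hom R V (cmod (T M) i)"
      and zero: "\<And>v. v \<in> carrier V \<Longrightarrow> cdiff (T M) i (\<phi> v) = \<zero>\<^bsub>cmod (T M) (i - 1)\<^esub>"
    let ?A = "fac_mod M i" and ?B = "fac_mod M (i - 1)"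
    have "(\<lambda>X. \<phi> (inv_into (carrier V) k X)) \<in> lin_hom R (bc N) (bc ?A)"
      using lin_hom_comp[OF k' \<phi>] by (simp add: T_obj_cmod)
    then obtain \<psi> where \<psi>: "\<psi> \<in> lin_hom S N ?A"
      and \<psi>_lift: "\<And>n. n \<in> carrier N \<Longrightarrow>
        unit_map ?A (\<psi> n) = \<phi> (inv_into (carrier V) k (unit_map N n))"
      by (rule reduced_map_lifts[OF NM fac_module[OF M] C_regular[OF factorizationD(1)[OF M]]
            C_Ext1[OF N factorizationD(1)[OF M]]]) auto
    note d = factorizationD(2)[OF M, of i]
    have "unit_map ?B (fac_diff M i (\<psi> n)) = \<zero>\<^bsub>bc ?B\<^esub>" if n: "n \<in> carrier N" for n
    proof -
      have "unit_map ?B (fac_diff M i (\<psi> n)) = cdiff (T M) i (unit_map ?A (\<psi> n))"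
        using T_cdiff_unit_map[OF lin_hom_closed[OF \<psi> n]] by simp
      then show ?thesis
        using zero[OF lin_hom_closed[OF k' unit_map_closed[OF NM n]]]
        by (simp add: \<psi>_lift[OF n] T_obj_cmod)
    qed
    then obtain \<chi> where \<chi>: "\<chi> \<in> lin_hom S N ?B"
      and \<psi>\<chi>: "\<And>n. n \<in> carrier N \<Longrightarrow> fac_diff M i (\<psi> n) = f \<odot>\<^bsub>?B\<^esub> \<chi> n"
      by (rule reduced_map_zero[OF NM fac_module[OF M] C_regular[OF factorizationD(1)[OF M]]
            lin_hom_comp[OF \<psi> d]]) auto
    have \<chi>': "\<chi> \<in> lin_hom S N (fac_mod M (i + 1))" using \<chi> by (simp add: fac_mod_succ)
    have \<psi>_eq: "\<psi> n = fac_diff M (i + 1) (\<chi> n)" if n: "n \<in> carrier N" for n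
    proof (rule fac_diff_inj[OF M lin_hom_closed[OF \<psi> n]])
      show "fac_diff M (i + 1) (\<chi> n) \<in> carrier ?A"
        by (rule lin_hom_closed[OF fac_diff_up[OF M] lin_hom_closed[OF \<chi>' n]])
      show "fac_diff M i (\<psi> n) = fac_diff M i (fac_diff M (i + 1) (\<chi> n))"
        using \<psi>\<chi>[OF n] fac_diff_diff[OF M lin_hom_closed[OF \<chi> n]] by (simp add: fac_diff_succ)
    qed
    let ?h = "\<lambda>v. bc_map (fac_mod M (i + 1)) \<chi> (k v)"
    have "?h \<in> lin_hom R V (cmod (T M) (i + 1))"
      using lin_hom_comp[OF k base_change_map_lin_hom[OF NM fac_module[OF M] \<chi>']] by (simp add: T_obj_cmod)
    moreover have "\<phi> v = cdiff (T M) (i + 1) (?h v)" if v: "v \<in> carrier V" for v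
    proof -
      from lin_hom_closed[OF k v] obtain n where n: "n \<in> carrier N" "k v = unit_map N n"
        by (rule unit_map_surj[OF NM])
      have "cdiff (T M) (i + 1) (?h v) = unit_map ?A (fac_diff M (i + 1) (\<chi> n))"
        using T_cdiff_unit_map[OF lin_hom_closed[OF \<chi>' n(1)]] n(2)
          base_change_map_unit_map[OF NM fac_module[OF M] \<chi>' n(1)] by simp
      also have "\<dots> = \<phi> (inv_into (carrier V) k (k v))"
        using \<psi>_lift[OF n(1)] n by (simp add: \<psi>_eq)
      finally show ?thesis by (simp add: k'k v)
    qed
    ultimately show "\<exists>\<psi> \<in> lin_hom R V (cmod (T M) (i + 1)). \<forall>v \<in> carrier V. \<phi> v = cdiff (T M) (i + 1) (\<psi> v)"
      by (intro bexI[of _ ?h]) auto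
  qed
qed

lemma T_totally_acyclic: "totally_acyclic R W (T M)"
  unfolding totally_acyclic_def
  using T_is_complex T_acyclic T_cmod_mem hom_from_T_acyclic hom_to_T_acyclic by blast

end

lemma T_map_unit_map:
  assumes M: "M \<in> Fac" and N: "N \<in> Fac" and \<alpha>: "\<alpha> \<in> fac_mor S M N"
    and x: "x \<in> carrier (fac_mod M i)"
  shows "T_mor N \<alpha> i (unit_map (fac_mod M i) x) = unit_map (fac_mod N i) (mor_at \<alpha> i x)"
  unfolding T_map_at
  by (rule base_change_map_unit_map[OF fac_module[OF M] fac_module[OF N] fac_morD(1)[OF \<alpha>] x])

lemma T_map_chain_map:
  assumes M: "M \<in> Fac" and N: "N \<in> Fac" and \<alpha>: "\<alpha> \<in> fac_mor S M N"
  shows "T_mor N \<alpha> \<in> chain_maps R (T M) (T N)"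
proof -
  have "T_mor N \<alpha> i \<in> lin_hom R (cmod (T M) i) (cmod (T N) i)" for i
    unfolding T_map_at T_obj_cmod
    by (rule base_change_map_lin_hom[OF fac_module[OF M] fac_module[OF N] fac_morD(1)[OF \<alpha>]])
  moreover have "T_mor N \<alpha> (i - 1) (cdiff (T M) i X) = cdiff (T N) i (T_mor N \<alpha> i X)"
    if "X \<in> carrier (cmod (T M) i)" for i X
  proof -
    from that obtain x where x: "x \<in> carrier (fac_mod M i)" "X = unit_map (fac_mod M i) x"
      by (rule T_element[OF M])
    then show ?thesis
      using T_map_unit_map[OF M N \<alpha> lin_hom_closed[OF factorizationD(2)[OF M] x(1)]]
        T_cdiff_unit_map[OF N lin_hom_closed[OF fac_morD(1)[OF \<alpha>] x(1)]]
      by (simp add: T_cdiff_unit_map[OF M] T_map_unit_map[OF M N \<alpha>] fac_morD(2)[OF \<alpha>])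
  qed
  ultimately show ?thesis by (simp add: chain_maps_def)
qed

lemma T_map_eqI:
  assumes M: "M \<in> Fac" and N: "N \<in> Fac" and \<alpha>: "\<alpha> \<in> fac_mor S M N"
    and a: "a \<in> chain_maps R (T M) (T N)"
    and eq: "\<And>i x. x \<in> carrier (fac_mod M i) \<Longrightarrow>
      a i (unit_map (fac_mod M i) x) = unit_map (fac_mod N i) (mor_at \<alpha> i x)"
  shows "(T_mor N \<alpha>, a) \<in> chain_homotopic R (T M) (T N)"
proof (rule chain_maps_eq_homotopic[OF T_is_complex[OF M] T_is_complex[OF N] T_map_chain_map[OF M N \<alpha>] a])
  fix i X assume "X \<in> carrier (cmod (T M) i)"
  then obtain x where "x \<in> carrier (fac_mod M i)" "X = unit_map (fac_mod M i) x"
    by (rule T_element[OF M])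
  then show "T_mor N \<alpha> i X = a i X" by (simp add: eq T_map_unit_map[OF M N \<alpha>])
qed

section \<open>The functor is full and faithful on representatives\<close>

context
  fixes M N assumes M: "M \<in> Fac" and N: "N \<in> Fac"
begin

lemma T_hom_lift:
  assumes "\<phi> \<in> lin_hom R (cmod (T M) i) (cmod (T N) j)"
  obtains \<psi> where "\<psi> \<in> lin_hom S (fac_mod M i) (fac_mod N j)"
    "\<And>x. x \<in> carrier (fac_mod M i) \<Longrightarrow> unit_map (fac_mod N j) (\<psi> x) = \<phi> (unit_map (fac_mod M i) x)"
  using assms unfolding T_obj_cmod
  by (rule reduced_map_lifts[OF fac_module[OF M] fac_module[OF N] C_regular[OF factorizationD(1)[OF N]]
        C_Ext1[OF factorizationD(1)[OF M] factorizationD(1)[OF N]]]) blast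

lemma fac_homotopic_imp_chain_homotopic:
  assumes "(\<alpha>, \<beta>) \<in> fac_homotopic S M N"
  shows "(T_mor N \<alpha>, T_mor N \<beta>) \<in> chain_homotopic R (T M) (T N)"
proof -
  from assms obtain h0 h1 where \<alpha>: "\<alpha> \<in> fac_mor S M N" and \<beta>: "\<beta> \<in> fac_mor S M N"
    and h: "h0 \<in> lin_hom S (fac0 M) (fac1 N)" "h1 \<in> lin_hom S (fac1 M) (fac0 N)"
    and eq0: "\<forall>x \<in> carrier (fac0 M).
      fst \<alpha> x \<ominus>\<^bsub>fac0 N\<^esub> fst \<beta> x = h1 (dif0 M x) \<oplus>\<^bsub>fac0 N\<^esub> dif1 N (h0 x)"
    and eq1: "\<forall>x \<in> carrier (fac1 M).
      snd \<alpha> x \<ominus>\<^bsub>fac1 N\<^esub> snd \<beta> x = h0 (dif1 M x) \<oplus>\<^bsub>fac1 N\<^esub> dif0 N (h1 x)"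
    by (auto simp: fac_homotopic_def)
  define h where "h i = (if even i then h0 else h1)" for i :: int
  have h: "h i \<in> lin_hom S (fac_mod M i) (fac_mod N (i + 1))" for i
    using h by (simp add: h_def fac_mod_def)
  have eq: "mor_at \<alpha> i x \<ominus>\<^bsub>fac_mod N i\<^esub> mor_at \<beta> i x =
      h (i - 1) (fac_diff M i x) \<oplus>\<^bsub>fac_mod N i\<^esub> fac_diff N (i + 1) (h i x)"
    if "x \<in> carrier (fac_mod M i)" for i x
    using eq0 eq1 that by (auto simp: h_def fac_mod_def mor_at_def fac_diff_def)
  have "contracts R (T M) (T N) (\<lambda>i. bc_map (fac_mod N (i + 1)) (h i))
      (\<lambda>i X. T_mor N \<alpha> i X \<ominus>\<^bsub>cmod (T N) i\<^esub> T_mor N \<beta> i X)"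
    unfolding contracts_def
  proof (intro conjI allI ballI)
    show "bc_map (fac_mod N (i + 1)) (h i) \<in> lin_hom R (cmod (T M) i) (cmod (T N) (i + 1))" for i
      unfolding T_obj_cmod by (rule base_change_map_lin_hom[OF fac_module[OF M] fac_module[OF N] h])
    fix i X assume "X \<in> carrier (cmod (T M) i)"
    then obtain x where x: "x \<in> carrier (fac_mod M i)" "X = unit_map (fac_mod M i) x"
      by (rule T_element[OF M])
    have c: "mor_at \<alpha> i x \<in> carrier (fac_mod N i)" "mor_at \<beta> i x \<in> carrier (fac_mod N i)"
      "fac_diff M i x \<in> carrier (fac_mod M (i - 1))" "h i x \<in> carrier (fac_mod N (i + 1))"
      using lin_hom_closed[OF fac_morD(1)[OF \<alpha>] x(1)] lin_hom_closed[OF fac_morD(1)[OF \<beta>] x(1)]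
        lin_hom_closed[OF factorizationD(2)[OF M] x(1)] lin_hom_closed[OF h x(1)] by auto
    have c': "h (i - 1) (fac_diff M i x) \<in> carrier (fac_mod N i)"
      "fac_diff N (i + 1) (h i x) \<in> carrier (fac_mod N i)"
      using lin_hom_closed[OF h c(3)] lin_hom_closed[OF fac_diff_up[OF N] c(4)] by auto
    have "T_mor N \<alpha> i X \<ominus>\<^bsub>cmod (T N) i\<^esub> T_mor N \<beta> i X =
        unit_map (fac_mod N i) (mor_at \<alpha> i x \<ominus>\<^bsub>fac_mod N i\<^esub> mor_at \<beta> i x)"
      using x c by (simp add: T_map_unit_map[OF M N \<alpha>] T_map_unit_map[OF M N \<beta>] T_obj_cmod
          unit_map_minus[OF fac_module[OF N]])
    also have "\<dots> = unit_map (fac_mod N i) (h (i - 1) (fac_diff M i x)) \<oplus>\<^bsub>cmod (T N) i\<^esub>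
        unit_map (fac_mod N i) (fac_diff N (i + 1) (h i x))"
      using c' by (simp add: eq[OF x(1)] unit_map_add[OF fac_module[OF N]] T_obj_cmod)
    also have "unit_map (fac_mod N i) (h (i - 1) (fac_diff M i x)) =
        bc_map (fac_mod N (i - 1 + 1)) (h (i - 1)) (cdiff (T M) i X)"
      using base_change_map_unit_map[OF fac_module[OF M] fac_module[OF N] h c(3)] x
      by (simp add: T_cdiff_unit_map[OF M])
    also have "unit_map (fac_mod N i) (fac_diff N (i + 1) (h i x)) =
        cdiff (T N) (i + 1) (bc_map (fac_mod N (i + 1)) (h i) X)"
      using base_change_map_unit_map[OF fac_module[OF M] fac_module[OF N] h x(1)]
        T_cdiff_unit_map[OF N c(4)] x by simp
    finally show "T_mor N \<alpha> i X \<ominus>\<^bsub>cmod (T N) i\<^esub> T_mor N \<beta> i X =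
        bc_map (fac_mod N (i - 1 + 1)) (h (i - 1)) (cdiff (T M) i X) \<oplus>\<^bsub>cmod (T N) i\<^esub>
        cdiff (T N) (i + 1) (bc_map (fac_mod N (i + 1)) (h i) X)" .
  qed
  then show ?thesis by (rule chain_homotopicI[OF T_map_chain_map[OF M N \<alpha>] T_map_chain_map[OF M N \<beta>]]) simp
qed

text \<open>
  The heart of faithfulness.  Only the components of the chain homotopy in degrees \<open>-1\<close> and \<open>0\<close> are lifted;
  the error \<open>f\<chi>\<close> of the lifted identity in degree \<open>0\<close> is absorbed into \<open>k1'\<close>, and the identity in
  degree \<open>1\<close> is then forced, because it holds after composition with the injective map \<open>d\<^sub>1\<close>.
\<close>

lemma chain_homotopic_imp_fac_homotopic:
  assumes \<alpha>: "\<alpha> \<in> fac_mor S M N" and \<beta>: "\<beta> \<in> fac_mor S M N"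
    and "(T_mor N \<alpha>, T_mor N \<beta>) \<in> chain_homotopic R (T M) (T N)"
  shows "(\<alpha>, \<beta>) \<in> fac_homotopic S M N"
proof -
  let ?M0 = "fac_mod M 0" and ?M1 = "fac_mod M 1" and ?N0 = "fac_mod N 0" and ?N1 = "fac_mod N 1"
  have m1: "fac_mod M (- 1) = ?M1" by (simp add: fac_mod_def)
  from assms(3) obtain h where
      h: "\<And>i. h i \<in> lin_hom R (cmod (T M) i) (cmod (T N) (i + 1))"
    and eq: "\<And>i X. X \<in> carrier (cmod (T M) i) \<Longrightarrow>
        T_mor N \<alpha> i X \<ominus>\<^bsub>cmod (T N) i\<^esub> T_mor N \<beta> i X =
        h (i - 1) (cdiff (T M) i X) \<oplus>\<^bsub>cmod (T N) i\<^esub> cdiff (T N) (i + 1) (h i X)"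
    unfolding chain_homotopic_def by blast
  from h[of "- 1"] obtain k1 where k1: "k1 \<in> lin_hom S ?M1 ?N0"
    and k1_lift: "\<And>x. x \<in> carrier ?M1 \<Longrightarrow> unit_map ?N0 (k1 x) = h (- 1) (unit_map ?M1 x)"
    using T_hom_lift[of "h (- 1)" "- 1" 0] by (auto simp: m1)
  from h[of 0] obtain k0 where k0: "k0 \<in> lin_hom S ?M0 ?N1"
    and k0_lift: "\<And>x. x \<in> carrier ?M0 \<Longrightarrow> unit_map ?N1 (k0 x) = h 0 (unit_map ?M0 x)"
    using T_hom_lift[of "h 0" 0 1] by auto
  note M0 = fac_module[OF M, of 0] and M1 = fac_module[OF M, of 1]
    and N0 = fac_module[OF N, of 0] and N1 = fac_module[OF N, of 1]
  interpret N0: module S ?N0 by (rule N0)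
  interpret N1: module S ?N1 by (rule N1)
  interpret B0: module R "bc ?N0" by (rule base_change_module[OF N0])
  note dM0 = factorization_maps(1)[OF M] and dM1 = factorization_maps(2)[OF M]
    and dN0 = factorization_maps(1)[OF N] and dN1 = factorization_maps(2)[OF N]
    and ddM0 = factorization_maps(3)[OF M] and ddM1 = factorization_maps(4)[OF M]
    and ddN0 = factorization_maps(3)[OF N]
  note \<alpha>0 = fac_morD(1)[OF \<alpha>, of 0] and \<beta>0 = fac_morD(1)[OF \<beta>, of 0]
    and \<alpha>1 = fac_morD(1)[OF \<alpha>, of 1] and \<beta>1 = fac_morD(1)[OF \<beta>, of 1]
  let ?\<gamma>0 = "\<lambda>x. mor_at \<alpha> 0 x \<ominus>\<^bsub>?N0\<^esub> mor_at \<beta> 0 x"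
  let ?\<gamma>1 = "\<lambda>x. mor_at \<alpha> 1 x \<ominus>\<^bsub>?N1\<^esub> mor_at \<beta> 1 x"
  let ?e = "\<lambda>x. k1 (fac_diff M 0 x) \<oplus>\<^bsub>?N0\<^esub> fac_diff N 1 (k0 x)"
  have \<gamma>0: "?\<gamma>0 \<in> lin_hom S ?M0 ?N0" by (rule lin_hom_diff_map[OF N0 \<alpha>0 \<beta>0])
  have \<gamma>1: "?\<gamma>1 \<in> lin_hom S ?M1 ?N1" by (rule lin_hom_diff_map[OF N1 \<alpha>1 \<beta>1])
  have e: "?e \<in> lin_hom S ?M0 ?N0"
    by (rule lin_hom_sum_map[OF N0 lin_hom_comp[OF dM0 k1] lin_hom_comp[OF k0 dN1]])
  have "unit_map ?N0 (?\<gamma>0 x \<ominus>\<^bsub>?N0\<^esub> ?e x) = \<zero>\<^bsub>bc ?N0\<^esub>" if x: "x \<in> carrier ?M0" for x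
  proof -
    have dx: "fac_diff M 0 x \<in> carrier ?M1" by (rule lin_hom_closed[OF dM0 x])
    have k0x: "k0 x \<in> carrier ?N1" by (rule lin_hom_closed[OF k0 x])
    have X: "unit_map ?M0 x \<in> carrier (cmod (T M) 0)"
      using unit_map_closed[OF M0 x] by (simp add: T_obj_cmod)
    have "unit_map ?N0 (?\<gamma>0 x) = unit_map ?N0 (k1 (fac_diff M 0 x)) \<oplus>\<^bsub>bc ?N0\<^esub>
        unit_map ?N0 (fac_diff N 1 (k0 x))"
      using eq[OF X] T_map_unit_map[OF M N \<alpha> x] T_map_unit_map[OF M N \<beta> x] T_cdiff_unit_map[OF M x]
        T_cdiff_unit_map[OF N k0x]
      by (simp add: T_obj_cmod unit_map_minus[OF N0 lin_hom_closed[OF \<alpha>0 x] lin_hom_closed[OF \<beta>0 x]]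
          k1_lift[OF dx] k0_lift[OF x] m1)
    also have "\<dots> = unit_map ?N0 (?e x)"
      using unit_map_add[OF N0 lin_hom_closed[OF k1 dx] lin_hom_closed[OF dN1 k0x]] by simp
    finally show ?thesis
      using lin_hom_closed[OF \<gamma>0 x] lin_hom_closed[OF e x]
      by (simp add: unit_map_minus[OF N0] B0.diff_zero_iff unit_map_closed[OF N0])
  qed
  then obtain \<chi> where \<chi>: "\<chi> \<in> lin_hom S ?M0 ?N0"
    and \<chi>_eq: "\<And>x. x \<in> carrier ?M0 \<Longrightarrow> ?\<gamma>0 x \<ominus>\<^bsub>?N0\<^esub> ?e x = f \<odot>\<^bsub>?N0\<^esub> \<chi> x"
    by (rule reduced_map_zero[OF M0 N0 C_regular[OF factorizationD(1)[OF N]] lin_hom_diff_map[OF N0 \<gamma>0 e]]) auto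
  define k1' where "k1' x = k1 x \<oplus>\<^bsub>?N0\<^esub> \<chi> (fac_diff M 1 x)" for x
  have k1': "k1' \<in> lin_hom S ?M1 ?N0"
    unfolding k1'_def[abs_def] by (rule lin_hom_sum_map[OF N0 k1 lin_hom_comp[OF dM1 \<chi>]])
  have deg0: "?\<gamma>0 x = k1' (fac_diff M 0 x) \<oplus>\<^bsub>?N0\<^esub> fac_diff N 1 (k0 x)" if x: "x \<in> carrier ?M0" for x
  proof -
    have c: "k1 (fac_diff M 0 x) \<in> carrier ?N0" "fac_diff N 1 (k0 x) \<in> carrier ?N0"
      "f \<odot>\<^bsub>?N0\<^esub> \<chi> x \<in> carrier ?N0"
      using lin_hom_closed[OF k1 lin_hom_closed[OF dM0 x]] lin_hom_closed[OF dN1 lin_hom_closed[OF k0 x]]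
        lin_hom_closed[OF \<chi> x] f by auto
    have "?\<gamma>0 x = ?e x \<oplus>\<^bsub>?N0\<^esub> f \<odot>\<^bsub>?N0\<^esub> \<chi> x"
      using \<chi>_eq[OF x] lin_hom_closed[OF \<gamma>0 x] lin_hom_closed[OF e x] c(3)
      by (simp add: N0.diff_eq_iff)
    also have "\<dots> = (k1 (fac_diff M 0 x) \<oplus>\<^bsub>?N0\<^esub> f \<odot>\<^bsub>?N0\<^esub> \<chi> x) \<oplus>\<^bsub>?N0\<^esub> fac_diff N 1 (k0 x)"
      using c by (simp add: N0.M.a_ac)
    also have "f \<odot>\<^bsub>?N0\<^esub> \<chi> x = \<chi> (fac_diff M 1 (fac_diff M 0 x))"
      by (simp add: ddM0[OF x] lin_hom_smult[OF \<chi> f x])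
    finally show ?thesis by (simp add: k1'_def)
  qed
  have deg1: "?\<gamma>1 x = k0 (fac_diff M 1 x) \<oplus>\<^bsub>?N1\<^esub> fac_diff N 0 (k1' x)" if x: "x \<in> carrier ?M1" for x
  proof -
    have dx: "fac_diff M 1 x \<in> carrier ?M0" by (rule lin_hom_closed[OF dM1 x])
    have c: "k0 (fac_diff M 1 x) \<in> carrier ?N1" "fac_diff N 0 (k1' x) \<in> carrier ?N1"
      using lin_hom_closed[OF k0 dx] lin_hom_closed[OF dN0 lin_hom_closed[OF k1' x]] by auto
    have c': "fac_diff N 1 (k0 (fac_diff M 1 x)) \<in> carrier ?N0" "f \<odot>\<^bsub>?N0\<^esub> k1' x \<in> carrier ?N0"
      using lin_hom_closed[OF dN1 c(1)] lin_hom_closed[OF k1' x] f by auto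
    have "fac_diff N 1 (?\<gamma>1 x) = ?\<gamma>0 (fac_diff M 1 x)"
      using fac_morD(2)[OF \<alpha>, of x 1] fac_morD(2)[OF \<beta>, of x 1] x
        lin_hom_minus[OF N1 N0 dN1 lin_hom_closed[OF \<alpha>1 x] lin_hom_closed[OF \<beta>1 x]] by simp
    also have "\<dots> = f \<odot>\<^bsub>?N0\<^esub> k1' x \<oplus>\<^bsub>?N0\<^esub> fac_diff N 1 (k0 (fac_diff M 1 x))"
      using deg0[OF dx] by (simp add: ddM1[OF x] lin_hom_smult[OF k1' f x])
    also have "\<dots> = fac_diff N 1 (k0 (fac_diff M 1 x) \<oplus>\<^bsub>?N1\<^esub> fac_diff N 0 (k1' x))"
      using c' ddN0[OF lin_hom_closed[OF k1' x]] by (simp add: lin_hom_add[OF dN1 c] N0.M.a_comm)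
    finally show ?thesis
      by (rule fac_diff_inj[OF N lin_hom_closed[OF \<gamma>1 x] N1.M.add.m_closed[OF c]])
  qed
  show ?thesis
    using \<alpha> \<beta> k0 k1' deg0 deg1
    unfolding fac_homotopic_def by (auto simp: fac_mod_def mor_at_def fac_diff_def)
qed

text \<open>
  Through this equivalence, compatibility of homotopy with the operations on morphisms of
  factorizations follows from the corresponding facts about chain maps.
\<close>

lemma fac_homotopic_iff:
  "(\<alpha>, \<beta>) \<in> fac_homotopic S M N \<longleftrightarrow> \<alpha> \<in> fac_mor S M N \<and> \<beta> \<in> fac_mor S M N \<and>
    (T_mor N \<alpha>, T_mor N \<beta>) \<in> chain_homotopic R (T M) (T N)"
proof -
  have "\<alpha> \<in> fac_mor S M N \<and> \<beta> \<in> fac_mor S M N" if "(\<alpha>, \<beta>) \<in> fac_homotopic S M N"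
    using that by (auto simp: fac_homotopic_def)
  then show ?thesis
    using chain_homotopic_imp_fac_homotopic fac_homotopic_imp_chain_homotopic by blast
qed

lemma fac_homotopic_equiv: "equiv (fac_mor S M N) (fac_homotopic S M N)"
proof -
  note eq = chain_homotopic_equiv[OF T_is_complex[OF M] T_is_complex[OF N]]
  show ?thesis
  proof (rule equivI)
    show "fac_homotopic S M N \<subseteq> fac_mor S M N \<times> fac_mor S M N"
      by (auto simp: fac_homotopic_def)
    show "refl_on (fac_mor S M N) (fac_homotopic S M N)"
    proof (rule refl_onI)
      fix \<alpha> assume \<alpha>: "\<alpha> \<in> fac_mor S M N"
      then show "(\<alpha>, \<alpha>) \<in> fac_homotopic S M N"
        using equiv_class_eq_iff[OF eq, of "T_mor N \<alpha>" "T_mor N \<alpha>"] T_map_chain_map[OF M N \<alpha>]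
        by (simp add: fac_homotopic_iff)
    qed
    show "sym (fac_homotopic S M N)"
    proof (rule symI)
      fix \<alpha> \<beta> assume "(\<alpha>, \<beta>) \<in> fac_homotopic S M N"
      then show "(\<beta>, \<alpha>) \<in> fac_homotopic S M N"
        using symD[of _ "T_mor N \<alpha>" "T_mor N \<beta>"] eq
        by (simp add: fac_homotopic_iff equiv_def)
    qed
    show "trans (fac_homotopic S M N)"
    proof (rule transI)
      fix \<alpha> \<beta> \<gamma> assume "(\<alpha>, \<beta>) \<in> fac_homotopic S M N" "(\<beta>, \<gamma>) \<in> fac_homotopic S M N"
      then show "(\<alpha>, \<gamma>) \<in> fac_homotopic S M N"
        using transD[of _ "T_mor N \<alpha>" "T_mor N \<beta>" "T_mor N \<gamma>"] eq
        by (simp add: fac_homotopic_iff equiv_def)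
    qed
  qed
qed

text \<open>
  The heart of fullness.  The lifts \<open>a0\<close>, \<open>b\<close> of two components of \<open>a\<close> satisfy \<open>a0 d\<^sub>1 = d\<^sub>1 b + f\<chi>\<close>, and
  \<open>a1 = b + d\<^sub>0\<chi>\<close> repairs this square.  The other square commutes because it does so after composition
  with the injective map \<open>d\<^sub>1\<close>.  The reduction of \<open>(a0, a1)\<close> agrees with \<open>a\<close> in degree \<open>0\<close>, where the
  zero homotopy therefore serves as starting point for an extension to all degrees.
\<close>

lemma chain_map_homotopic_to_T_map:
  assumes a: "a \<in> chain_maps R (T M) (T N)"
  obtains \<alpha> where "\<alpha> \<in> fac_mor S M N" "(T_mor N \<alpha>, a) \<in> chain_homotopic R (T M) (T N)"
proof -
  let ?M0 = "fac_mod M 0" and ?M1 = "fac_mod M 1" and ?N0 = "fac_mod N 0" and ?N1 = "fac_mod N 1"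
  note M0 = fac_module[OF M, of 0] and M1 = fac_module[OF M, of 1]
    and N0 = fac_module[OF N, of 0] and N1 = fac_module[OF N, of 1]
  interpret N0: module S ?N0 by (rule N0)
  interpret N1: module S ?N1 by (rule N1)
  interpret B0: module R "bc ?N0" by (rule base_change_module[OF N0])
  note dM0 = factorization_maps(1)[OF M] and dM1 = factorization_maps(2)[OF M]
    and dN0 = factorization_maps(1)[OF N] and dN1 = factorization_maps(2)[OF N]
    and ddM0 = factorization_maps(3)[OF M] and ddN0 = factorization_maps(3)[OF N]
  obtain a0 where a0: "a0 \<in> lin_hom S ?M0 ?N0"
    and a0_lift: "\<And>x. x \<in> carrier ?M0 \<Longrightarrow> unit_map ?N0 (a0 x) = a 0 (unit_map ?M0 x)"
    using T_hom_lift[OF chain_mapsD(1)[OF a, of 0]] by blast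
  obtain b where b: "b \<in> lin_hom S ?M1 ?N1"
    and b_lift: "\<And>x. x \<in> carrier ?M1 \<Longrightarrow> unit_map ?N1 (b x) = a 1 (unit_map ?M1 x)"
    using T_hom_lift[OF chain_mapsD(1)[OF a, of 1]] by blast
  have a0d: "(\<lambda>x. a0 (fac_diff M 1 x)) \<in> lin_hom S ?M1 ?N0" by (rule lin_hom_comp[OF dM1 a0])
  have db: "(\<lambda>x. fac_diff N 1 (b x)) \<in> lin_hom S ?M1 ?N0" by (rule lin_hom_comp[OF b dN1])
  have "unit_map ?N0 (a0 (fac_diff M 1 x) \<ominus>\<^bsub>?N0\<^esub> fac_diff N 1 (b x)) = \<zero>\<^bsub>bc ?N0\<^esub>"
    if x: "x \<in> carrier ?M1" for x
  proof -
    have X: "unit_map ?M1 x \<in> carrier (cmod (T M) 1)"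
      using unit_map_closed[OF M1 x] by (simp add: T_obj_cmod)
    have "unit_map ?N0 (a0 (fac_diff M 1 x)) = unit_map ?N0 (fac_diff N 1 (b x))"
      using chain_mapsD(2)[OF a X] T_cdiff_unit_map[OF M x] T_cdiff_unit_map[OF N lin_hom_closed[OF b x]]
      by (simp add: a0_lift[OF lin_hom_closed[OF dM1 x]] b_lift[OF x])
    then show ?thesis
      using lin_hom_closed[OF a0d x] lin_hom_closed[OF db x]
      by (simp add: unit_map_minus[OF N0] B0.diff_zero_iff unit_map_closed[OF N0])
  qed
  then obtain \<chi> where \<chi>: "\<chi> \<in> lin_hom S ?M1 ?N0"
    and \<chi>_eq: "\<And>x. x \<in> carrier ?M1 \<Longrightarrow>
      a0 (fac_diff M 1 x) \<ominus>\<^bsub>?N0\<^esub> fac_diff N 1 (b x) = f \<odot>\<^bsub>?N0\<^esub> \<chi> x"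
    by (rule reduced_map_zero[OF M1 N0 C_regular[OF factorizationD(1)[OF N]] lin_hom_diff_map[OF N0 a0d db]])
      auto
  define a1 where "a1 x = b x \<oplus>\<^bsub>?N1\<^esub> fac_diff N 0 (\<chi> x)" for x
  have a1: "a1 \<in> lin_hom S ?M1 ?N1"
    unfolding a1_def[abs_def] by (rule lin_hom_sum_map[OF N1 b lin_hom_comp[OF \<chi> dN0]])
  have comm1: "a0 (fac_diff M 1 x) = fac_diff N 1 (a1 x)" if x: "x \<in> carrier ?M1" for x
  proof -
    have "a0 (fac_diff M 1 x) = fac_diff N 1 (b x) \<oplus>\<^bsub>?N0\<^esub> f \<odot>\<^bsub>?N0\<^esub> \<chi> x"
      using \<chi>_eq[OF x] lin_hom_closed[OF a0d x] lin_hom_closed[OF db x] lin_hom_closed[OF \<chi> x] f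
      by (simp add: N0.diff_eq_iff)
    then show ?thesis
      by (simp add: a1_def lin_hom_add[OF dN1 lin_hom_closed[OF b x] lin_hom_closed[OF dN0 lin_hom_closed[OF \<chi> x]]]
          ddN0[OF lin_hom_closed[OF \<chi> x]])
  qed
  have comm0: "a1 (fac_diff M 0 x) = fac_diff N 0 (a0 x)" if x: "x \<in> carrier ?M0" for x
  proof (rule fac_diff_inj[OF N, of _ 1])
    have dx: "fac_diff M 0 x \<in> carrier ?M1" by (rule lin_hom_closed[OF dM0 x])
    show "a1 (fac_diff M 0 x) \<in> carrier ?N1" by (rule lin_hom_closed[OF a1 dx])
    show "fac_diff N 0 (a0 x) \<in> carrier ?N1" by (rule lin_hom_closed[OF dN0 lin_hom_closed[OF a0 x]])
    show "fac_diff N 1 (a1 (fac_diff M 0 x)) = fac_diff N 1 (fac_diff N 0 (a0 x))"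
      using comm1[OF dx] by (simp add: ddM0[OF x] ddN0[OF lin_hom_closed[OF a0 x]] lin_hom_smult[OF a0 f x])
  qed
  have \<alpha>: "(a0, a1) \<in> fac_mor S M N"
    using a0 a1 comm0 comm1 by (simp add: fac_mor_def fac_mod_def fac_diff_def)
  have "(T_mor N (a0, a1), a) \<in> chain_homotopic R (T M) (T N)"
  proof (rule homotopy_extends[OF T_is_complex[OF M] T_is_complex[OF N]
        hom_from_T_acyclic[OF M T_cmod_mem[OF N]] hom_to_T_acyclic[OF N T_cmod_mem[OF M]]
        T_map_chain_map[OF M N \<alpha>] a lin_hom_zero_map[OF is_complexD(1)[OF T_is_complex[OF N]]]
        lin_hom_zero_map[OF is_complexD(1)[OF T_is_complex[OF N]]]])
    fix X assume "X \<in> carrier (cmod (T M) 0)"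
    then obtain x where x: "x \<in> carrier ?M0" "X = unit_map ?M0 x" by (rule T_element[OF M])
    have d1: "cdiff (T N) 1 \<in> lin_hom R (cmod (T N) 1) (cmod (T N) 0)"
      using is_complexD(2)[OF T_is_complex[OF N], of 1] by simp
    have "T_mor N (a0, a1) 0 X = a 0 X"
      using T_map_unit_map[OF M N \<alpha> x(1)] x by (simp add: a0_lift mor_at_def)
    then show "T_mor N (a0, a1) 0 X \<ominus>\<^bsub>cmod (T N) 0\<^esub> a 0 X =
        \<zero>\<^bsub>cmod (T N) 0\<^esub> \<oplus>\<^bsub>cmod (T N) 0\<^esub> cdiff (T N) 1 \<zero>\<^bsub>cmod (T N) 1\<^esub>"
      using lin_hom_closed[OF chain_mapsD(1)[OF a] \<open>X \<in> carrier (cmod (T M) 0)\<close>]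
        lin_hom_zero[OF is_complexD(1)[OF T_is_complex[OF N]] is_complexD(1)[OF T_is_complex[OF N]] d1]
      by (simp add: T_obj_cmod B0.diff_zero_iff)
  qed
  with \<alpha> show ?thesis by (rule that)
qed

end

end

section \<open>Operations on homotopy classes\<close>

text \<open>
  Operations on classes are defined as unions over all representatives; a union of equal classes is
  that class.
\<close>

lemma UN_class:
  assumes r: "equiv A r" and q: "equiv D q" and a: "a \<in> A"
    and cong: "\<And>a'. (a, a') \<in> r \<Longrightarrow> (F a, F a') \<in> q"
  shows "(\<Union>a' \<in> r `` {a}. q `` {F a'}) = q `` {F a}"
proof -
  have "q `` {F a'} = q `` {F a}" if "a' \<in> r `` {a}" for a'
    using cong that equiv_class_eq[OF q] by blast
  moreover have "r `` {a} \<noteq> {}" using equiv_class_self[OF r a] by blast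
  ultimately show ?thesis by (rule SUP_eq_const[rotated])
qed

lemma UN_class2:
  assumes r: "equiv A r" and s: "equiv B s" and q: "equiv D q" and a: "a \<in> A" and b: "b \<in> B"
    and cong: "\<And>a' b'. (a, a') \<in> r \<Longrightarrow> (b, b') \<in> s \<Longrightarrow> (F a b, F a' b') \<in> q"
  shows "(\<Union>a' \<in> r `` {a}. \<Union>b' \<in> s `` {b}. q `` {F a' b'}) = q `` {F a b}"
proof -
  have "(\<Union>b' \<in> s `` {b}. q `` {F a' b'}) = q `` {F a b}" if "a' \<in> r `` {a}" for a'
  proof -
    have "q `` {F a' b'} = q `` {F a b}" if "b' \<in> s `` {b}" for b'
      using cong that \<open>a' \<in> r `` {a}\<close> equiv_class_eq[OF q] by blast
    moreover have "s `` {b} \<noteq> {}" using equiv_class_self[OF s b] by blast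
    ultimately show ?thesis by (rule SUP_eq_const[rotated])
  qed
  moreover have "r `` {a} \<noteq> {}" using equiv_class_self[OF r a] by blast
  ultimately show ?thesis by (rule SUP_eq_const[rotated])
qed

abbreviation chain_class ::
    "('a, 'x) ring_scheme \<Rightarrow> ('a, 'b) chain_complex \<Rightarrow> ('a, 'b) chain_complex \<Rightarrow> (int \<Rightarrow> 'b \<Rightarrow> 'b) \<Rightarrow> (int \<Rightarrow> 'b \<Rightarrow> 'b) set"
  where "chain_class R X Y a \<equiv> chain_homotopic R X Y `` {a}"

lemma Ktac_simps:
  "Obj (Ktac R W) = {T. totally_acyclic R W T}"
  "Hom (Ktac R W) X Y = chain_maps R X Y // chain_homotopic R X Y"
  "Ident (Ktac R W) X = chain_class R X X (\<lambda>i. id)"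
  "ShiftO (Ktac R W) = complex_shift"
  "Std (Ktac R W) = complex_cone_triangle R"
  by (simp_all add: Ktac_def)

lemma chain_class_eqI:
  assumes X: "is_complex R X" and Y: "is_complex R Y"
    and a: "a \<in> chain_maps R X Y" and b: "b \<in> chain_maps R X Y"
    and eq: "\<And>i x. x \<in> carrier (cmod X i) \<Longrightarrow> a i x = b i x"
  shows "chain_class R X Y a = chain_class R X Y b"
  by (rule equiv_class_eq[OF chain_homotopic_equiv[OF X Y] chain_maps_eq_homotopic[OF X Y a b eq]])

lemma Ktac_Comp:
  assumes X: "is_complex R X" and Y: "is_complex R Y" and Z: "is_complex R Z"
    and a: "a \<in> chain_maps R X Y" and b: "b \<in> chain_maps R Y Z"
  shows "Comp (Ktac R W) X Y Z (chain_class R Y Z b) (chain_class R X Y a) =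
    chain_class R X Z (\<lambda>i. b i \<circ> a i)"
  unfolding Ktac_def tri_category.simps
  by (rule UN_class2[OF chain_homotopic_equiv[OF Y Z] chain_homotopic_equiv[OF X Y]
        chain_homotopic_equiv[OF X Z] b a chain_homotopic_comp[OF X Y Z]])

lemma Ktac_Plus:
  assumes X: "is_complex R X" and Y: "is_complex R Y"
    and a: "a \<in> chain_maps R X Y" and b: "b \<in> chain_maps R X Y"
  shows "Plus (Ktac R W) X Y (chain_class R X Y a) (chain_class R X Y b) =
    chain_class R X Y (\<lambda>i x. a i x \<oplus>\<^bsub>cmod Y i\<^esub> b i x)"
  unfolding Ktac_def tri_category.simps
  by (rule UN_class2[OF chain_homotopic_equiv[OF X Y] chain_homotopic_equiv[OF X Y]
        chain_homotopic_equiv[OF X Y] a b chain_homotopic_sum[OF X Y]])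

lemma Ktac_ShiftH:
  assumes X: "is_complex R X" and Y: "is_complex R Y" and a: "a \<in> chain_maps R X Y"
  shows "ShiftH (Ktac R W) X Y (chain_class R X Y a) =
    chain_class R (complex_shift X) (complex_shift Y) (\<lambda>i. a (i - 1))"
  unfolding Ktac_def tri_category.simps
  by (rule UN_class[OF chain_homotopic_equiv[OF X Y]
        chain_homotopic_equiv[OF complex_shift_complex[OF X] complex_shift_complex[OF Y]] a
        chain_homotopic_shift[OF X Y]])

lemma Ktac_HomE:
  assumes "a \<in> Hom (Ktac R W) X Y"
  obtains \<alpha> where "\<alpha> \<in> chain_maps R X Y" "a = chain_class R X Y \<alpha>"
  using assms by (auto simp: Ktac_simps elim: quotientE)

lemma Ktac_HomI: "a \<in> chain_maps R X Y \<Longrightarrow> chain_class R X Y a \<in> Hom (Ktac R W) X Y"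
  by (auto simp: Ktac_simps intro: quotientI)

lemma Ktac_Comp_closed:
  assumes X: "is_complex R X" and Y: "is_complex R Y" and Z: "is_complex R Z"
    and "a \<in> Hom (Ktac R W) X Y" "b \<in> Hom (Ktac R W) Y Z"
  shows "Comp (Ktac R W) X Y Z b a \<in> Hom (Ktac R W) X Z"
  using assms(4,5)
  by (elim Ktac_HomE) (simp add: Ktac_Comp[OF X Y Z] Ktac_HomI chain_maps_comp)

lemma Ktac_Comp_assoc:
  assumes X: "is_complex R X" and Y: "is_complex R Y" and Z: "is_complex R Z" and U: "is_complex R U"
    and "a \<in> Hom (Ktac R W) X Y" "b \<in> Hom (Ktac R W) Y Z" "c \<in> Hom (Ktac R W) Z U"
  shows "Comp (Ktac R W) X Y U (Comp (Ktac R W) Y Z U c b) a =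
    Comp (Ktac R W) X Z U c (Comp (Ktac R W) X Y Z b a)"
  using assms(5-7)
  by (elim Ktac_HomE)
    (simp add: Ktac_Comp[OF X Y Z] Ktac_Comp[OF X Y U] Ktac_Comp[OF X Z U] Ktac_Comp[OF Y Z U]
      chain_maps_comp comp_assoc)

lemma HF_simps:
  "Obj (HF S C f) = factorizations S C f"
  "Hom (HF S C f) M N = fac_mor S M N // fac_homotopic S M N"
  "Ident (HF S C f) M = fac_homotopic S M M `` {(id, id)}"
  "ShiftO (HF S C f) = fac_shift"
  "Std (HF S C f) = fac_cone_triangle S"
  by (simp_all add: HF_def)

section \<open>Morphisms of factorizations\<close>

text \<open>
  Names for the operations on pairs that occur on representatives in \<^const>\<open>HF\<close>.
\<close>

definition fac_comp :: "('b \<Rightarrow> 'b) \<times> ('b \<Rightarrow> 'b) \<Rightarrow> ('b \<Rightarrow> 'b) \<times> ('b \<Rightarrow> 'b) \<Rightarrow> ('b \<Rightarrow> 'b) \<times> ('b \<Rightarrow> 'b)"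
  where "fac_comp \<beta> \<alpha> = (fst \<beta> \<circ> fst \<alpha>, snd \<beta> \<circ> snd \<alpha>)"

definition fac_sum ::
    "('a, 'b) factorization \<Rightarrow> ('b \<Rightarrow> 'b) \<times> ('b \<Rightarrow> 'b) \<Rightarrow> ('b \<Rightarrow> 'b) \<times> ('b \<Rightarrow> 'b) \<Rightarrow> ('b \<Rightarrow> 'b) \<times> ('b \<Rightarrow> 'b)"
  where "fac_sum N \<alpha> \<beta> =
    (\<lambda>x. fst \<alpha> x \<oplus>\<^bsub>fac0 N\<^esub> fst \<beta> x, \<lambda>x. snd \<alpha> x \<oplus>\<^bsub>fac1 N\<^esub> snd \<beta> x)"

definition fac_swap :: "('b \<Rightarrow> 'b) \<times> ('b \<Rightarrow> 'b) \<Rightarrow> ('b \<Rightarrow> 'b) \<times> ('b \<Rightarrow> 'b)"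
  where "fac_swap \<alpha> = (snd \<alpha>, fst \<alpha>)"

lemma mor_at_simps:
  "mor_at (fac_comp \<beta> \<alpha>) i x = mor_at \<beta> i (mor_at \<alpha> i x)"
  "mor_at (fac_sum N \<alpha> \<beta>) i x = mor_at \<alpha> i x \<oplus>\<^bsub>fac_mod N i\<^esub> mor_at \<beta> i x"
  "mor_at (fac_swap \<alpha>) i = mor_at \<alpha> (i - 1)"
  "mor_at (id, id) i = id"
  by (simp_all add: mor_at_def fac_comp_def fac_sum_def fac_swap_def fac_mod_def)

lemma fac_shift_at:
  "fac_mod (fac_shift M) i = fac_mod M (i - 1)"
  "fac_diff (fac_shift M) i x = \<ominus>\<^bsub>fac_mod M i\<^esub> fac_diff M (i - 1) x"
  by (simp_all add: fac_mod_def fac_diff_def fac_shift_def)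

lemma fac_mor_id: "(id, id) \<in> fac_mor S M M"
  using lin_hom_id by (auto simp: fac_mor_def id_def)

lemma fac_mor_comp:
  assumes \<alpha>: "\<alpha> \<in> fac_mor S M N" and \<beta>: "\<beta> \<in> fac_mor S N L"
  shows "fac_comp \<beta> \<alpha> \<in> fac_mor S M L"
proof -
  have "mor_at (fac_comp \<beta> \<alpha>) i \<in> lin_hom S (fac_mod M i) (fac_mod L i)" for i
    using lin_hom_comp[OF fac_morD(1)[OF \<alpha>] fac_morD(1)[OF \<beta>], of i]
    by (simp add: mor_at_simps(1)[abs_def])
  then show ?thesis
    using lin_hom_closed[OF fac_morD(1)[OF \<alpha>]]
    by (auto simp: fac_mor_iff mor_at_simps fac_morD(2)[OF \<alpha>] fac_morD(2)[OF \<beta>])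
qed

context factorization_reduction
begin

lemma fac_mor_sum:
  assumes N: "N \<in> Fac" and \<alpha>: "\<alpha> \<in> fac_mor S M N" and \<beta>: "\<beta> \<in> fac_mor S M N"
  shows "fac_sum N \<alpha> \<beta> \<in> fac_mor S M N"
proof -
  have "mor_at (fac_sum N \<alpha> \<beta>) i \<in> lin_hom S (fac_mod M i) (fac_mod N i)" for i
    using lin_hom_sum_map[OF fac_module[OF N] fac_morD(1)[OF \<alpha>] fac_morD(1)[OF \<beta>], of i]
    by (simp add: mor_at_simps(2)[abs_def])
  then show ?thesis
    using lin_hom_closed[OF fac_morD(1)[OF \<alpha>]] lin_hom_closed[OF fac_morD(1)[OF \<beta>]]
    by (auto simp: fac_mor_iff mor_at_simps fac_morD(2)[OF \<alpha>] fac_morD(2)[OF \<beta>]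
        lin_hom_add[OF factorizationD(2)[OF N]])
qed

lemma fac_shift_factorization:
  assumes M: "M \<in> Fac"
  shows "fac_shift M \<in> Fac"
proof -
  have C: "fac0 M \<in> C" "fac1 M \<in> C"
    and d: "dif1 M \<in> lin_hom S (fac1 M) (fac0 M)" "dif0 M \<in> lin_hom S (fac0 M) (fac1 M)"
    and dd: "\<And>x. x \<in> carrier (fac0 M) \<Longrightarrow> dif1 M (dif0 M x) = f \<odot>\<^bsub>fac0 M\<^esub> x"
      "\<And>x. x \<in> carrier (fac1 M) \<Longrightarrow> dif0 M (dif1 M x) = f \<odot>\<^bsub>fac1 M\<^esub> x"
    using M by (auto simp: factorizations_def)
  note M0 = C_module[OF C(1)] and M1 = C_module[OF C(2)]
  interpret M0: module S "fac0 M" by (rule M0)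
  interpret M1: module S "fac1 M" by (rule M1)
  show ?thesis
    using C lin_hom_neg_map[OF M0 d(1)] lin_hom_neg_map[OF M1 d(2)]
      lin_hom_closed[OF d(1)] lin_hom_closed[OF d(2)] dd f
    by (auto simp: factorizations_def fac_shift_def lin_hom_neg[OF M0 M1 d(2)] lin_hom_neg[OF M1 M0 d(1)])
qed

lemma fac_mor_swap:
  assumes M: "M \<in> Fac" and N: "N \<in> Fac" and \<alpha>: "\<alpha> \<in> fac_mor S M N"
  shows "fac_swap \<alpha> \<in> fac_mor S (fac_shift M) (fac_shift N)"
  unfolding fac_mor_iff
proof (intro allI conjI ballI)
  fix i
  show "mor_at (fac_swap \<alpha>) i \<in> lin_hom S (fac_mod (fac_shift M) i) (fac_mod (fac_shift N) i)"
    using fac_morD(1)[OF \<alpha>] by (simp add: fac_shift_at mor_at_simps)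
  fix x assume "x \<in> carrier (fac_mod (fac_shift M) i)"
  then have x: "x \<in> carrier (fac_mod M (i - 1))" by (simp add: fac_shift_at)
  have per: "mor_at \<alpha> (i - 2) = mor_at \<alpha> i" by (simp add: mor_at_def)
  have dx: "fac_diff M (i - 1) x \<in> carrier (fac_mod M i)"
    using lin_hom_closed[OF factorizationD(2)[OF M] x] by simp
  show "mor_at (fac_swap \<alpha>) (i - 1) (fac_diff (fac_shift M) i x) =
      fac_diff (fac_shift N) i (mor_at (fac_swap \<alpha>) i x)"
    using fac_morD(2)[OF \<alpha> x] lin_hom_neg[OF fac_module[OF M] fac_module[OF N] fac_morD(1)[OF \<alpha>] dx]
    by (simp add: fac_shift_at mor_at_simps per)
qed

abbreviation fac_class ::
    "('a, 'm) factorization \<Rightarrow> ('a, 'm) factorization \<Rightarrow> ('m \<Rightarrow> 'm) \<times> ('m \<Rightarrow> 'm) \<Rightarrow> (('m \<Rightarrow> 'm) \<times> ('m \<Rightarrow> 'm)) set"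
  where "fac_class M N \<alpha> \<equiv> fac_homotopic S M N `` {\<alpha>}"

abbreviation "A \<equiv> HF S C f"
abbreviation "K \<equiv> Ktac R W"
abbreviation "Th \<equiv> T_hom S R g"
abbreviation "Tsh M \<equiv> T (fac_shift M)"
abbreviation "shT M \<equiv> complex_shift (T M)"

lemma T_mor_eqI:
  assumes M: "M \<in> Fac" and N: "N \<in> Fac" and \<alpha>: "\<alpha> \<in> fac_mor S M N"
    and a: "a \<in> chain_maps R (T M) (T N)"
    and eq: "\<And>i x. x \<in> carrier (fac_mod M i) \<Longrightarrow>
      a i (unit_map (fac_mod M i) x) = unit_map (fac_mod N i) (mor_at \<alpha> i x)"
  shows "chain_class R (T M) (T N) (T_mor N \<alpha>) = chain_class R (T M) (T N) a"
  by (rule equiv_class_eq[OF chain_homotopic_equiv[OF T_is_complex[OF M] T_is_complex[OF N]]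
        T_map_eqI[OF M N \<alpha> a eq]])

lemma T_mor_id:
  assumes M: "M \<in> Fac"
  shows "chain_class R (T M) (T M) (T_mor M (id, id)) = chain_class R (T M) (T M) (\<lambda>i. id)"
  by (rule T_mor_eqI[OF M M fac_mor_id chain_maps_id]) (simp add: mor_at_simps)

lemma T_mor_comp_homotopic:
  assumes M: "M \<in> Fac" and N: "N \<in> Fac" and L: "L \<in> Fac"
    and \<alpha>: "\<alpha> \<in> fac_mor S M N" and \<beta>: "\<beta> \<in> fac_mor S N L"
  shows "(T_mor L (fac_comp \<beta> \<alpha>), \<lambda>i. T_mor L \<beta> i \<circ> T_mor N \<alpha> i) \<in> chain_homotopic R (T M) (T L)"
  by (rule T_map_eqI[OF M L fac_mor_comp[OF \<alpha> \<beta>]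
        chain_maps_comp[OF T_map_chain_map[OF M N \<alpha>] T_map_chain_map[OF N L \<beta>]]])
    (simp add: T_map_unit_map[OF M N \<alpha>] T_map_unit_map[OF N L \<beta>] lin_hom_closed[OF fac_morD(1)[OF \<alpha>]]
      mor_at_simps)

lemma T_mor_sum_homotopic:
  assumes M: "M \<in> Fac" and N: "N \<in> Fac"
    and \<alpha>: "\<alpha> \<in> fac_mor S M N" and \<beta>: "\<beta> \<in> fac_mor S M N"
  shows "(T_mor N (fac_sum N \<alpha> \<beta>), \<lambda>i x. T_mor N \<alpha> i x \<oplus>\<^bsub>cmod (T N) i\<^esub> T_mor N \<beta> i x)
    \<in> chain_homotopic R (T M) (T N)"
  by (rule T_map_eqI[OF M N fac_mor_sum[OF N \<alpha> \<beta>]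
        chain_maps_sum[OF T_is_complex[OF N] T_map_chain_map[OF M N \<alpha>] T_map_chain_map[OF M N \<beta>]]])
    (simp add: T_map_unit_map[OF M N \<alpha>] T_map_unit_map[OF M N \<beta>] T_obj_cmod mor_at_simps
      unit_map_add[OF fac_module[OF N]] lin_hom_closed[OF fac_morD(1)[OF \<alpha>]] lin_hom_closed[OF fac_morD(1)[OF \<beta>]])

text \<open>
  The reduced complex of a shifted factorization and the shift of the reduced complex have the same
  modules, and their differentials agree on carriers although they are different functions.  So the
  identity maps form an isomorphism between them in the homotopy category.
\<close>

lemma T_shift_simps:
  assumes M: "M \<in> Fac"
  shows "cmod (Tsh M) i = cmod (shT M) i"
    and "X \<in> carrier (cmod (Tsh M) i) \<Longrightarrow>
      cdiff (Tsh M) i X = cdiff (shT M) i X"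
proof -
  show "cmod (Tsh M) i = cmod (shT M) i"
    by (simp add: T_obj_cmod fac_shift_at complex_shift_def)
  assume "X \<in> carrier (cmod (Tsh M) i)"
  then obtain x where x: "x \<in> carrier (fac_mod (fac_shift M) i)" "X = unit_map (fac_mod (fac_shift M) i) x"
    by (rule T_element[OF fac_shift_factorization[OF M]])
  then have x': "x \<in> carrier (fac_mod M (i - 1))" by (simp add: fac_shift_at)
  have dx: "fac_diff M (i - 1) x \<in> carrier (fac_mod M i)"
    using lin_hom_closed[OF factorizationD(2)[OF M] x'] by simp
  show "cdiff (Tsh M) i X = cdiff (shT M) i X"
    using x T_cdiff_unit_map[OF fac_shift_factorization[OF M] x(1)] T_cdiff_unit_map[OF M x']
      unit_map_neg[OF fac_module[OF M] dx]
    by (simp add: fac_shift_at complex_shift_def T_obj_cmod)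
qed

lemma T_shift_identity:
  assumes M: "M \<in> Fac"
  shows "(\<lambda>i. id) \<in> chain_maps R (Tsh M) (shT M)"
    and "(\<lambda>i. id) \<in> chain_maps R (shT M) (Tsh M)"
  using T_shift_simps[OF M] by (simp_all add: chain_maps_def id_def lin_hom_id)

definition shift_iso where "shift_iso M = chain_class R (Tsh M) (shT M) (\<lambda>i. id)"

lemma shift_iso_arrow:
  assumes M: "M \<in> Fac"
  shows "iso_arrow K (Tsh M) (shT M) (shift_iso M)"
proof -
  note X = T_is_complex[OF fac_shift_factorization[OF M]] and Y = complex_shift_complex[OF T_is_complex[OF M]]
  have "(\<lambda>i. id \<circ> id) = (\<lambda>i :: int. id :: ('r \<times> 'm \<Rightarrow> 'r) set \<Rightarrow> _)" by simp
  then show ?thesis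
    unfolding iso_arrow_def shift_iso_def
    using Ktac_Comp[OF X Y X T_shift_identity[OF M], where W = W] Ktac_Comp[OF Y X Y T_shift_identity(2,1)[OF M], where W = W]
    by (auto simp: Ktac_simps(3) intro!: Ktac_HomI T_shift_identity[OF M]
        bexI[of _ "chain_class R (shT M) (Tsh M) (\<lambda>i. id)"])
qed

lemma HF_Comp:
  assumes M: "M \<in> Fac" and N: "N \<in> Fac" and L: "L \<in> Fac"
    and \<alpha>: "\<alpha> \<in> fac_mor S M N" and \<beta>: "\<beta> \<in> fac_mor S N L"
  shows "Comp A M N L (fac_class N L \<beta>) (fac_class M N \<alpha>) = fac_class M L (fac_comp \<beta> \<alpha>)"
  unfolding HF_def tri_category.simps fac_comp_def[symmetric]
proof (rule UN_class2[OF fac_homotopic_equiv[OF N L] fac_homotopic_equiv[OF M N] fac_homotopic_equiv[OF M L] \<beta> \<alpha>])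
  fix \<beta>' \<alpha>' assume h: "(\<beta>, \<beta>') \<in> fac_homotopic S N L" "(\<alpha>, \<alpha>') \<in> fac_homotopic S M N"
  then have \<alpha>': "\<alpha>' \<in> fac_mor S M N" and \<beta>': "\<beta>' \<in> fac_mor S N L"
    by (simp_all add: fac_homotopic_iff[OF M N] fac_homotopic_iff[OF N L])
  note eq = chain_homotopic_equiv[OF T_is_complex[OF M] T_is_complex[OF L]]
  have "(\<lambda>i. T_mor L \<beta> i \<circ> T_mor N \<alpha> i, \<lambda>i. T_mor L \<beta>' i \<circ> T_mor N \<alpha>' i) \<in> chain_homotopic R (T M) (T L)"
    using h by (intro chain_homotopic_comp[OF T_is_complex[OF M] T_is_complex[OF N] T_is_complex[OF L]])
      (simp_all add: fac_homotopic_iff[OF M N] fac_homotopic_iff[OF N L])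
  with T_mor_comp_homotopic[OF M N L \<alpha> \<beta>] T_mor_comp_homotopic[OF M N L \<alpha>' \<beta>']
  have "(T_mor L (fac_comp \<beta> \<alpha>), T_mor L (fac_comp \<beta>' \<alpha>')) \<in> chain_homotopic R (T M) (T L)"
    using eq by (meson equivE symD transD)
  then show "(fac_comp \<beta> \<alpha>, fac_comp \<beta>' \<alpha>') \<in> fac_homotopic S M L"
    by (simp add: fac_homotopic_iff[OF M L] fac_mor_comp[OF \<alpha> \<beta>] fac_mor_comp[OF \<alpha>' \<beta>'])
qed

lemma HF_Plus:
  assumes M: "M \<in> Fac" and N: "N \<in> Fac"
    and \<alpha>: "\<alpha> \<in> fac_mor S M N" and \<beta>: "\<beta> \<in> fac_mor S M N"
  shows "Plus A M N (fac_class M N \<alpha>) (fac_class M N \<beta>) = fac_class M N (fac_sum N \<alpha> \<beta>)"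
  unfolding HF_def tri_category.simps fac_sum_def[symmetric]
proof (rule UN_class2[OF fac_homotopic_equiv[OF M N] fac_homotopic_equiv[OF M N] fac_homotopic_equiv[OF M N] \<alpha> \<beta>])
  fix \<alpha>' \<beta>' assume h: "(\<alpha>, \<alpha>') \<in> fac_homotopic S M N" "(\<beta>, \<beta>') \<in> fac_homotopic S M N"
  then have \<alpha>': "\<alpha>' \<in> fac_mor S M N" and \<beta>': "\<beta>' \<in> fac_mor S M N"
    by (simp_all add: fac_homotopic_iff[OF M N])
  note eq = chain_homotopic_equiv[OF T_is_complex[OF M] T_is_complex[OF N]]
  have "(\<lambda>i x. T_mor N \<alpha> i x \<oplus>\<^bsub>cmod (T N) i\<^esub> T_mor N \<beta> i x,
      \<lambda>i x. T_mor N \<alpha>' i x \<oplus>\<^bsub>cmod (T N) i\<^esub> T_mor N \<beta>' i x) \<in> chain_homotopic R (T M) (T N)"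
    using h by (intro chain_homotopic_sum[OF T_is_complex[OF M] T_is_complex[OF N]])
      (simp_all add: fac_homotopic_iff[OF M N])
  with T_mor_sum_homotopic[OF M N \<alpha> \<beta>] T_mor_sum_homotopic[OF M N \<alpha>' \<beta>']
  have "(T_mor N (fac_sum N \<alpha> \<beta>), T_mor N (fac_sum N \<alpha>' \<beta>')) \<in> chain_homotopic R (T M) (T N)"
    using eq by (meson equivE symD transD)
  then show "(fac_sum N \<alpha> \<beta>, fac_sum N \<alpha>' \<beta>') \<in> fac_homotopic S M N"
    by (simp add: fac_homotopic_iff[OF M N] fac_mor_sum[OF N \<alpha> \<beta>] fac_mor_sum[OF N \<alpha>' \<beta>'])
qed

lemma T_mor_swap: "T_mor (fac_shift N) (fac_swap \<alpha>) i = T_mor N \<alpha> (i - 1)"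
  by (simp add: T_map_at fac_shift_at mor_at_simps)

text \<open>
  Transported along \<open>fac_homotopic_iff\<close> from the shift of complexes.
\<close>

lemma fac_homotopic_swap:
  assumes M: "M \<in> Fac" and N: "N \<in> Fac" and h: "(\<alpha>, \<beta>) \<in> fac_homotopic S M N"
  shows "(fac_swap \<alpha>, fac_swap \<beta>) \<in> fac_homotopic S (fac_shift M) (fac_shift N)"
proof -
  note M' = fac_shift_factorization[OF M] and N' = fac_shift_factorization[OF N]
  have \<alpha>: "\<alpha> \<in> fac_mor S M N" and \<beta>: "\<beta> \<in> fac_mor S M N"
    and "(T_mor N \<alpha>, T_mor N \<beta>) \<in> chain_homotopic R (T M) (T N)"
    using h by (simp_all add: fac_homotopic_iff[OF M N])
  note s = fac_mor_swap[OF M N \<alpha>] fac_mor_swap[OF M N \<beta>]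
  have "(\<lambda>i. T_mor N \<alpha> (i - 1), \<lambda>i. T_mor N \<beta> (i - 1)) \<in> chain_homotopic R (shT M) (shT N)"
    by (rule chain_homotopic_shift[OF T_is_complex[OF M] T_is_complex[OF N]]) fact
  then have "(T_mor (fac_shift N) (fac_swap \<alpha>), T_mor (fac_shift N) (fac_swap \<beta>)) \<in> chain_homotopic R (shT M) (shT N)"
    by (simp add: T_mor_swap[abs_def])
  then have "(T_mor (fac_shift N) (fac_swap \<alpha>), T_mor (fac_shift N) (fac_swap \<beta>)) \<in> chain_homotopic R (Tsh M) (Tsh N)"
    by (rule chain_homotopic_cong[OF _ T_map_chain_map[OF M' N' s(1)] T_map_chain_map[OF M' N' s(2)]])
      (simp_all add: T_shift_simps[OF M] T_shift_simps[OF N])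
  then show ?thesis using s by (simp add: fac_homotopic_iff[OF M' N'])
qed

lemma HF_ShiftH:
  assumes M: "M \<in> Fac" and N: "N \<in> Fac" and \<alpha>: "\<alpha> \<in> fac_mor S M N"
  shows "ShiftH A M N (fac_class M N \<alpha>) = fac_class (fac_shift M) (fac_shift N) (fac_swap \<alpha>)"
  unfolding HF_def tri_category.simps fac_swap_def[symmetric]
  by (rule UN_class[OF fac_homotopic_equiv[OF M N]
        fac_homotopic_equiv[OF fac_shift_factorization[OF M] fac_shift_factorization[OF N]] \<alpha>
        fac_homotopic_swap[OF M N]])

lemma T_hom_class:
  assumes M: "M \<in> Fac" and N: "N \<in> Fac" and \<alpha>: "\<alpha> \<in> fac_mor S M N"
  shows "Th M N (fac_class M N \<alpha>) = chain_class R (T M) (T N) (T_mor N \<alpha>)"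
  unfolding T_hom_def
  by (rule UN_class[OF fac_homotopic_equiv[OF M N]
        chain_homotopic_equiv[OF T_is_complex[OF M] T_is_complex[OF N]] \<alpha>
        fac_homotopic_imp_chain_homotopic[OF M N]])

lemma HF_HomE:
  assumes "a \<in> Hom A M N"
  obtains \<alpha> where "\<alpha> \<in> fac_mor S M N" "a = fac_class M N \<alpha>"
  using assms by (auto simp: HF_simps elim: quotientE)

lemma HF_HomI: "\<alpha> \<in> fac_mor S M N \<Longrightarrow> fac_class M N \<alpha> \<in> Hom A M N"
  by (auto simp: HF_simps intro: quotientI)

section \<open>The functor is additive, full and faithful\<close>

lemma T_hom_closed:
  assumes "M \<in> Fac" "N \<in> Fac" "a \<in> Hom A M N"
  shows "Th M N a \<in> Hom K (T M) (T N)"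
  using assms(3) by (elim HF_HomE) (simp add: T_hom_class[OF assms(1,2)] Ktac_HomI T_map_chain_map[OF assms(1,2)])

lemma T_hom_Comp:
  assumes M: "M \<in> Fac" and N: "N \<in> Fac" and L: "L \<in> Fac"
    and a: "a \<in> Hom A M N" and b: "b \<in> Hom A N L"
  shows "Th M L (Comp A M N L b a) = Comp K (T M) (T N) (T L) (Th N L b) (Th M N a)"
proof -
  from a obtain \<alpha> where \<alpha>: "\<alpha> \<in> fac_mor S M N" "a = fac_class M N \<alpha>" by (rule HF_HomE)
  from b obtain \<beta> where \<beta>: "\<beta> \<in> fac_mor S N L" "b = fac_class N L \<beta>" by (rule HF_HomE)
  show ?thesis
    unfolding \<alpha>(2) \<beta>(2) HF_Comp[OF M N L \<alpha>(1) \<beta>(1)] T_hom_class[OF M N \<alpha>(1)] T_hom_class[OF N L \<beta>(1)]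
      T_hom_class[OF M L fac_mor_comp[OF \<alpha>(1) \<beta>(1)]]
      Ktac_Comp[OF T_is_complex[OF M] T_is_complex[OF N] T_is_complex[OF L] T_map_chain_map[OF M N \<alpha>(1)]
        T_map_chain_map[OF N L \<beta>(1)]]
    by (rule equiv_class_eq[OF chain_homotopic_equiv[OF T_is_complex[OF M] T_is_complex[OF L]]
          T_mor_comp_homotopic[OF M N L \<alpha>(1) \<beta>(1)]])
qed

lemma T_hom_Plus:
  assumes M: "M \<in> Fac" and N: "N \<in> Fac"
    and a: "a \<in> Hom A M N" and b: "b \<in> Hom A M N"
  shows "Th M N (Plus A M N a b) = Plus K (T M) (T N) (Th M N a) (Th M N b)"
proof -
  from a obtain \<alpha> where \<alpha>: "\<alpha> \<in> fac_mor S M N" "a = fac_class M N \<alpha>" by (rule HF_HomE)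
  from b obtain \<beta> where \<beta>: "\<beta> \<in> fac_mor S M N" "b = fac_class M N \<beta>" by (rule HF_HomE)
  show ?thesis
    unfolding \<alpha>(2) \<beta>(2) HF_Plus[OF M N \<alpha>(1) \<beta>(1)] T_hom_class[OF M N \<alpha>(1)] T_hom_class[OF M N \<beta>(1)]
      T_hom_class[OF M N fac_mor_sum[OF N \<alpha>(1) \<beta>(1)]]
      Ktac_Plus[OF T_is_complex[OF M] T_is_complex[OF N] T_map_chain_map[OF M N \<alpha>(1)]
        T_map_chain_map[OF M N \<beta>(1)]]
    by (rule equiv_class_eq[OF chain_homotopic_equiv[OF T_is_complex[OF M] T_is_complex[OF N]]
          T_mor_sum_homotopic[OF M N \<alpha>(1) \<beta>(1)]])
qed

lemma T_hom_Ident: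
  assumes "M \<in> Fac"
  shows "Th M M (Ident A M) = Ident K (T M)"
  unfolding HF_simps Ktac_simps T_hom_class[OF assms assms fac_mor_id] by (rule T_mor_id[OF assms])

lemma T_additive: "additive_functor A K T Th"
  unfolding additive_functor_def HF_simps(1)
  by (auto simp: Ktac_simps(1) T_totally_acyclic T_hom_closed T_hom_Ident T_hom_Comp T_hom_Plus)

lemma T_full: "full_functor A K T Th"
  unfolding full_functor_def HF_simps(1)
proof (intro ballI subsetI)
  fix M N b assume M: "M \<in> Fac" and N: "N \<in> Fac"
    and "b \<in> Hom K (T M) (T N)"
  then obtain \<beta> where \<beta>: "\<beta> \<in> chain_maps R (T M) (T N)" "b = chain_class R (T M) (T N) \<beta>"
    by (elim Ktac_HomE)
  obtain \<alpha> where \<alpha>: "\<alpha> \<in> fac_mor S M N" "(T_mor N \<alpha>, \<beta>) \<in> chain_homotopic R (T M) (T N)"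
    by (rule chain_map_homotopic_to_T_map[OF M N \<beta>(1)])
  have "Th M N (fac_class M N \<alpha>) = b"
    unfolding T_hom_class[OF M N \<alpha>(1)] \<beta>(2)
    by (rule equiv_class_eq[OF chain_homotopic_equiv[OF T_is_complex[OF M] T_is_complex[OF N]] \<alpha>(2)])
  then show "b \<in> Th M N ` Hom A M N" using HF_HomI[OF \<alpha>(1)] by blast
qed

lemma T_faithful: "faithful_functor A K T Th"
  unfolding faithful_functor_def HF_simps(1)
proof (intro ballI inj_onI)
  fix M N a b assume M: "M \<in> Fac" and N: "N \<in> Fac"
    and a: "a \<in> Hom A M N" and b: "b \<in> Hom A M N" and eq: "Th M N a = Th M N b"
  from a obtain \<alpha> where \<alpha>: "\<alpha> \<in> fac_mor S M N" "a = fac_class M N \<alpha>" by (rule HF_HomE)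
  from b obtain \<beta> where \<beta>: "\<beta> \<in> fac_mor S M N" "b = fac_class M N \<beta>" by (rule HF_HomE)
  have "(T_mor N \<alpha>, T_mor N \<beta>) \<in> chain_homotopic R (T M) (T N)"
    using eq unfolding \<alpha>(2) \<beta>(2) T_hom_class[OF M N \<alpha>(1)] T_hom_class[OF M N \<beta>(1)]
    by (rule eq_equiv_class[OF _ chain_homotopic_equiv[OF T_is_complex[OF M] T_is_complex[OF N]]
          T_map_chain_map[OF M N \<beta>(1)]])
  then show "a = b"
    unfolding \<alpha>(2) \<beta>(2)
    by (intro equiv_class_eq[OF fac_homotopic_equiv[OF M N]])
      (simp add: fac_homotopic_iff[OF M N] \<alpha>(1) \<beta>(1))
qed

section \<open>The functor is triangulated\<close>

lemma shift_iso_natural: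
  assumes M: "M \<in> Fac" and N: "N \<in> Fac" and a: "a \<in> Hom A M N"
  shows "Comp K (Tsh M) (Tsh N) (shT N)
      (shift_iso N) (Th (fac_shift M) (fac_shift N) (ShiftH A M N a)) =
    Comp K (Tsh M) (shT M) (shT N)
      (ShiftH K (T M) (T N) (Th M N a)) (shift_iso M)"
proof -
  note M' = fac_shift_factorization[OF M] and N' = fac_shift_factorization[OF N]
  note X = T_is_complex[OF M'] and Y = T_is_complex[OF N'] and X' = complex_shift_complex[OF T_is_complex[OF M]]
    and Y' = complex_shift_complex[OF T_is_complex[OF N]]
  from a obtain \<alpha> where \<alpha>: "\<alpha> \<in> fac_mor S M N" "a = fac_class M N \<alpha>" by (rule HF_HomE)
  note s = fac_mor_swap[OF M N \<alpha>(1)]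
  note t = T_map_chain_map[OF M N \<alpha>(1)]
  note t' = chain_maps_shift[OF T_is_complex[OF M] T_is_complex[OF N] t]
  show ?thesis
    unfolding \<alpha>(2) HF_ShiftH[OF M N \<alpha>(1)] T_hom_class[OF M N \<alpha>(1)] T_hom_class[OF M' N' s] shift_iso_def
      Ktac_ShiftH[OF T_is_complex[OF M] T_is_complex[OF N] t]
      Ktac_Comp[OF X Y Y' T_map_chain_map[OF M' N' s] T_shift_identity(1)[OF N]]
      Ktac_Comp[OF X X' Y' T_shift_identity(1)[OF M] t']
  proof (rule chain_class_eqI[OF X Y' chain_maps_comp[OF T_map_chain_map[OF M' N' s] T_shift_identity(1)[OF N]]
        chain_maps_comp[OF T_shift_identity(1)[OF M] t']])
    show "(id \<circ> T_mor (fac_shift N) (fac_swap \<alpha>) i) X = (T_mor N \<alpha> (i - 1) \<circ> id) X" for i X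
      by (simp add: T_mor_swap)
  qed
qed

lemma T_iso:
  assumes M: "M \<in> Fac" and N: "N \<in> Fac" and iso: "iso_arrow A M N a"
  shows "iso_arrow K (T M) (T N) (Th M N a)"
proof -
  from iso obtain b where a: "a \<in> Hom A M N" and b: "b \<in> Hom A N M"
    and ba: "Comp A M N M b a = Ident A M" and ab: "Comp A N M N a b = Ident A N"
    by (auto simp: iso_arrow_def)
  show ?thesis
    unfolding iso_arrow_def
    using T_hom_closed[OF M N a] T_hom_closed[OF N M b] T_hom_Comp[OF M N M a b] T_hom_Comp[OF N M N b a]
    by (auto simp: ba ab T_hom_Ident[OF M] T_hom_Ident[OF N] intro!: bexI[of _ "Th N M b"])
qed

lemma base_change_direct_sum:
  assumes X: "X \<in> C" and Y: "Y \<in> C" and P: "P \<in> C" and ds: "direct_sum S X Y P i j p q"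
  shows "direct_sum R (bc X) (bc Y) (bc P)
    (bc_map P i) (bc_map P j)
    (bc_map X p) (bc_map Y q)"
proof -
  note XM = C_module[OF X] and YM = C_module[OF Y] and PM = C_module[OF P]
  have h: "i \<in> lin_hom S X P" "j \<in> lin_hom S Y P" "p \<in> lin_hom S P X" "q \<in> lin_hom S P Y"
    and eqs: "\<And>a. a \<in> carrier X \<Longrightarrow> p (i a) = a \<and> q (i a) = \<zero>\<^bsub>Y\<^esub>"
      "\<And>b. b \<in> carrier Y \<Longrightarrow> p (j b) = \<zero>\<^bsub>X\<^esub> \<and> q (j b) = b"
      "\<And>x. x \<in> carrier P \<Longrightarrow> i (p x) \<oplus>\<^bsub>P\<^esub> j (q x) = x"
    using ds by (auto simp: direct_sum_def)
  note u = base_change_map_unit_map[OF XM PM h(1)] base_change_map_unit_map[OF YM PM h(2)]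
    base_change_map_unit_map[OF PM XM h(3)] base_change_map_unit_map[OF PM YM h(4)]
  note cl = lin_hom_closed[OF h(1)] lin_hom_closed[OF h(2)] lin_hom_closed[OF h(3)] lin_hom_closed[OF h(4)]
  show ?thesis
    unfolding direct_sum_def
  proof (intro conjI ballI)
    fix a assume "a \<in> carrier (bc X)"
    then obtain x where "x \<in> carrier X" "a = unit_map X x" by (rule unit_map_surj[OF XM])
    then show "bc_map X p (bc_map P i a) = a"
      "bc_map Y q (bc_map P i a) = \<zero>\<^bsub>bc Y\<^esub>"
      using eqs(1) by (simp_all add: u cl unit_map_zero[OF YM])
  next
    fix b assume "b \<in> carrier (bc Y)"
    then obtain y where "y \<in> carrier Y" "b = unit_map Y y" by (rule unit_map_surj[OF YM])
    then show "bc_map X p (bc_map P j b) = \<zero>\<^bsub>bc X\<^esub>"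
      "bc_map Y q (bc_map P j b) = b"
      using eqs(2) by (simp_all add: u cl unit_map_zero[OF XM])
  next
    fix c assume "c \<in> carrier (bc P)"
    then obtain z where "z \<in> carrier P" "c = unit_map P z" by (rule unit_map_surj[OF PM])
    then show "bc_map P i (bc_map X p c) \<oplus>\<^bsub>bc P\<^esub>
        bc_map P j (bc_map Y q c) = c"
      using eqs(3) by (simp add: u cl unit_map_add[OF PM, symmetric])
  qed (intro base_change_map_lin_hom XM YM PM h)+
qed

text \<open>
  \<open>Z\<close> is the cone of \<open>\<alpha>\<close> with inclusions \<open>\<iota>\<close>, \<open>\<kappa>\<close> and projections \<open>\<pi>\<close>, \<open>\<rho>\<close>, stated for all degrees at
  once in the form that mapping cones of complexes take.
\<close>

definition cone_matrix where
  "cone_matrix \<alpha> \<iota> \<kappa> \<pi> \<rho> X Y Z \<longleftrightarrow>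
    (\<forall>n. direct_sum S (fac_mod Y n) (fac_mod X (n - 1)) (fac_mod Z n)
        (mor_at \<iota> n) (mor_at \<kappa> n) (mor_at \<pi> n) (mor_at \<rho> n)) \<and>
    (\<forall>n. \<forall>z \<in> carrier (fac_mod Z n). fac_diff Z n z =
        mor_at \<iota> (n - 1) (fac_diff Y n (mor_at \<pi> n z) \<oplus>\<^bsub>fac_mod Y (n - 1)\<^esub> mor_at \<alpha> (n - 1) (mor_at \<rho> n z))
        \<oplus>\<^bsub>fac_mod Z (n - 1)\<^esub> mor_at \<kappa> (n - 1) (\<ominus>\<^bsub>fac_mod X n\<^esub> fac_diff X (n - 1) (mor_at \<rho> n z)))"

text \<open>
  The inclusion \<open>\<iota>\<close> and the projection \<open>\<rho>\<close> commute with the differentials by the zero entry of the matrix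
  \<open>((d, \<alpha>), (0, -d))\<close>; the sign of its last entry is that of the shift.
\<close>

lemma cone_triangle_morphisms:
  assumes X: "X \<in> Fac" and Y: "Y \<in> Fac" and Z: "Z \<in> Fac"
    and std: "fac_cone_triangle S X Y Z u v w"
  obtains \<alpha> \<iota> \<kappa> \<pi> \<rho> where "\<alpha> \<in> fac_mor S X Y" "\<iota> \<in> fac_mor S Y Z" "\<rho> \<in> fac_mor S Z (fac_shift X)"
    and "cone_matrix \<alpha> \<iota> \<kappa> \<pi> \<rho> X Y Z"
    and "u = fac_class X Y \<alpha>" "v = fac_class Y Z \<iota>" "w = fac_class Z (fac_shift X) \<rho>"
proof -
  from std obtain \<alpha>0 \<alpha>1 i0 j0 p0 q0 i1 j1 p1 q1 where \<alpha>: "(\<alpha>0, \<alpha>1) \<in> fac_mor S X Y"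
    and ds0: "direct_sum S (fac0 Y) (fac1 X) (fac0 Z) i0 j0 p0 q0"
    and ds1: "direct_sum S (fac1 Y) (fac0 X) (fac1 Z) i1 j1 p1 q1"
    and d1: "\<forall>z \<in> carrier (fac1 Z). dif1 Z z =
          i0 (dif1 Y (p1 z) \<oplus>\<^bsub>fac0 Y\<^esub> \<alpha>0 (q1 z)) \<oplus>\<^bsub>fac0 Z\<^esub> j0 (\<ominus>\<^bsub>fac1 X\<^esub> dif0 X (q1 z))"
    and d0: "\<forall>z \<in> carrier (fac0 Z). dif0 Z z =
          i1 (dif0 Y (p0 z) \<oplus>\<^bsub>fac1 Y\<^esub> \<alpha>1 (q0 z)) \<oplus>\<^bsub>fac1 Z\<^esub> j1 (\<ominus>\<^bsub>fac0 X\<^esub> dif1 X (q0 z))"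
    and uvw: "u = fac_class X Y (\<alpha>0, \<alpha>1)" "v = fac_class Y Z (i0, i1)" "w = fac_class Z (fac_shift X) (q0, q1)"
    unfolding fac_cone_triangle_def by blast
  let ?\<alpha> = "(\<alpha>0, \<alpha>1)" and ?\<iota> = "(i0, i1)" and ?\<kappa> = "(j0, j1)" and ?\<pi> = "(p0, p1)" and ?\<rho> = "(q0, q1)"
  have ds: "direct_sum S (fac_mod Y n) (fac_mod X (n - 1)) (fac_mod Z n)
        (mor_at ?\<iota> n) (mor_at ?\<kappa> n) (mor_at ?\<pi> n) (mor_at ?\<rho> n)" for n
    using ds0 ds1 by (simp add: fac_mod_def mor_at_def)
  have d: "fac_diff Z n z =
        mor_at ?\<iota> (n - 1) (fac_diff Y n (mor_at ?\<pi> n z) \<oplus>\<^bsub>fac_mod Y (n - 1)\<^esub> mor_at ?\<alpha> (n - 1) (mor_at ?\<rho> n z))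
        \<oplus>\<^bsub>fac_mod Z (n - 1)\<^esub> mor_at ?\<kappa> (n - 1) (\<ominus>\<^bsub>fac_mod X n\<^esub> fac_diff X (n - 1) (mor_at ?\<rho> n z))"
    if "z \<in> carrier (fac_mod Z n)" for n z
    using that d0 d1 by (auto simp: fac_mod_def mor_at_def fac_diff_def)
  have h: "mor_at ?\<iota> n \<in> lin_hom S (fac_mod Y n) (fac_mod Z n)"
      "mor_at ?\<kappa> n \<in> lin_hom S (fac_mod X (n - 1)) (fac_mod Z n)"
      "mor_at ?\<pi> n \<in> lin_hom S (fac_mod Z n) (fac_mod Y n)"
      "mor_at ?\<rho> n \<in> lin_hom S (fac_mod Z n) (fac_mod X (n - 1))"
    and eqs: "\<And>a. a \<in> carrier (fac_mod Y n) \<Longrightarrow>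
        mor_at ?\<pi> n (mor_at ?\<iota> n a) = a \<and> mor_at ?\<rho> n (mor_at ?\<iota> n a) = \<zero>\<^bsub>fac_mod X (n - 1)\<^esub>"
      "\<And>b. b \<in> carrier (fac_mod X (n - 1)) \<Longrightarrow> mor_at ?\<rho> n (mor_at ?\<kappa> n b) = b" for n
    using ds[of n] unfolding direct_sum_def by auto
  have per: "mor_at ?\<kappa> (n - 1) \<in> lin_hom S (fac_mod X n) (fac_mod Z (n - 1))" for n
    using h(2)[of "n - 1"] by simp
  have "?\<iota> \<in> fac_mor S Y Z"
    unfolding fac_mor_iff
  proof (intro allI conjI ballI h(1))
    fix n y assume y: "y \<in> carrier (fac_mod Y n)"
    interpret Y: module S "fac_mod Y (n - 1)" by (rule fac_module[OF Y])
    interpret Z: module S "fac_mod Z (n - 1)" by (rule fac_module[OF Z])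
    interpret X: module S "fac_mod X n" by (rule fac_module[OF X])
    have dy: "fac_diff Y n y \<in> carrier (fac_mod Y (n - 1))" by (rule lin_hom_closed[OF factorizationD(2)[OF Y] y])
    have dX: "fac_diff X (n - 1) \<in> lin_hom S (fac_mod X (n - 1)) (fac_mod X n)"
      using factorizationD(2)[OF X, of "n - 1"] by simp
    have zX: "fac_diff X (n - 1) \<zero>\<^bsub>fac_mod X (n - 1)\<^esub> = \<zero>\<^bsub>fac_mod X n\<^esub>"
      by (rule lin_hom_zero[OF fac_module[OF X] fac_module[OF X] dX])
    have nz: "\<ominus>\<^bsub>fac_mod X n\<^esub> \<zero>\<^bsub>fac_mod X n\<^esub> = \<zero>\<^bsub>fac_mod X n\<^esub>"
      by (rule X.M.minus_equality) simp_all
    have z\<alpha>: "mor_at ?\<alpha> (n - 1) \<zero>\<^bsub>fac_mod X (n - 1)\<^esub> = \<zero>\<^bsub>fac_mod Y (n - 1)\<^esub>"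
      by (rule lin_hom_zero[OF fac_module[OF X] fac_module[OF Y] fac_morD(1)[OF \<alpha>]])
    have z\<kappa>: "mor_at ?\<kappa> (n - 1) \<zero>\<^bsub>fac_mod X n\<^esub> = \<zero>\<^bsub>fac_mod Z (n - 1)\<^esub>"
      by (rule lin_hom_zero[OF fac_module[OF X] fac_module[OF Z] per])
    have "fac_diff Z n (mor_at ?\<iota> n y) = mor_at ?\<iota> (n - 1) (fac_diff Y n y)"
      using d[OF lin_hom_closed[OF h(1) y]] eqs(1)[OF y] dy lin_hom_closed[OF h(1) dy]
      by (simp add: z\<alpha> zX z\<kappa> nz)
    then show "mor_at ?\<iota> (n - 1) (fac_diff Y n y) = fac_diff Z n (mor_at ?\<iota> n y)" by simp
  qed
  moreover have "?\<rho> \<in> fac_mor S Z (fac_shift X)"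
    unfolding fac_mor_iff
  proof (intro allI conjI ballI)
    show "mor_at ?\<rho> n \<in> lin_hom S (fac_mod Z n) (fac_mod (fac_shift X) n)" for n
      using h(4)[of n] by (simp add: fac_shift_at)
    fix n z assume z: "z \<in> carrier (fac_mod Z n)"
    interpret Y: module S "fac_mod Y (n - 1)" by (rule fac_module[OF Y])
    interpret X: module S "fac_mod X n" by (rule fac_module[OF X])
    have \<rho>z: "mor_at ?\<rho> n z \<in> carrier (fac_mod X (n - 1))" by (rule lin_hom_closed[OF h(4) z])
    have y: "fac_diff Y n (mor_at ?\<pi> n z) \<oplus>\<^bsub>fac_mod Y (n - 1)\<^esub> mor_at ?\<alpha> (n - 1) (mor_at ?\<rho> n z)
        \<in> carrier (fac_mod Y (n - 1))" (is "?y \<in> _")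
      using lin_hom_closed[OF factorizationD(2)[OF Y] lin_hom_closed[OF h(3) z]]
        lin_hom_closed[OF fac_morD(1)[OF \<alpha>] \<rho>z] by simp
    have x: "\<ominus>\<^bsub>fac_mod X n\<^esub> fac_diff X (n - 1) (mor_at ?\<rho> n z) \<in> carrier (fac_mod X n)" (is "?x \<in> _")
      using lin_hom_closed[OF factorizationD(2)[OF X] \<rho>z] by simp
    have x': "?x \<in> carrier (fac_mod X (n - 1 - 1))" using x by simp
    have \<rho>': "mor_at ?\<rho> (n - 1) \<in> lin_hom S (fac_mod Z (n - 1)) (fac_mod X n)" using h(4)[of "n - 1"] by simp
    have "mor_at ?\<rho> (n - 1) (fac_diff Z n z) = mor_at ?\<rho> (n - 1) (mor_at ?\<iota> (n - 1) ?y) \<oplus>\<^bsub>fac_mod X n\<^esub>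
        mor_at ?\<rho> (n - 1) (mor_at ?\<kappa> (n - 1) ?x)"
      unfolding d[OF z] by (rule lin_hom_add[OF \<rho>' lin_hom_closed[OF h(1) y] lin_hom_closed[OF per x]])
    also have "\<dots> = ?x" using eqs(1)[OF y] eqs(2)[OF x'] x by simp
    finally show "mor_at ?\<rho> (n - 1) (fac_diff Z n z) = fac_diff (fac_shift X) n (mor_at ?\<rho> n z)"
      by (simp add: fac_shift_at)
  qed
  moreover have "cone_matrix ?\<alpha> ?\<iota> ?\<kappa> ?\<pi> ?\<rho> X Y Z" unfolding cone_matrix_def using ds d by blast
  ultimately show ?thesis using that \<alpha> uvw by blast
qed

text \<open>
  Base change preserves the direct sum decompositions, and evaluation on elements \<open>1 \<otimes> z\<close> shows that the
  matrix of the differential is reduced entry by entry.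
\<close>

lemma T_standard_triangle:
  assumes X: "X \<in> Fac" and Y: "Y \<in> Fac" and Z: "Z \<in> Fac"
    and std: "fac_cone_triangle S X Y Z u v w"
  shows "complex_cone_triangle R (T X) (T Y) (T Z) (Th X Y u) (Th Y Z v)
      (Comp K (T Z) (Tsh X) (shT X) (shift_iso X) (Th Z (fac_shift X) w))"
    and "u \<in> Hom A X Y" "v \<in> Hom A Y Z" "w \<in> Hom A Z (fac_shift X)"
proof -
  obtain \<alpha> \<iota> \<kappa> \<pi> \<rho>
    where \<alpha>: "\<alpha> \<in> fac_mor S X Y" and \<iota>: "\<iota> \<in> fac_mor S Y Z" and \<rho>: "\<rho> \<in> fac_mor S Z (fac_shift X)"
    and cone: "cone_matrix \<alpha> \<iota> \<kappa> \<pi> \<rho> X Y Z"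
    and uvw: "u = fac_class X Y \<alpha>" "v = fac_class Y Z \<iota>" "w = fac_class Z (fac_shift X) \<rho>"
    by (rule cone_triangle_morphisms[OF X Y Z std]) (rule that)
  note ds = cone[unfolded cone_matrix_def, THEN conjunct1] and d = cone[unfolded cone_matrix_def, THEN conjunct2]
  note X' = fac_shift_factorization[OF X]
  show "u \<in> Hom A X Y" "v \<in> Hom A Y Z" "w \<in> Hom A Z (fac_shift X)"
    unfolding uvw by (intro HF_HomI \<alpha> \<iota> \<rho>)+
  let ?\<kappa> = "\<lambda>n. bc_map (fac_mod Z n) (mor_at \<kappa> n)"
  let ?\<pi> = "\<lambda>n. bc_map (fac_mod Y n) (mor_at \<pi> n)"
  have \<kappa>: "mor_at \<kappa> n \<in> lin_hom S (fac_mod X (n - 1)) (fac_mod Z n)"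
    and \<pi>: "mor_at \<pi> n \<in> lin_hom S (fac_mod Z n) (fac_mod Y n)" for n
    using ds unfolding direct_sum_def by auto
  have \<rho>_lin: "mor_at \<rho> n \<in> lin_hom S (fac_mod Z n) (fac_mod X (n - 1))" for n
    using fac_morD(1)[OF \<rho>] by (simp add: fac_shift_at)
  have \<rho>_at: "T_mor (fac_shift X) \<rho> n = bc_map (fac_mod X (n - 1)) (mor_at \<rho> n)" for n
    by (simp add: T_map_at fac_shift_at)
  have dsum: "direct_sum R (cmod (T Y) n) (cmod (T X) (n - 1)) (cmod (T Z) n)
      (T_mor Z \<iota> n) (?\<kappa> n) (?\<pi> n) (T_mor (fac_shift X) \<rho> n)" for n
    unfolding T_obj_cmod T_map_at fac_shift_at
    using ds by (intro base_change_direct_sum factorizationD(1) X Y Z) simp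
  have diff: "cdiff (T Z) n c = T_mor Z \<iota> (n - 1) (cdiff (T Y) n (?\<pi> n c) \<oplus>\<^bsub>cmod (T Y) (n - 1)\<^esub>
        T_mor Y \<alpha> (n - 1) (T_mor (fac_shift X) \<rho> n c)) \<oplus>\<^bsub>cmod (T Z) (n - 1)\<^esub>
        ?\<kappa> (n - 1) (\<ominus>\<^bsub>cmod (T X) (n - 2)\<^esub> cdiff (T X) (n - 1) (T_mor (fac_shift X) \<rho> n c))"
    if c: "c \<in> carrier (cmod (T Z) n)" for n c
  proof -
    from c obtain z where z: "z \<in> carrier (fac_mod Z n)" "c = unit_map (fac_mod Z n) z"
      by (rule T_element[OF Z])
    interpret Y: module S "fac_mod Y (n - 1)" by (rule fac_module[OF Y])
    interpret XM: module S "fac_mod X n" by (rule fac_module[OF X])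
    note \<pi>z = lin_hom_closed[OF \<pi> z(1)]
    note \<rho>z = lin_hom_closed[OF \<rho>_lin z(1)]
    note d\<pi>z = lin_hom_closed[OF factorizationD(2)[OF Y] \<pi>z]
    note \<alpha>\<rho>z = lin_hom_closed[OF fac_morD(1)[OF \<alpha>] \<rho>z]
    have d\<rho>z: "fac_diff X (n - 1) (mor_at \<rho> n z) \<in> carrier (fac_mod X n)"
      using lin_hom_closed[OF factorizationD(2)[OF X] \<rho>z] by simp
    have \<kappa>': "mor_at \<kappa> (n - 1) \<in> lin_hom S (fac_mod X n) (fac_mod Z (n - 1))" using \<kappa>[of "n - 1"] by simp
    let ?y = "fac_diff Y n (mor_at \<pi> n z) \<oplus>\<^bsub>fac_mod Y (n - 1)\<^esub> mor_at \<alpha> (n - 1) (mor_at \<rho> n z)"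
    let ?x = "\<ominus>\<^bsub>fac_mod X n\<^esub> fac_diff X (n - 1) (mor_at \<rho> n z)"
    have y: "?y \<in> carrier (fac_mod Y (n - 1))" using d\<pi>z \<alpha>\<rho>z by simp
    have x: "?x \<in> carrier (fac_mod X n)" using d\<rho>z by simp
    have \<rho>c: "T_mor (fac_shift X) \<rho> n c = unit_map (fac_mod X (n - 1)) (mor_at \<rho> n z)"
      unfolding \<rho>_at z(2) by (rule base_change_map_unit_map[OF fac_module[OF Z] fac_module[OF X] \<rho>_lin z(1)])
    have "cdiff (T Y) n (?\<pi> n c) = unit_map (fac_mod Y (n - 1)) (fac_diff Y n (mor_at \<pi> n z))"
      using base_change_map_unit_map[OF fac_module[OF Z] fac_module[OF Y] \<pi> z(1)] z(2)
        T_cdiff_unit_map[OF Y \<pi>z] by simp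
    moreover have "T_mor Y \<alpha> (n - 1) (T_mor (fac_shift X) \<rho> n c) =
        unit_map (fac_mod Y (n - 1)) (mor_at \<alpha> (n - 1) (mor_at \<rho> n z))"
      unfolding \<rho>c by (rule T_map_unit_map[OF X Y \<alpha> \<rho>z])
    ultimately have "cdiff (T Y) n (?\<pi> n c) \<oplus>\<^bsub>cmod (T Y) (n - 1)\<^esub>
        T_mor Y \<alpha> (n - 1) (T_mor (fac_shift X) \<rho> n c) = unit_map (fac_mod Y (n - 1)) ?y"
      using unit_map_add[OF fac_module[OF Y] d\<pi>z \<alpha>\<rho>z] by (simp add: T_obj_cmod)
    then have 1: "T_mor Z \<iota> (n - 1) (cdiff (T Y) n (?\<pi> n c) \<oplus>\<^bsub>cmod (T Y) (n - 1)\<^esub>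
        T_mor Y \<alpha> (n - 1) (T_mor (fac_shift X) \<rho> n c)) = unit_map (fac_mod Z (n - 1)) (mor_at \<iota> (n - 1) ?y)"
      using T_map_unit_map[OF Y Z \<iota> y] by simp
    have "\<ominus>\<^bsub>cmod (T X) (n - 2)\<^esub> cdiff (T X) (n - 1) (T_mor (fac_shift X) \<rho> n c) = unit_map (fac_mod X n) ?x"
      using T_cdiff_unit_map[OF X \<rho>z] unit_map_neg[OF fac_module[OF X] d\<rho>z]
      by (simp add: \<rho>c T_obj_cmod)
    then have 2: "?\<kappa> (n - 1) (\<ominus>\<^bsub>cmod (T X) (n - 2)\<^esub> cdiff (T X) (n - 1) (T_mor (fac_shift X) \<rho> n c)) =
        unit_map (fac_mod Z (n - 1)) (mor_at \<kappa> (n - 1) ?x)"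
      using base_change_map_unit_map[OF fac_module[OF X] fac_module[OF Z] \<kappa>' x] by simp
    have "cdiff (T Z) n c = unit_map (fac_mod Z (n - 1))
        (mor_at \<iota> (n - 1) ?y \<oplus>\<^bsub>fac_mod Z (n - 1)\<^esub> mor_at \<kappa> (n - 1) ?x)"
      using T_cdiff_unit_map[OF Z z(1)] d z by simp
    also have "\<dots> = unit_map (fac_mod Z (n - 1)) (mor_at \<iota> (n - 1) ?y) \<oplus>\<^bsub>cmod (T Z) (n - 1)\<^esub>
        unit_map (fac_mod Z (n - 1)) (mor_at \<kappa> (n - 1) ?x)"
      unfolding T_obj_cmod
      by (rule unit_map_add[OF fac_module[OF Z] lin_hom_closed[OF fac_morD(1)[OF \<iota>] y] lin_hom_closed[OF \<kappa>' x]])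
    finally show ?thesis by (simp only: 1 2)
  qed
  have w: "Comp K (T Z) (Tsh X) (shT X) (shift_iso X) (Th Z (fac_shift X) w) =
      chain_class R (T Z) (shT X) (T_mor (fac_shift X) \<rho>)"
  proof -
    have "Th Z (fac_shift X) w = chain_class R (T Z) (Tsh X) (T_mor (fac_shift X) \<rho>)"
      unfolding uvw by (rule T_hom_class[OF Z X' \<rho>])
    then show ?thesis
      using Ktac_Comp[OF T_is_complex[OF Z] T_is_complex[OF X'] complex_shift_complex[OF T_is_complex[OF X]]
          T_map_chain_map[OF Z X' \<rho>] T_shift_identity(1)[OF X], where W = W]
      by (simp add: shift_iso_def)
  qed
  show "complex_cone_triangle R (T X) (T Y) (T Z) (Th X Y u) (Th Y Z v)
      (Comp K (T Z) (Tsh X) (shT X) (shift_iso X) (Th Z (fac_shift X) w))"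
    unfolding uvw T_hom_class[OF X Y \<alpha>] T_hom_class[OF Y Z \<iota>] complex_cone_triangle_def
    by (rule bexI[OF _ T_map_chain_map[OF X Y \<alpha>]],
        rule exI[of _ "T_mor Z \<iota>"], rule exI[of _ ?\<kappa>], rule exI[of _ ?\<pi>],
        rule exI[of _ "T_mor (fac_shift X) \<rho>"])
      (simp add: dsum diff w[unfolded uvw])
qed

text \<open>
  An isomorphism of \<open>(u, v, w)\<close> with a standard triangle is mapped to one of the images; in the last
  square the naturality of the isomorphism between shifts enters.
\<close>

lemma T_exact_triangle:
  assumes "exact_triangle A X Y Z u v w"
  shows "exact_triangle K (T X) (T Y) (T Z) (Th X Y u) (Th Y Z v)
    (Comp K (T Z) (Tsh X) (shT X) (shift_iso X) (Th Z (fac_shift X) w))"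
proof -
  from assms have X: "X \<in> Fac" and Y: "Y \<in> Fac" and Z: "Z \<in> Fac"
    and u: "u \<in> Hom A X Y" and v: "v \<in> Hom A Y Z" and w: "w \<in> Hom A Z (fac_shift X)"
    by (simp_all add: exact_triangle_def HF_simps(1,4))
  from assms obtain X' Y' Z' u' v' w' a b c
    where X': "X' \<in> Fac" and Y': "Y' \<in> Fac" and Z': "Z' \<in> Fac"
    and std: "fac_cone_triangle S X' Y' Z' u' v' w'"
    and a: "iso_arrow A X X' a" and b: "iso_arrow A Y Y' b" and c: "iso_arrow A Z Z' c"
    and sq1: "Comp A X Y Y' b u = Comp A X X' Y' u' a"
    and sq2: "Comp A Y Z Z' c v = Comp A Y Y' Z' v' b"
    and sq3: "Comp A Z (fac_shift X) (fac_shift X') (ShiftH A X X' a) w = Comp A Z Z' (fac_shift X') w' c"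
    unfolding exact_triangle_def HF_simps(1,4,5) by blast
  note std' = T_standard_triangle[OF X' Y' Z' std]
  have a': "a \<in> Hom A X X'" and b': "b \<in> Hom A Y Y'" and c': "c \<in> Hom A Z Z'"
    using a b c by (simp_all add: iso_arrow_def)
  note sX = fac_shift_factorization[OF X] and sX' = fac_shift_factorization[OF X']
  have sa: "ShiftH A X X' a \<in> Hom A (fac_shift X) (fac_shift X')"
    using a' by (elim HF_HomE) (simp add: HF_ShiftH[OF X X'] HF_HomI[OF fac_mor_swap[OF X X']])
  have Ksa: "ShiftH K (T X) (T X') (Th X X' a) \<in> Hom K (shT X) (shT X')"
    using T_hom_closed[OF X X' a']
    by (elim Ktac_HomE) (simp add: Ktac_ShiftH[OF T_is_complex[OF X] T_is_complex[OF X']]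
        Ktac_HomI[OF chain_maps_shift[OF T_is_complex[OF X] T_is_complex[OF X']]])
  have t: "shift_iso X \<in> Hom K (Tsh X) (shT X)"
    "shift_iso X' \<in> Hom K (Tsh X') (shT X')"
    using shift_iso_arrow[OF X] shift_iso_arrow[OF X'] by (simp_all add: iso_arrow_def)
  note cx = T_is_complex[OF Z] T_is_complex[OF Z'] T_is_complex[OF sX] T_is_complex[OF sX']
    complex_shift_complex[OF T_is_complex[OF X]] complex_shift_complex[OF T_is_complex[OF X']]
  note Tw = T_hom_closed[OF Z sX w] and Tw' = T_hom_closed[OF Z' sX' std'(4)] and Tc = T_hom_closed[OF Z Z' c']
  let ?tw = "Comp K (T Z) (Tsh X) (shT X) (shift_iso X) (Th Z (fac_shift X) w)" and ?tw' = "Comp K (T Z') (Tsh X') (shT X') (shift_iso X') (Th Z' (fac_shift X') w')"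
    and ?sa = "ShiftH K (T X) (T X') (Th X X' a)"
  have square: "Comp K (T Z) (shT X) (shT X') ?sa
      ?tw =
    Comp K (T Z) (T Z') (shT X')
      ?tw' (Th Z Z' c)"
    (is "?lhs = ?rhs")
  proof -
    have "?lhs = Comp K (T Z) (Tsh X) (shT X')
        (Comp K (Tsh X) (shT X) (shT X')
          ?sa (shift_iso X)) (Th Z (fac_shift X) w)"
      by (rule Ktac_Comp_assoc[OF cx(1) cx(3) cx(5) cx(6) Tw t(1) Ksa, symmetric])
    also have "\<dots> = Comp K (T Z) (Tsh X) (shT X')
        (Comp K (Tsh X) (Tsh X') (shT X')
          (shift_iso X') (Th (fac_shift X) (fac_shift X') (ShiftH A X X' a))) (Th Z (fac_shift X) w)"
      by (simp only: shift_iso_natural[OF X X' a'])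
    also have "\<dots> = Comp K (T Z) (Tsh X') (shT X') (shift_iso X')
        (Comp K (T Z) (Tsh X) (Tsh X')
          (Th (fac_shift X) (fac_shift X') (ShiftH A X X' a)) (Th Z (fac_shift X) w))"
      by (rule Ktac_Comp_assoc[OF cx(1) cx(3) cx(4) cx(6) Tw T_hom_closed[OF sX sX' sa] t(2)])
    also have "\<dots> = Comp K (T Z) (Tsh X') (shT X') (shift_iso X')
        (Comp K (T Z) (T Z') (Tsh X') (Th Z' (fac_shift X') w') (Th Z Z' c))"
      by (simp only: T_hom_Comp[OF Z sX sX' w sa, symmetric] sq3 T_hom_Comp[OF Z Z' sX' c' std'(4)])
    also have "\<dots> = ?rhs"
      by (rule Ktac_Comp_assoc[OF cx(1) cx(2) cx(4) cx(6) Tc Tw' t(2), symmetric])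
    finally show ?thesis .
  qed
  show ?thesis
    unfolding exact_triangle_def Ktac_simps(1,4,5)
  proof (intro conjI exI)
    show "T X \<in> {T. totally_acyclic R W T}" "T Y \<in> {T. totally_acyclic R W T}" "T Z \<in> {T. totally_acyclic R W T}"
      using T_totally_acyclic X Y Z by auto
    show "Th X Y u \<in> Hom K (T X) (T Y)" "Th Y Z v \<in> Hom K (T Y) (T Z)"
      by (intro T_hom_closed X Y Z u v)+
    show "?tw
        \<in> Hom K (T Z) (shT X)"
      by (rule Ktac_Comp_closed[OF cx(1) cx(3) cx(5) Tw t(1)])
    show "T X' \<in> {T. totally_acyclic R W T}" "T Y' \<in> {T. totally_acyclic R W T}" "T Z' \<in> {T. totally_acyclic R W T}"
      using T_totally_acyclic X' Y' Z' by auto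
    show "complex_cone_triangle R (T X') (T Y') (T Z') (Th X' Y' u') (Th Y' Z' v')
      ?tw'"
      by (rule std'(1))
    show "iso_arrow K (T X) (T X') (Th X X' a)" "iso_arrow K (T Y) (T Y') (Th Y Y' b)"
      "iso_arrow K (T Z) (T Z') (Th Z Z' c)"
      by (intro T_iso X Y Z X' Y' Z' a b c)+
    show "Comp K (T X) (T Y) (T Y') (Th Y Y' b) (Th X Y u) = Comp K (T X) (T X') (T Y') (Th X' Y' u') (Th X X' a)"
      by (simp only: T_hom_Comp[OF X Y Y' u b', symmetric] sq1 T_hom_Comp[OF X X' Y' a' std'(2)])
    show "Comp K (T Y) (T Z) (T Z') (Th Z Z' c) (Th Y Z v) = Comp K (T Y) (T Y') (T Z') (Th Y' Z' v') (Th Y Y' b)"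
      by (simp only: T_hom_Comp[OF Y Z Z' v c', symmetric] sq2 T_hom_Comp[OF Y Y' Z' b' std'(3)])
    show "Comp K (T Z) (shT X) (shT X') ?sa
      ?tw =
    Comp K (T Z) (T Z') (shT X')
      ?tw' (Th Z Z' c)"
      by (rule square)
  qed
qed

lemma T_triangulated: "triangulated_functor A K T Th"
  unfolding triangulated_functor_def HF_simps(1,4) Ktac_simps(4)
  using T_additive shift_iso_arrow shift_iso_natural T_exact_triangle by (intro conjI exI[of _ shift_iso]) auto

end

section \<open>Passing to the quotient ring\<close>

lemma quotient_reduction:
  assumes S: "cring S" and f: "f \<in> carrier S"
  shows "reduction S (S Quot (PIdl\<^bsub>S\<^esub> f)) (\<lambda>s. PIdl\<^bsub>S\<^esub> f +>\<^bsub>S\<^esub> s) f"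
proof -
  interpret S: cring S by (rule S)
  interpret I: ideal "PIdl\<^bsub>S\<^esub> f" S by (rule S.cgenideal_ideal[OF f])
  show ?thesis
  proof (rule reduction.intro)
    show "cring (S Quot PIdl\<^bsub>S\<^esub> f)" by (rule I.quotient_is_cring[OF S])
    show "(\<lambda>s. PIdl\<^bsub>S\<^esub> f +>\<^bsub>S\<^esub> s) \<in> ring_hom S (S Quot PIdl\<^bsub>S\<^esub> f)" by (rule I.rcos_ring_hom)
    show "(\<lambda>s. PIdl\<^bsub>S\<^esub> f +>\<^bsub>S\<^esub> s) ` carrier S = carrier (S Quot PIdl\<^bsub>S\<^esub> f)"
      by (auto simp: FactRing_simps)
    show "(PIdl\<^bsub>S\<^esub> f +>\<^bsub>S\<^esub> s = \<zero>\<^bsub>S Quot PIdl\<^bsub>S\<^esub> f\<^esub>) = (\<exists>t\<in>carrier S. s = f \<otimes>\<^bsub>S\<^esub> t)"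
      if s: "s \<in> carrier S" for s
    proof -
      have "(PIdl\<^bsub>S\<^esub> f +>\<^bsub>S\<^esub> s = PIdl\<^bsub>S\<^esub> f) \<longleftrightarrow> s \<in> PIdl\<^bsub>S\<^esub> f"
      proof
        assume "PIdl\<^bsub>S\<^esub> f +>\<^bsub>S\<^esub> s = PIdl\<^bsub>S\<^esub> f"
        then show "s \<in> PIdl\<^bsub>S\<^esub> f" using I.a_rcos_self[OF s] by simp
      qed (rule I.a_rcos_const)
      also have "\<dots> \<longleftrightarrow> (\<exists>t\<in>carrier S. s = f \<otimes>\<^bsub>S\<^esub> t)"
      proof
        assume "s \<in> PIdl\<^bsub>S\<^esub> f"
        then obtain x where x: "x \<in> carrier S" "s = x \<otimes>\<^bsub>S\<^esub> f" unfolding cgenideal_def by blast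
        then have "s = f \<otimes>\<^bsub>S\<^esub> x" using S.m_comm[OF x(1) f] by simp
        with x(1) show "\<exists>t\<in>carrier S. s = f \<otimes>\<^bsub>S\<^esub> t" by (rule bexI[rotated])
      next
        assume "\<exists>t\<in>carrier S. s = f \<otimes>\<^bsub>S\<^esub> t"
        then obtain t where t: "t \<in> carrier S" "s = f \<otimes>\<^bsub>S\<^esub> t" ..
        then have "s = t \<otimes>\<^bsub>S\<^esub> f" using S.m_comm[OF f t(1)] by simp
        with t(1) show "s \<in> PIdl\<^bsub>S\<^esub> f" unfolding cgenideal_def by blast
      qed
      finally show ?thesis by (simp add: FactRing_def)
    qed
  qed (use S f in auto)
qed

theorem theorem3p5:
  fixes S :: "('a, 'x) ring_scheme"
    and C :: "('a, 'm) module set"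
    and f :: 'a
  assumes "cring S"
    and "additive_subcategory S C"
    and "self_orthogonal S C"
    and "f \<in> carrier S"
    and "ring_regular S f"
    and "\<forall>M \<in> C. module_regular M f"
  defines "R \<equiv> S Quot (PIdl\<^bsub>S\<^esub> f)"
    and "g \<equiv> (\<lambda>s. PIdl\<^bsub>S\<^esub> f +>\<^bsub>S\<^esub> s)"
  shows "triangulated_functor (HF S C f) (Ktac R (base_change_subcategory S R g C))
           (T_obj S R g) (T_hom S R g) \<and>
         full_functor (HF S C f) (Ktac R (base_change_subcategory S R g C))
           (T_obj S R g) (T_hom S R g) \<and>
         faithful_functor (HF S C f) (Ktac R (base_change_subcategory S R g C))
           (T_obj S R g) (T_hom S R g)"
proof -
  interpret reduction S R g f
    unfolding R_def g_def by (rule quotient_reduction[OF assms(1,4)])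
  interpret factorization_reduction S R g f C
  proof (intro factorization_reduction.intro factorization_reduction_axioms.intro reduction_axioms)
    show "module S M" if "M \<in> C" for M
      using assms(2) that by (simp add: additive_subcategory_def)
    show "module_regular M f" if "M \<in> C" for M
      using assms(6) that by simp
    show "zero_module (Ext S 1 M N)" if "M \<in> C" "N \<in> C" for M N
      using assms(3) that by (simp add: self_orthogonal_def)
  qed
  show ?thesis by (intro conjI T_triangulated T_full T_faithful)
qed

end
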